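(* Suppose the ignorability condition $R\perp\!\!\!\perp Y\mid X$ and the Basic Assumption (both stated in the context) hold, and $Na_N\to\infty$ as $N\to\infty$. Let $\mu(\cdot)$ be a (possibly misspecified) limit of the cross-fitted estimator $\hat m(\cdot)$ such that for every $k\le\mathbb K$ $$\mathbb E_X\Big[\frac{a_N}{\pi_N(X)}\{\hat m(X;\mathbb S_{-k})-\mu(X)\}^2\Big]=O_p(c_{\mu,N}^2),\qquad c_{\mu,N}=o(1).$$ Let $\tilde\theta=N^{-1}\sum_{i=1}^N\hat m(X_i)+N^{-1}\sum_{i=1}^N\frac{R_i}{\pi_N(X_i)}\{Y_i-\hat m(X_i)\}$ and $$\psi_{\mu,\pi}(Z)=\mu(X)+\frac{R}{\pi_N(X)}\{Y-\mu(X)\}-\theta_0 .$$ Then $$\tilde\theta-\theta_0=N^{-1}\sum_{i=1}^N\psi_{\mu,\pi}(Z_i)+O_p\Big(\frac{c_{\mu,N}}{\sqrt{Na_N}}\Big),\qquad V_N(\mu):=\mathrm{Var}\{\psi_{\mu,\pi}(Z)\}\asymp a_N^{-1}.$$ Alternatively, with $\tilde\psi_\mu(Z)=\frac{R}{\pi_N(X)}\{Y-\mu(X)\}-\mathbb E\big[\frac{R}{\pi_N(X)}\{Y-\mu(X)\}\big]$ (so that $\mathbb E\{\tilde\psi_\mu(Z)\}=0$), $$\tilde\theta-\theta_0=N^{-1}\sum_{i=1}^N\tilde\psi_\mu(Z_i)+O_p\Big(\frac{c_{\mu,N}}{\sqrt{Na_N}}+\frac1{\sqrt N}\Big),\qquad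 \tilde V_N(\mu):=\mathrm{Var}\{\tilde\psi_\mu(Z)\}\asymp a_N^{-1}.$$ If, additionally, for every $c>0$, $a_N^{-1}$-type tail control in the following form holds (Tail Condition): $$a_N^{-1}\,\mathbb E\Big[\psi_{\mu,\pi}^2(Z)\mathbf 1\{|\psi_{\mu,\pi}(Z)|>c\sqrt{N/a_N}\}\Big]\to0\quad(N\to\infty),$$ then $$(Na_N)^{1/2}(\tilde\theta-\theta_0)=O_p(1),\qquad N^{1/2}V_N^{-1/2}(\mu)(\tilde\theta-\theta_0)\xrightarrow{d}\mathcal N(0,1).$$ Moreover, if in addition $a_N\to0$ as $N\to\infty$, then $$N^{1/2}\tilde V_N^{-1/2}(\mu)(\tilde\theta-\theta_0)\xrightarrow{d}\mathcal N(0,1),\qquad \frac{V_N(\mu)}{\tilde V_N(\mu)}=1+O(a_N).$$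
   Context: Setting. For each $N$ the data $\mathbb S=\{Z_i=(R_i,R_iY_i,X_i)\}_{i=1}^N$ are i.i.d. copies of $Z=(R,RY,X)$, with $R\in\{0,1\}$ (labeling indicator), $Y\in\mathbb R$, $X\in\mathbb R^p$; $\mathcal X$ is the support of the law $\mathbb P_X$ of $X$. The law of $R$ given $X$ (and $p$) may depend on $N$ (triangular array); this dependence is suppressed. $\theta_0=\mathbb E(Y)$, $m(x)=\mathbb E(Y\mid X=x)$, $\pi_N(x)=\mathbb P(R=1\mid X=x)$ (here a known function). It is assumed that $\mathbb E\{\pi_N^{-1}(X)\}<\infty$ for each $N$, and $a_N:=[\mathbb E\{\pi_N^{-1}(X)\}]^{-1}$ (which may tend to $0$). Cross-fitting. For a fixed integer $\mathbb K\ge2$, $\{\mathcal I_k\}_{k=1}^{\mathbb K}$ is a random partition of $\{1,\dots,N\}$ (independent of the data); $\mathbb S_{-k}=\{Z_i:i\notin\mathcal I_k\}$; $\hat m(\cdot;\mathbb S_{-k})$ is an estimator of $m(\cdot)$ built from $\mathbb S_{-k}$ only; and $\hat m(X_i):=\hat m(X_i;\mathbb S_{-k(i)})$ where $k(i)$ is the unique $k$ with $i\in\mathcal I_k$. $\mathbb E_X$ denotes expectation over an independent copy of $X$ with the estimators (training data) held fixed. $\mu(\cdot)$ is a nonrandom function, $\mu\ne m$ allowed. Basic Assumption. (a) $Z$ has finite second moments and $\mathrm{Var}(X)$ is positive definite. (b) There are constants $0<\sigma_{\zeta,1}^2$, $\sigma_{\zeta,2}^2<\infty$ (not depending on $N$)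 with $\mathbb E[\{Y-m(X)\}^2\mid X=x]\ge\sigma_{\zeta,1}^2$ and $\mathbb E[\{Y-\mu(X)\}^2\mid X=x]\le\sigma_{\zeta,2}^2$ for all $x\in\mathcal X$, and $\mathrm{Var}(Y)\le\sigma_{\zeta,2}^2$. $u_N\asymp v_N$ means $cv_N<u_N<Cv_N$ for some constants $c,C>0$ and all large $N$. *)

theory Defs
  imports "HOL-Probability.Probability" "HOL-Library.Landau_Symbols"
begin

text \<open>
  Everything is a triangular array: for every sample size \<open>N\<close> there is a population space carrying
  a generic \<open>(R, Y, X)\<close>, and a sample space carrying the data and the random partition. Since the
  dimension \<open>p\<close> may vary with \<open>N\<close>, vectors in \<open>\<real>\<^sup>p\<close> are functions on \<open>{..<p}\<close>.
\<close>

definition cov_space :: "nat \<Rightarrow> (nat \<Rightarrow> real) measure" where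
  "cov_space p = (\<Pi>\<^sub>M j\<in>{..<p}. borel)"

definition obs_space :: "nat \<Rightarrow> (real \<times> real \<times> (nat \<Rightarrow> real)) measure" where
  "obs_space p = borel \<Otimes>\<^sub>M (borel \<Otimes>\<^sub>M cov_space p)"

definition obs :: "real \<Rightarrow> real \<Rightarrow> (nat \<Rightarrow> real) \<Rightarrow> real \<times> real \<times> (nat \<Rightarrow> real)" where
  "obs r y x = (r, r * y, x)"

definition sigma_of :: "'b measure \<Rightarrow> nat \<Rightarrow> ('b \<Rightarrow> nat \<Rightarrow> real) \<Rightarrow> 'b measure" where
  "sigma_of Q p X = vimage_algebra (space Q) X (cov_space p)"

definition cond_indep_given ::
  "'b measure \<Rightarrow> 'b measure \<Rightarrow> ('b \<Rightarrow> real) \<Rightarrow> ('b \<Rightarrow> real) \<Rightarrow> bool" where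
  "cond_indep_given Q F U V \<longleftrightarrow>
     (\<forall>A\<in>sets borel. \<forall>B\<in>sets borel. AE \<omega> in Q.
        real_cond_exp Q F (\<lambda>\<omega>. indicator A (U \<omega>) * indicator B (V \<omega>)) \<omega> =
        real_cond_exp Q F (\<lambda>\<omega>. indicator A (U \<omega>)) \<omega> *
        real_cond_exp Q F (\<lambda>\<omega>. indicator B (V \<omega>)) \<omega>)"

text \<open>
  The inverse is taken in the extended nonnegative reals, where \<open>inverse 0 = \<infinity>\<close>; hence
  finiteness forces \<open>\<pi>(X) > 0\<close> almost surely.
\<close>

definition mean_inv_ps ::
  "'b measure \<Rightarrow> ('b \<Rightarrow> nat \<Rightarrow> real) \<Rightarrow> ((nat \<Rightarrow> real) \<Rightarrow> real) \<Rightarrow> ennreal" where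
  "mean_inv_ps Q X \<pi> = (\<integral>\<^sup>+\<omega>. inverse (ennreal (\<pi> (X \<omega>))) \<partial>Q)"

definition a_rate ::
  "'b measure \<Rightarrow> ('b \<Rightarrow> nat \<Rightarrow> real) \<Rightarrow> ((nat \<Rightarrow> real) \<Rightarrow> real) \<Rightarrow> real" where
  "a_rate Q X \<pi> = 1 / enn2real (mean_inv_ps Q X \<pi>)"

text \<open>
  The functions \<open>m\<close> and \<open>\<pi>\<close> are (versions of) the regression functions
  \<open>E(Y | X = x)\<close> and \<open>P(R = 1 | X = x)\<close>.
\<close>

locale population = prob_space Q
  for Q :: "'b measure" and p :: nat and R Y :: "'b \<Rightarrow> real" and X :: "'b \<Rightarrow> nat \<Rightarrow> real"
    and m \<pi> :: "(nat \<Rightarrow> real) \<Rightarrow> real" +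
  assumes R_measurable: "R \<in> borel_measurable Q"
    and Y_measurable: "Y \<in> borel_measurable Q"
    and X_measurable: "X \<in> measurable Q (cov_space p)"
    and R_binary: "\<And>\<omega>. \<omega> \<in> space Q \<Longrightarrow> R \<omega> \<in> {0, 1}"
    and Y_integrable: "integrable Q Y"
    and m_measurable: "m \<in> borel_measurable (cov_space p)"
    and m_regression: "AE \<omega> in Q. real_cond_exp Q (sigma_of Q p X) Y \<omega> = m (X \<omega>)"
    and ps_measurable: "\<pi> \<in> borel_measurable (cov_space p)"
    and ps_propensity:
      "AE \<omega> in Q. real_cond_exp Q (sigma_of Q p X) (\<lambda>\<omega>. indicator {1} (R \<omega>)) \<omega> = \<pi> (X \<omega>)"
    and mean_inv_ps_finite: "mean_inv_ps Q X \<pi> < \<infinity>"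

definition covariance :: "'b measure \<Rightarrow> ('b \<Rightarrow> real) \<Rightarrow> ('b \<Rightarrow> real) \<Rightarrow> real" where
  "covariance Q U V =
     (\<integral>\<omega>. (U \<omega> - (\<integral>\<omega>'. U \<omega>' \<partial>Q)) * (V \<omega> - (\<integral>\<omega>'. V \<omega>' \<partial>Q)) \<partial>Q)"

text \<open>
  Conditional expectations given \<open>X = x\<close> are determined only up to null sets of the law of \<open>X\<close>, so
  the bounds over the support of \<open>X\<close> are almost sure bounds. The nonnegative conditional expectation
  takes the value \<open>\<infinity>\<close> where appropriate, so that the upper bound also expresses
  integrability.
\<close>

definition basic_assumption ::
  "'b measure \<Rightarrow> nat \<Rightarrow> ('b \<Rightarrow> real) \<Rightarrow> ('b \<Rightarrow> real) \<Rightarrow> ('b \<Rightarrow> nat \<Rightarrow> real) \<Rightarrow>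
   ((nat \<Rightarrow> real) \<Rightarrow> real) \<Rightarrow> ((nat \<Rightarrow> real) \<Rightarrow> real) \<Rightarrow> real \<Rightarrow> real \<Rightarrow> bool" where
  "basic_assumption Q p R Y X m \<mu> v\<^sub>1 v\<^sub>2 \<longleftrightarrow>
     integrable Q (\<lambda>\<omega>. (R \<omega>)\<^sup>2) \<and>
     integrable Q (\<lambda>\<omega>. (R \<omega> * Y \<omega>)\<^sup>2) \<and>
     (\<forall>j<p. integrable Q (\<lambda>\<omega>. (X \<omega> j)\<^sup>2)) \<and>
     (\<forall>u :: nat \<Rightarrow> real. (\<exists>j<p. u j \<noteq> 0) \<longrightarrow>
        0 < (\<Sum>i<p. \<Sum>j<p. u i * covariance Q (\<lambda>\<omega>. X \<omega> i) (\<lambda>\<omega>. X \<omega> j) * u j)) \<and>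
     (AE \<omega> in Q.
        nn_cond_exp Q (sigma_of Q p X) (\<lambda>\<omega>. ennreal ((Y \<omega> - m (X \<omega>))\<^sup>2)) \<omega> \<ge> ennreal v\<^sub>1) \<and>
     (AE \<omega> in Q.
        nn_cond_exp Q (sigma_of Q p X) (\<lambda>\<omega>. ennreal ((Y \<omega> - \<mu> (X \<omega>))\<^sup>2)) \<omega> \<le> ennreal v\<^sub>2) \<and>
     integrable Q (\<lambda>\<omega>. (Y \<omega>)\<^sup>2) \<and> prob_space.variance Q Y \<le> v\<^sub>2"

text \<open>
  In the following locale \<open>L\<close> is the law of a single observation, \<open>I k\<close> is the random \<open>k\<close>-th block of
  the partition, and \<open>mhat J z\<close> is the function estimated from the data set \<open>(z\<^sub>i)\<close>, \<open>i \<in> J\<close>.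
  Blocks may be empty.
\<close>

locale crossfit_sample = prob_space M
  for M :: "'a measure" and N p K :: nat and L :: "(real \<times> real \<times> (nat \<Rightarrow> real)) measure"
    and R Y :: "nat \<Rightarrow> 'a \<Rightarrow> real" and X :: "nat \<Rightarrow> 'a \<Rightarrow> nat \<Rightarrow> real"
    and I :: "nat \<Rightarrow> 'a \<Rightarrow> nat set"
    and mhat ::
      "nat set \<Rightarrow> (nat \<Rightarrow> real \<times> real \<times> (nat \<Rightarrow> real)) \<Rightarrow> (nat \<Rightarrow> real) \<Rightarrow> real" +
  assumes R_measurable: "\<And>i. i \<in> {1..N} \<Longrightarrow> R i \<in> borel_measurable M"
    and Y_measurable: "\<And>i. i \<in> {1..N} \<Longrightarrow> Y i \<in> borel_measurable M"
    and X_measurable: "\<And>i. i \<in> {1..N} \<Longrightarrow> X i \<in> measurable M (cov_space p)"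
    and R_binary: "\<And>i \<omega>. i \<in> {1..N} \<Longrightarrow> \<omega> \<in> space M \<Longrightarrow> R i \<omega> \<in> {0, 1}"
    and data_indep:
      "indep_vars (\<lambda>_. obs_space p) (\<lambda>i \<omega>. obs (R i \<omega>) (Y i \<omega>) (X i \<omega>)) {1..N}"
    and data_law:
      "\<And>i. i \<in> {1..N} \<Longrightarrow> distr M (obs_space p) (\<lambda>\<omega>. obs (R i \<omega>) (Y i \<omega>) (X i \<omega>)) = L"
    and blocks_measurable:
      "\<And>k. k \<in> {1..K} \<Longrightarrow> I k \<in> measurable M (count_space (Pow {1..N}))"
    and blocks_disjoint:
      "\<And>\<omega>. \<omega> \<in> space M \<Longrightarrow> disjoint_family_on (\<lambda>k. I k \<omega>) {1..K}"
    and blocks_cover: "\<And>\<omega>. \<omega> \<in> space M \<Longrightarrow> (\<Union>k\<in>{1..K}. I k \<omega>) = {1..N}"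
    and partition_indep_data:
      "indep_set
         (sets (vimage_algebra (space M) (\<lambda>\<omega>. \<lambda>k\<in>{1..K}. I k \<omega>)
            (\<Pi>\<^sub>M k\<in>{1..K}. count_space (Pow {1..N}))))
         (sets (vimage_algebra (space M) (\<lambda>\<omega>. \<lambda>i\<in>{1..N}. obs (R i \<omega>) (Y i \<omega>) (X i \<omega>))
            (\<Pi>\<^sub>M i\<in>{1..N}. obs_space p)))"
    and mhat_measurable:
      "\<And>J. J \<subseteq> {1..N} \<Longrightarrow>
         (\<lambda>(z, x). mhat J z x) \<in> borel_measurable ((\<Pi>\<^sub>M i\<in>J. obs_space p) \<Otimes>\<^sub>M cov_space p)"

text \<open>
  The remaining definitions of estimators are pointwise; their arguments are realized values of the
  blocks and of the data.
\<close>

definition held_out_fit ::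
  "nat \<Rightarrow> (nat set \<Rightarrow> (nat \<Rightarrow> real \<times> real \<times> (nat \<Rightarrow> real)) \<Rightarrow> (nat \<Rightarrow> real) \<Rightarrow> real) \<Rightarrow>
   (nat \<Rightarrow> nat set) \<Rightarrow> (nat \<Rightarrow> real) \<Rightarrow> (nat \<Rightarrow> real) \<Rightarrow> (nat \<Rightarrow> nat \<Rightarrow> real) \<Rightarrow>
   nat \<Rightarrow> (nat \<Rightarrow> real) \<Rightarrow> real" where
  "held_out_fit N mhat I r y x k =
     mhat ({1..N} - I k) (\<lambda>i\<in>{1..N} - I k. obs (r i) (y i) (x i))"

definition fold_of :: "nat \<Rightarrow> (nat \<Rightarrow> nat set) \<Rightarrow> nat \<Rightarrow> nat" where
  "fold_of K I i = (THE k. k \<in> {1..K} \<and> i \<in> I k)"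

definition theta_tilde ::
  "nat \<Rightarrow> nat \<Rightarrow> ((nat \<Rightarrow> real) \<Rightarrow> real) \<Rightarrow>
   (nat set \<Rightarrow> (nat \<Rightarrow> real \<times> real \<times> (nat \<Rightarrow> real)) \<Rightarrow> (nat \<Rightarrow> real) \<Rightarrow> real) \<Rightarrow>
   (nat \<Rightarrow> nat set) \<Rightarrow> (nat \<Rightarrow> real) \<Rightarrow> (nat \<Rightarrow> real) \<Rightarrow> (nat \<Rightarrow> nat \<Rightarrow> real) \<Rightarrow> real" where
  "theta_tilde N K \<pi> mhat I r y x =
     (let fit = (\<lambda>i. held_out_fit N mhat I r y x (fold_of K I i) (x i))
      in (\<Sum>i=1..N. fit i) / real N + (\<Sum>i=1..N. r i / \<pi> (x i) * (y i - fit i)) / real N)"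

definition weighted_sq_error ::
  "'b measure \<Rightarrow> nat \<Rightarrow> ('b \<Rightarrow> nat \<Rightarrow> real) \<Rightarrow> ((nat \<Rightarrow> real) \<Rightarrow> real) \<Rightarrow>
   ((nat \<Rightarrow> real) \<Rightarrow> real) \<Rightarrow> ((nat \<Rightarrow> real) \<Rightarrow> real) \<Rightarrow> ennreal" where
  "weighted_sq_error Q p X \<pi> f \<mu> =
     (\<integral>\<^sup>+x. ennreal (a_rate Q X \<pi> / \<pi> x * (f x - \<mu> x)\<^sup>2) \<partial>(distr Q (cov_space p) X))"

definition ipw_residual ::
  "((nat \<Rightarrow> real) \<Rightarrow> real) \<Rightarrow> ((nat \<Rightarrow> real) \<Rightarrow> real) \<Rightarrow> real \<Rightarrow> real \<Rightarrow> (nat \<Rightarrow> real) \<Rightarrow> real" where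
  "ipw_residual \<pi> \<mu> r y x = r / \<pi> x * (y - \<mu> x)"

text \<open>
  Stochastic order \<open>O\<^sub>p(r)\<close> of an array of \<open>[0, \<infinity>]\<close>-valued variables living on possibly
  different probability spaces. Measurability is included because the measure of a nonmeasurable
  set is zero by convention.
\<close>

definition Op :: "(nat \<Rightarrow> 'a measure) \<Rightarrow> (nat \<Rightarrow> 'a \<Rightarrow> ennreal) \<Rightarrow> (nat \<Rightarrow> real) \<Rightarrow> bool" where
  "Op M U r \<longleftrightarrow>
     (\<forall>\<epsilon>>0. \<exists>C>0. \<forall>\<^sub>F N in sequentially.
        U N \<in> borel_measurable (M N) \<and>
        measure (M N) {\<omega> \<in> space (M N). U N \<omega> > ennreal (C * r N)} \<le> \<epsilon>)"

abbreviation Op_real :: "(nat \<Rightarrow> 'a measure) \<Rightarrow> (nat \<Rightarrow> 'a \<Rightarrow> real) \<Rightarrow> (nat \<Rightarrow> real) \<Rightarrow> bool" where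
  "Op_real M U r \<equiv>
     (\<forall>\<^sub>F N in sequentially. U N \<in> borel_measurable (M N)) \<and>
     Op M (\<lambda>N \<omega>. ennreal \<bar>U N \<omega>\<bar>) r"

definition same_order :: "(nat \<Rightarrow> real) \<Rightarrow> (nat \<Rightarrow> real) \<Rightarrow> bool" where
  "same_order u v \<longleftrightarrow>
     (\<exists>c>0. \<exists>C>0. \<forall>\<^sub>F N in sequentially. c * v N < u N \<and> u N < C * v N)"

end

theory Submission
  imports Defs
begin

text \<open>
  Writing \<open>\<psi> = (Y - \<theta>\<^sub>0) + (R / \<pi>(X) - 1) (Y - \<mu>(X))\<close>, ignorability makes the two summands uncorrelated and
  gives \<open>V = Var Y + E[(1 / \<pi>(X) - 1) (Y - \<mu>(X))\<^sup>2]\<close>; the variance of the second influence function has the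
  same form with \<open>Var (Y - \<mu>(X))\<close> in place of \<open>Var Y\<close>. Both lie between \<open>v\<^sub>1 / a\<close> and \<open>v\<^sub>2 / a\<close>
  and differ by at most \<open>v\<^sub>2\<close>.

  The remainder of the expansion is the average of \<open>(1 - R / \<pi>(X)) (mhat(X) - \<mu>(X))\<close>. Given the partition
  and the training data of one fold, its terms over the held-out block are independent and centred with
  second moment at most \<open>W / a\<close>, where \<open>W\<close> is the weighted squared error of the fit; truncating to
  \<open>W \<le> C c\<^sub>\<mu>\<^sup>2\<close> and applying Markov's inequality gives its order. Asymptotic normality is Lindeberg's
  theorem for the leading average, proved by characteristic functions, followed by a perturbation.
\<close>

section \<open>Independence and second moments\<close>

text \<open>Since the error of the fit is controlled only in probability, the remainder need not
  have a second moment. Truncation works because its indicator depends on the training data alone: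
  once these are frozen it is constant, so the held-out terms stay independent and centred. The
  block being random, this argument is run for each of its finitely many possible values
  \<open>J\<close>, and independence of partition and data lets the bounds be averaged over
  \<open>J\<close>.

  Ignorability is given for events only. It is first raised to an identity of measures:
  \<open>R\<close> and \<open>\<pi>(X)\<close>, used as densities, give the same image measure under
  \<open>(Y, X)\<close>. Every moment of \<open>R / \<pi>(X)\<close> is read off from it,
  integrability included.

  In the sample only the law of \<open>(R, R Y, X)\<close> is prescribed, so each statistic has to
  be written as a function of that triple before it can be compared with the population.

  The probability spaces change with \<open>N\<close>; hence limits in law are handled through
  characteristic functions, and all bounds depend on the population only via
  \<open>v\<^sub>1\<close>, \<open>v\<^sub>2\<close> and \<open>a\<close>.\<close>

lemma (in prob_space) nn_integral_indep_var:
  assumes ind: "indep_var S A T B" and F[measurable]: "F \<in> borel_measurable (S \<Otimes>\<^sub>M T)"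
  shows "(\<integral>\<^sup>+\<omega>. F (A \<omega>, B \<omega>) \<partial>M) = (\<integral>\<^sup>+\<omega>. (\<integral>\<^sup>+\<omega>'. F (A \<omega>, B \<omega>') \<partial>M) \<partial>M)"
proof -
  have [measurable]: "A \<in> measurable M S" "B \<in> measurable M T"
    using ind by (auto dest: indep_var_rv1 indep_var_rv2)
  interpret B: prob_space "distr M T B" by (rule prob_space_distr) simp
  have eq: "distr M (S \<Otimes>\<^sub>M T) (\<lambda>\<omega>. (A \<omega>, B \<omega>)) = distr M S A \<Otimes>\<^sub>M distr M T B"
    using ind by (simp add: indep_var_distribution_eq)
  have "(\<integral>\<^sup>+\<omega>. F (A \<omega>, B \<omega>) \<partial>M) = (\<integral>\<^sup>+z. F z \<partial>(distr M S A \<Otimes>\<^sub>M distr M T B))"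
    unfolding eq[symmetric] by (simp add: nn_integral_distr)
  also have "\<dots> = (\<integral>\<^sup>+x. (\<integral>\<^sup>+y. F (x, y) \<partial>distr M T B) \<partial>distr M S A)"
    by (subst B.nn_integral_fst[symmetric]) simp_all
  also have "\<dots> = (\<integral>\<^sup>+x. (\<integral>\<^sup>+\<omega>'. F (x, B \<omega>') \<partial>M) \<partial>distr M S A)"
    by (intro nn_integral_cong nn_integral_distr) simp_all
  also have "\<dots> = (\<integral>\<^sup>+\<omega>. (\<integral>\<^sup>+\<omega>'. F (A \<omega>, B \<omega>') \<partial>M) \<partial>M)"
    by (rule nn_integral_distr) simp_all
  finally show ?thesis .
qed

text \<open>Each new term is independent of the sum of the earlier ones and both are centred, so the
  cross term of the square is integrable with mean zero.\<close>

lemma (in prob_space) second_moment_sum_indep: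
  fixes \<xi> :: "'i \<Rightarrow> 'a \<Rightarrow> real"
  assumes "finite J" "indep_vars (\<lambda>_. borel) \<xi> J"
    and "\<And>i. i \<in> J \<Longrightarrow> integrable M (\<lambda>\<omega>. (\<xi> i \<omega>)\<^sup>2)"
    and "\<And>i. i \<in> J \<Longrightarrow> expectation (\<xi> i) = 0"
  shows "integrable M (\<lambda>\<omega>. (\<Sum>i\<in>J. \<xi> i \<omega>)\<^sup>2) \<and>
    expectation (\<lambda>\<omega>. (\<Sum>i\<in>J. \<xi> i \<omega>)\<^sup>2) = (\<Sum>i\<in>J. expectation (\<lambda>\<omega>. (\<xi> i \<omega>)\<^sup>2))"
  using assms
proof (induction J)
  case empty
  then show ?case by simp
next
  case (insert i J)
  have rv: "\<xi> j \<in> borel_measurable M" if "j \<in> insert i J" for j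
    using insert.prems(1) that by (auto simp: indep_vars_def2)
  have int: "integrable M (\<xi> j)" if "j \<in> insert i J" for j
    using square_integrable_imp_integrable[OF rv insert.prems(2)] that by auto
  have IH: "integrable M (\<lambda>\<omega>. (\<Sum>i\<in>J. \<xi> i \<omega>)\<^sup>2)"
    "expectation (\<lambda>\<omega>. (\<Sum>i\<in>J. \<xi> i \<omega>)\<^sup>2) = (\<Sum>i\<in>J. expectation (\<lambda>\<omega>. (\<xi> i \<omega>)\<^sup>2))"
    using insert.IH indep_vars_subset[OF insert.prems(1)] insert.prems(2,3) by auto
  have ind: "indep_var borel (\<xi> i) borel (\<lambda>\<omega>. \<Sum>i\<in>J. \<xi> i \<omega>)"
    by (rule indep_vars_sum) (use insert in auto)
  have intS: "integrable M (\<lambda>\<omega>. \<Sum>i\<in>J. \<xi> i \<omega>)" by (intro Bochner_Integration.integrable_sum int) simp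
  have cross: "integrable M (\<lambda>\<omega>. \<xi> i \<omega> * (\<Sum>i\<in>J. \<xi> i \<omega>))"
    "expectation (\<lambda>\<omega>. \<xi> i \<omega> * (\<Sum>i\<in>J. \<xi> i \<omega>)) = 0"
    using indep_var_integrable[OF ind int intS] indep_var_lebesgue_integral[OF ind int intS]
      insert.prems(3) by auto
  have eq: "(\<Sum>i\<in>insert i J. \<xi> i \<omega>)\<^sup>2 =
      (\<xi> i \<omega>)\<^sup>2 + (2 * (\<xi> i \<omega> * (\<Sum>i\<in>J. \<xi> i \<omega>)) + (\<Sum>i\<in>J. \<xi> i \<omega>)\<^sup>2)" for \<omega>
    using insert.hyps by (simp add: power2_sum)
  have i2: "integrable M (\<lambda>\<omega>. (\<xi> i \<omega>)\<^sup>2)" using insert.prems(2) by simp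
  have c2: "integrable M (\<lambda>\<omega>. 2 * (\<xi> i \<omega> * (\<Sum>i\<in>J. \<xi> i \<omega>)))" using cross(1) by simp
  show ?case
    unfolding eq using i2 c2 IH cross insert.hyps
    by (simp add: Bochner_Integration.integrable_add)
qed

text \<open>Restricting to an event independent of \<open>Z\<close> only rescales the law of
  \<open>Z\<close> by the probability of the event. The event will be "block \<open>k\<close> equals
  \<open>J\<close>" and \<open>Z\<close> the whole data vector; independence is phrased with
  \<open>indep_set\<close> to match \<open>partition_indep_data\<close>.\<close>

lemma (in prob_space) nn_integral_indicator_indep:
  assumes ind: "indep_set \<A> (sets (vimage_algebra (space M) Z S))" and C: "C \<in> \<A>"
    and [measurable]: "Z \<in> measurable M S" "G \<in> borel_measurable S"
  shows "(\<integral>\<^sup>+\<omega>. indicator C \<omega> * G (Z \<omega>) \<partial>M) = emeasure M C * (\<integral>\<^sup>+\<omega>. G (Z \<omega>) \<partial>M)"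
proof -
  have [measurable]: "C \<in> sets M" using indep_setD_ev1[OF ind] C by auto
  have eq: "distr (density M (indicator C)) S Z = scale_measure (emeasure M C) (distr M S Z)"
  proof (rule measure_eqI)
    fix D assume "D \<in> sets (distr (density M (indicator C)) S Z)"
    then have [measurable]: "D \<in> sets S" by simp
    have D: "Z -` D \<inter> space M \<in> sets (vimage_algebra (space M) Z S)"
      by (rule in_vimage_algebra) simp
    have "emeasure (distr (density M (indicator C)) S Z) D = emeasure (density M (indicator C)) (Z -` D \<inter> space M)"
      by (simp add: emeasure_distr)
    also have "\<dots> = (\<integral>\<^sup>+\<omega>. indicator C \<omega> * indicator (Z -` D \<inter> space M) \<omega> \<partial>M)"
      by (rule emeasure_density) simp_all
    also have "\<dots> = (\<integral>\<^sup>+\<omega>. indicator (C \<inter> (Z -` D \<inter> space M)) \<omega> \<partial>M)"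
      by (simp only: indicator_inter_arith)
    also have "\<dots> = emeasure M (C \<inter> (Z -` D \<inter> space M))" by simp
    also have "\<dots> = emeasure M C * emeasure M (Z -` D \<inter> space M)"
      using indep_setD[OF ind C D] by (simp add: emeasure_eq_measure ennreal_mult)
    also have "\<dots> = emeasure (scale_measure (emeasure M C) (distr M S Z)) D"
      by (simp add: emeasure_distr)
    finally show "emeasure (distr (density M (indicator C)) S Z) D =
        emeasure (scale_measure (emeasure M C) (distr M S Z)) D" .
  qed simp
  have "(\<integral>\<^sup>+\<omega>. indicator C \<omega> * G (Z \<omega>) \<partial>M) = (\<integral>\<^sup>+z. G z \<partial>distr (density M (indicator C)) S Z)"
    by (simp add: nn_integral_distr nn_integral_density)
  also have "\<dots> = emeasure M C * (\<integral>\<^sup>+\<omega>. G (Z \<omega>) \<partial>M)"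
    unfolding eq by (simp add: nn_integral_scale_measure nn_integral_distr)
  finally show ?thesis .
qed

section \<open>Square integrability of products, sums and differences\<close>

lemma integrable_mult_of_square_integrable:
  fixes f g :: "'a \<Rightarrow> real"
  assumes [measurable]: "f \<in> borel_measurable M" "g \<in> borel_measurable M"
    and "integrable M (\<lambda>x. (f x)\<^sup>2)" "integrable M (\<lambda>x. (g x)\<^sup>2)"
  shows "integrable M (\<lambda>x. f x * g x)"
proof (rule Bochner_Integration.integrable_bound)
  show "integrable M (\<lambda>x. (f x)\<^sup>2 + (g x)\<^sup>2)" using assms by simp
  have "\<bar>f x * g x\<bar> \<le> (f x)\<^sup>2 + (g x)\<^sup>2" for x
  proof -
    have "0 \<le> (\<bar>f x\<bar> - \<bar>g x\<bar>)\<^sup>2" by simp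
    then have "2 * (\<bar>f x\<bar> * \<bar>g x\<bar>) \<le> (f x)\<^sup>2 + (g x)\<^sup>2" by (simp add: power2_diff)
    moreover have "0 \<le> \<bar>f x\<bar> * \<bar>g x\<bar>" by simp
    ultimately show ?thesis unfolding abs_mult by linarith
  qed
  then show "AE x in M. norm (f x * g x) \<le> norm ((f x)\<^sup>2 + (g x)\<^sup>2)" by simp
qed simp

lemma integrable_square_add:
  fixes f g :: "'a \<Rightarrow> real"
  assumes "f \<in> borel_measurable M" "g \<in> borel_measurable M"
    and "integrable M (\<lambda>x. (f x)\<^sup>2)" "integrable M (\<lambda>x. (g x)\<^sup>2)"
  shows "integrable M (\<lambda>x. (f x + g x)\<^sup>2)"
  unfolding power2_sum using integrable_mult_of_square_integrable[OF assms] assms(3,4)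
  by (simp add: mult.assoc)

lemma integrable_square_diff:
  fixes f g :: "'a \<Rightarrow> real"
  assumes "f \<in> borel_measurable M" "g \<in> borel_measurable M"
    and "integrable M (\<lambda>x. (f x)\<^sup>2)" "integrable M (\<lambda>x. (g x)\<^sup>2)"
  shows "integrable M (\<lambda>x. (f x - g x)\<^sup>2)"
  unfolding power2_diff using integrable_mult_of_square_integrable[OF assms] assms(3,4)
  by (simp add: mult.assoc)

lemma (in prob_space) variance_le_second_moment:
  fixes f :: "'a \<Rightarrow> real"
  assumes "integrable M f" "integrable M (\<lambda>x. (f x)\<^sup>2)"
  shows "variance f \<le> expectation (\<lambda>x. (f x)\<^sup>2)"
  using variance_eq[OF assms] by simp

section \<open>Weak convergence of triangular arrays\<close>

text \<open>A quantitative form of Slutsky's lemma: \<open>iexp\<close> is 1-Lipschitz, which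
  handles sample points where the variables are \<open>\<epsilon>\<close>-close, and has modulus 1,
  which costs at most 2 elsewhere.\<close>

lemma (in prob_space) cmod_char_distr_diff_le:
  assumes [measurable]: "A \<in> borel_measurable M" "B \<in> borel_measurable M" and \<epsilon>: "\<epsilon> > 0"
  shows "cmod (char (distr M borel B) t - char (distr M borel A) t) \<le>
    \<bar>t\<bar> * \<epsilon> + 2 * prob {\<omega> \<in> space M. \<bar>B \<omega> - A \<omega>\<bar> > \<epsilon>}"
proof -
  let ?E = "{\<omega> \<in> space M. \<bar>B \<omega> - A \<omega>\<bar> > \<epsilon>}"
  have int: "integrable M (\<lambda>\<omega>. iexp (t * f \<omega>))" if "f \<in> borel_measurable M" for f
    using that by (intro integrable_const_bound[where B=1]) auto
  have char: "char (distr M borel f) t = (CLINT \<omega>|M. iexp (t * f \<omega>))"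
    if "f \<in> borel_measurable M" for f
    using that by (simp add: char_def integral_distr)
  have "char (distr M borel B) t - char (distr M borel A) t =
      (CLINT \<omega>|M. iexp (t * B \<omega>) - iexp (t * A \<omega>))"
    unfolding char[OF assms(1)] char[OF assms(2)]
    by (rule Bochner_Integration.integral_diff[symmetric]; rule int; fact)
  also have "cmod \<dots> \<le> (LINT \<omega>|M. cmod (iexp (t * B \<omega>) - iexp (t * A \<omega>)))"
    by (rule integral_norm_bound)
  also have "\<dots> \<le> (LINT \<omega>|M. \<bar>t\<bar> * \<epsilon> + 2 * indicator ?E \<omega>)"
  proof (rule integral_mono)
    show "integrable M (\<lambda>\<omega>. cmod (iexp (t * B \<omega>) - iexp (t * A \<omega>)))"
      by (intro integrable_norm Bochner_Integration.integrable_diff int) fact+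
    show "integrable M (\<lambda>\<omega>. \<bar>t\<bar> * \<epsilon> + 2 * indicator ?E \<omega>)"
      by (intro Bochner_Integration.integrable_add integrable_mult_right integrable_real_indicator)
        (auto simp: emeasure_eq_measure)
  next
    fix \<omega> assume \<omega>: "\<omega> \<in> space M"
    show "cmod (iexp (t * B \<omega>) - iexp (t * A \<omega>)) \<le> \<bar>t\<bar> * \<epsilon> + 2 * indicator ?E \<omega>"
    proof (cases "\<omega> \<in> ?E")
      case True
      have "cmod (iexp (t * B \<omega>) - iexp (t * A \<omega>)) \<le> cmod (iexp (t * B \<omega>)) + cmod (iexp (t * A \<omega>))"
        by (rule norm_triangle_ineq4)
      also have "\<dots> = 2" by simp
      also have "\<dots> \<le> \<bar>t\<bar> * \<epsilon> + 2 * indicator ?E \<omega>" using True \<epsilon> by simp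
      finally show ?thesis .
    next
      case False
      then have le: "\<bar>B \<omega> - A \<omega>\<bar> \<le> \<epsilon>" using \<omega> by auto
      have "iexp (t * B \<omega>) - iexp (t * A \<omega>) = iexp (t * A \<omega>) * (iexp (t * (B \<omega> - A \<omega>)) - 1)"
        by (simp add: algebra_simps flip: exp_add of_real_mult)
      then have "cmod (iexp (t * B \<omega>) - iexp (t * A \<omega>)) = cmod (iexp (t * (B \<omega> - A \<omega>)) - 1)"
        by (simp add: norm_mult)
      also have "\<dots> \<le> \<bar>t * (B \<omega> - A \<omega>)\<bar>"
        using iexp_approx1[of "t * (B \<omega> - A \<omega>)" 0] by simp
      also have "\<dots> \<le> \<bar>t\<bar> * \<epsilon>" using le by (simp add: abs_mult mult_left_mono)
      finally show ?thesis using False by simp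
    qed
  qed
  also have "\<dots> = \<bar>t\<bar> * \<epsilon> + 2 * prob ?E"
    by (subst Bochner_Integration.integral_add) (auto simp: prob_space emeasure_eq_measure)
  finally show ?thesis .
qed

text \<open>The model is specified only for sample sizes at least 1, so index 0 may fail to carry a
  distribution; the shift by \<open>Suc\<close> removes it.\<close>

lemma levy_continuity_eventually:
  fixes \<nu> :: "nat \<Rightarrow> real measure"
  assumes "\<And>n. n \<ge> 1 \<Longrightarrow> real_distribution (\<nu> n)" "real_distribution \<nu>'"
    and "\<And>t. (\<lambda>n. char (\<nu> n) t) \<longlonglongrightarrow> char \<nu>' t"
  shows "weak_conv_m \<nu> \<nu>'"
proof -
  have "weak_conv_m (\<lambda>n. \<nu> (Suc n)) \<nu>'"
    by (rule levy_continuity) (use assms LIMSEQ_Suc in auto)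
  then show ?thesis
    unfolding weak_conv_m_def weak_conv_def by (auto intro: LIMSEQ_imp_Suc)
qed

text \<open>Slutsky's lemma for arrays. The leading part enters through its characteristic
  functions, which is the form in which Lindeberg's theorem delivers it, so Levy's theorem is
  applied once, to the perturbed variables.\<close>

lemma weak_conv_m_perturb:
  fixes M :: "nat \<Rightarrow> 'a measure"
  assumes prob: "\<And>n. n \<ge> 1 \<Longrightarrow> prob_space (M n)"
    and A: "\<And>n. n \<ge> 1 \<Longrightarrow> A n \<in> borel_measurable (M n)"
    and B: "\<And>n. n \<ge> 1 \<Longrightarrow> B n \<in> borel_measurable (M n)"
    and \<nu>: "real_distribution \<nu>"
    and char: "\<And>t. (\<lambda>n. char (distr (M n) borel (A n)) t) \<longlonglongrightarrow> char \<nu> t"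
    and diff: "\<And>\<epsilon>. \<epsilon> > 0 \<Longrightarrow>
      (\<lambda>n. measure (M n) {\<omega> \<in> space (M n). \<bar>B n \<omega> - A n \<omega>\<bar> > \<epsilon>}) \<longlonglongrightarrow> 0"
  shows "weak_conv_m (\<lambda>n. distr (M n) borel (B n)) \<nu>"
proof (rule levy_continuity_eventually)
  show "real_distribution (distr (M n) borel (B n))" if "n \<ge> 1" for n
  proof -
    interpret prob_space "M n" by (rule prob[OF that])
    show ?thesis using B[OF that] by simp
  qed
  show "real_distribution \<nu>" by fact
  fix t
  have "(\<lambda>n. char (distr (M n) borel (B n)) t - char (distr (M n) borel (A n)) t) \<longlonglongrightarrow> 0"
  proof (rule LIMSEQ_I)
    fix r :: real assume r: "r > 0"
    \<comment> \<open>The Lipschitz part then costs at most \<open>r / 2\<close>, and probabilities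
      below \<open>r / 4\<close> cost less than another \<open>r / 2\<close>. The \<open>+ 1\<close>
      covers \<open>t = 0\<close>.\<close>
    define \<epsilon> where "\<epsilon> = r / (2 * (\<bar>t\<bar> + 1))"
    have \<epsilon>: "\<epsilon> > 0" using r by (simp add: \<epsilon>_def add_nonneg_pos)
    have t\<epsilon>: "\<bar>t\<bar> * \<epsilon> \<le> r / 2" using r by (simp add: \<epsilon>_def field_simps)
    from LIMSEQ_D[OF diff[OF \<epsilon>], of "r / 4"] r obtain n0
      where n0: "\<And>n. n \<ge> n0 \<Longrightarrow> measure (M n) {\<omega> \<in> space (M n). \<bar>B n \<omega> - A n \<omega>\<bar> > \<epsilon>} < r / 4"
      by auto
    show "\<exists>no. \<forall>n\<ge>no. norm (char (distr (M n) borel (B n)) t - char (distr (M n) borel (A n)) t - 0) < r"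
    proof (intro exI allI impI)
      fix n assume "n \<ge> max n0 1"
      then have n: "n \<ge> n0" "n \<ge> 1" by auto
      show "norm (char (distr (M n) borel (B n)) t - char (distr (M n) borel (A n)) t - 0) < r"
        using prob_space.cmod_char_distr_diff_le[OF prob A B \<epsilon>, of n t, OF n(2) n(2) n(2)] n0[OF n(1)] t\<epsilon> by simp
    qed
  qed
  from tendsto_add[OF this char[of t]] show "(\<lambda>n. char (distr (M n) borel (B n)) t) \<longlonglongrightarrow> char \<nu> t"
    by simp
qed

text \<open>Rows are i.i.d., so the characteristic function of a row is an \<open>n\<close>-th power
  \<open>\<rho> ^ n\<close>. Replacing \<open>\<rho>\<close> by its second order expansion
  \<open>1 - t^2 / (2 n)\<close> costs \<open>n\<close> times the error for one term; the factor
  \<open>n\<close> is absorbed because a normalised term has second moment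
  \<open>1 / n\<close>.\<close>

lemma lindeberg_char_tendsto:
  fixes \<xi> :: "nat \<Rightarrow> nat \<Rightarrow> 'a \<Rightarrow> real" and \<eta> :: "nat \<Rightarrow> 'b \<Rightarrow> real"
  assumes probM: "\<And>n. n \<ge> 1 \<Longrightarrow> prob_space (M n)"
    and probQ: "\<And>n. n \<ge> 1 \<Longrightarrow> prob_space (Q n)"
    and indep: "\<And>n. n \<ge> 1 \<Longrightarrow> prob_space.indep_vars (M n) (\<lambda>_. borel) (\<xi> n) {1..n}"
    and law: "\<And>n i. i \<in> {1..n} \<Longrightarrow> distr (M n) borel (\<xi> n i) = distr (Q n) borel (\<eta> n)"
    and meas: "\<And>n. n \<ge> 1 \<Longrightarrow> \<eta> n \<in> borel_measurable (Q n)"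
    and sq: "\<And>n. n \<ge> 1 \<Longrightarrow> integrable (Q n) (\<lambda>\<omega>. (\<eta> n \<omega>)\<^sup>2)"
    and mean: "\<And>n. n \<ge> 1 \<Longrightarrow> (LINT \<omega>|Q n. \<eta> n \<omega>) = 0"
    and var: "\<And>n. n \<ge> 1 \<Longrightarrow> (LINT \<omega>|Q n. (\<eta> n \<omega>)\<^sup>2) = s n"
    and s_pos: "\<And>n. n \<ge> 1 \<Longrightarrow> s n > 0"
    and lindeberg: "\<And>\<epsilon>. \<epsilon> > 0 \<Longrightarrow> (\<lambda>n. (LINT \<omega>|Q n. (\<eta> n \<omega>)\<^sup>2 *
        indicator {u. \<bar>u\<bar> > \<epsilon> * sqrt (real n * s n)} (\<eta> n \<omega>)) / s n) \<longlonglongrightarrow> 0"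
  shows "(\<lambda>n. char (distr (M n) borel (\<lambda>\<omega>. (\<Sum>i=1..n. \<xi> n i \<omega>) / sqrt (real n * s n))) t)
    \<longlonglongrightarrow> char std_normal_distribution t"
proof -
  define \<phi> where "\<phi> n = char (distr (M n) borel (\<lambda>\<omega>. (\<Sum>i=1..n. \<xi> n i \<omega>) / sqrt (real n * s n))) t" for n
  define L where "L \<epsilon> n = (LINT \<omega>|Q n. (\<eta> n \<omega>)\<^sup>2 *
        indicator {u. \<bar>u\<bar> > \<epsilon> * sqrt (real n * s n)} (\<eta> n \<omega>)) / s n" for \<epsilon> n
  have main: "cmod (\<phi> n - complex_of_real ((1 + (- (t\<^sup>2) / 2) / n) ^ n)) \<le> t\<^sup>2 / 6 * (6 * L \<epsilon> n + \<bar>t\<bar> * \<epsilon>)"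
    if n: "n \<ge> 1" "real n \<ge> t\<^sup>2 / 4" and \<epsilon>: "\<epsilon> > 0" for n \<epsilon>
  proof -
    interpret M: prob_space "M n" by (rule probM[OF n(1)])
    interpret Q: prob_space "Q n" by (rule probQ[OF n(1)])
    define w where "w = sqrt (real n * s n)"
    have w: "w > 0" "w\<^sup>2 = real n * s n"
      using n(1) s_pos[OF n(1)] by (auto simp: w_def)
    note [measurable] = meas[OF n(1)]
    have rv: "\<xi> n i \<in> borel_measurable (M n)" if "i \<in> {1..n}" for i
      using indep[OF n(1)] that by (auto simp: M.indep_vars_def2)
    let ?x = "\<lambda>\<omega>. \<eta> n \<omega> / w"
    have int: "integrable (Q n) (\<eta> n)"
      by (rule Q.square_integrable_imp_integrable[OF meas[OF n(1)] sq[OF n(1)]])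
    have int2: "integrable (Q n) (\<lambda>\<omega>. (?x \<omega>)\<^sup>2)"
      using sq[OF n(1)] by (simp add: power_divide)
    have x2: "(LINT \<omega>|Q n. (?x \<omega>)\<^sup>2) = 1 / n"
      using s_pos[OF n(1)] n(1) by (simp add: power_divide var[OF n(1)] w)
    define \<rho> where "\<rho> = char (distr (Q n) borel ?x) t"
    have \<phi>: "\<phi> n = \<rho> ^ n"
    proof -
      have "\<phi> n = char (distr (M n) borel (\<lambda>\<omega>. \<Sum>i=1..n. \<xi> n i \<omega> / w)) t"
        by (simp add: \<phi>_def w_def sum_divide_distrib)
      also have "\<dots> = (\<Prod>i=1..n. char (distr (M n) borel (\<lambda>\<omega>. \<xi> n i \<omega> / w)) t)"
        by (rule M.char_distr_sum, rule M.indep_vars_compose2[OF indep[OF n(1)]]) simp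
      also have "\<dots> = (\<Prod>i=1..n. \<rho>)"
      proof (rule prod.cong[OF refl])
        fix i assume i: "i \<in> {1..n}"
        note [measurable] = rv[OF i]
        have "distr (M n) borel (\<lambda>\<omega>. \<xi> n i \<omega> / w) = distr (distr (M n) borel (\<xi> n i)) borel (\<lambda>u. u / w)"
          by (subst distr_distr) (simp_all add: comp_def)
        also have "\<dots> = distr (Q n) borel ?x"
          unfolding law[OF i] by (subst distr_distr) (simp_all add: comp_def)
        finally show "char (distr (M n) borel (\<lambda>\<omega>. \<xi> n i \<omega> / w)) t = \<rho>" by (simp add: \<rho>_def)
      qed
      finally show ?thesis by simp
    qed
    have \<rho>: "cmod (\<rho> - (1 - t\<^sup>2 * (1 / n) / 2)) \<le> (t\<^sup>2 / 6) * Q.expectation (\<lambda>\<omega>. min (6 * (?x \<omega>)\<^sup>2) (\<bar>t\<bar> * \<bar>?x \<omega>\<bar> ^ 3))"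
      unfolding \<rho>_def
      by (rule Q.char_approx3'[of ?x "1 / n"]) (use int int2 mean[OF n(1)] x2 in auto)
    have int3: "integrable (Q n) (\<lambda>\<omega>. (?x \<omega>)\<^sup>2 * indicator {u. \<bar>u\<bar> > \<epsilon> * w} (\<eta> n \<omega>))"
      by (rule Bochner_Integration.integrable_bound[OF int2]) (auto split: split_indicator)
    \<comment> \<open>Lindeberg's split: for large values the quadratic branch of the minimum is
      used; for the others \<open>|?x|\<close> is at most \<open>\<epsilon>\<close>, and the cubic
      branch is at most \<open>|t| * \<epsilon>\<close> times the square.\<close>
    have "Q.expectation (\<lambda>\<omega>. min (6 * (?x \<omega>)\<^sup>2) (\<bar>t\<bar> * \<bar>?x \<omega>\<bar> ^ 3)) \<le>
        Q.expectation (\<lambda>\<omega>. 6 * ((?x \<omega>)\<^sup>2 * indicator {u. \<bar>u\<bar> > \<epsilon> * w} (\<eta> n \<omega>)) + (\<bar>t\<bar> * \<epsilon>) * (?x \<omega>)\<^sup>2)"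
    proof (rule integral_mono)
      show "integrable (Q n) (\<lambda>\<omega>. min (6 * (?x \<omega>)\<^sup>2) (\<bar>t\<bar> * \<bar>?x \<omega>\<bar> ^ 3))"
        by (rule Bochner_Integration.integrable_bound[OF integrable_mult_right[OF int2, of 6]])
          auto
      show "integrable (Q n) (\<lambda>\<omega>. 6 * ((?x \<omega>)\<^sup>2 * indicator {u. \<bar>u\<bar> > \<epsilon> * w} (\<eta> n \<omega>)) + (\<bar>t\<bar> * \<epsilon>) * (?x \<omega>)\<^sup>2)"
        by (intro Bochner_Integration.integrable_add integrable_mult_right int3 int2)
      fix \<omega>
      have nn: "0 \<le> \<bar>t\<bar> * \<epsilon> * (?x \<omega>)\<^sup>2" using \<epsilon> by simp
      show "min (6 * (?x \<omega>)\<^sup>2) (\<bar>t\<bar> * \<bar>?x \<omega>\<bar> ^ 3) \<le>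
        6 * ((?x \<omega>)\<^sup>2 * indicator {u. \<bar>u\<bar> > \<epsilon> * w} (\<eta> n \<omega>)) + (\<bar>t\<bar> * \<epsilon>) * (?x \<omega>)\<^sup>2"
      proof (cases "\<bar>\<eta> n \<omega>\<bar> > \<epsilon> * w")
        case True
        then show ?thesis using nn by simp
      next
        case False
        then have "\<bar>?x \<omega>\<bar> \<le> \<epsilon>" using w by (simp add: field_simps)
        then have "\<bar>?x \<omega>\<bar> * (?x \<omega>)\<^sup>2 \<le> \<epsilon> * (?x \<omega>)\<^sup>2" by (rule mult_right_mono) simp
        moreover have "\<bar>?x \<omega>\<bar> ^ 3 = \<bar>?x \<omega>\<bar> * (?x \<omega>)\<^sup>2"
          by (simp only: power3_eq_cube power2_eq_square abs_mult_self_eq mult.assoc)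
        ultimately have "\<bar>t\<bar> * \<bar>?x \<omega>\<bar> ^ 3 \<le> \<bar>t\<bar> * (\<epsilon> * (?x \<omega>)\<^sup>2)"
          by (simp only:) (rule mult_left_mono, auto)
        then show ?thesis using False by (auto simp: mult.assoc intro: min.coboundedI2)
      qed
    qed
    also have "\<dots> = 6 * (LINT \<omega>|Q n. (?x \<omega>)\<^sup>2 * indicator {u. \<bar>u\<bar> > \<epsilon> * w} (\<eta> n \<omega>)) + (\<bar>t\<bar> * \<epsilon>) * (1 / n)"
      by (subst Bochner_Integration.integral_add)
        (use int3 int2 in \<open>auto intro!: integrable_mult_right simp only: integral_mult_right_zero x2\<close>)
    also have "(LINT \<omega>|Q n. (?x \<omega>)\<^sup>2 * indicator {u. \<bar>u\<bar> > \<epsilon> * w} (\<eta> n \<omega>)) = L \<epsilon> n / n"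
      by (simp add: L_def power_divide w w_def[symmetric])
    finally have E: "Q.expectation (\<lambda>\<omega>. min (6 * (?x \<omega>)\<^sup>2) (\<bar>t\<bar> * \<bar>?x \<omega>\<bar> ^ 3)) \<le> (6 * L \<epsilon> n + \<bar>t\<bar> * \<epsilon>) / n"
      by (simp add: add_divide_distrib)
    interpret D: real_distribution "distr (Q n) borel ?x" by simp
    have eq: "1 - t\<^sup>2 * (1 / n) / 2 = 1 + (- (t\<^sup>2) / 2) / n" by simp
    have "cmod (\<phi> n - complex_of_real ((1 + (- (t\<^sup>2) / 2) / n)) ^ n) \<le>
        n * cmod (\<rho> - complex_of_real (1 + (- (t\<^sup>2) / 2) / n))"
      unfolding \<phi>
    proof (rule norm_power_diff)
      show "cmod \<rho> \<le> 1" unfolding \<rho>_def by (rule D.cmod_char_le_1)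
      \<comment> \<open>This is where \<open>n\<close> has to be at least \<open>t^2 / 4\<close>:
        then \<open>t^2 / (2 n)\<close> is at most 2.\<close>
      show "cmod (complex_of_real (1 + (- (t\<^sup>2) / 2) / n)) \<le> 1"
        unfolding norm_of_real using n by (intro abs_leI) (auto simp: field_simps)
    qed
    also have "\<dots> \<le> n * ((t\<^sup>2 / 6) * ((6 * L \<epsilon> n + \<bar>t\<bar> * \<epsilon>) / n))"
      by (intro mult_left_mono order_trans[OF \<rho>[unfolded eq]] E) simp_all
    also have "\<dots> = t\<^sup>2 / 6 * (6 * L \<epsilon> n + \<bar>t\<bar> * \<epsilon>)" using n(1) by simp
    finally show ?thesis by simp
  qed
  have "(\<lambda>n. \<phi> n - complex_of_real ((1 + (- (t\<^sup>2) / 2) / real n) ^ n)) \<longlonglongrightarrow> 0"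
  proof (rule LIMSEQ_I)
    fix r :: real assume r: "r > 0"
    \<comment> \<open>With this choice the small-value part of the bound,
      \<open>t^2 * |t| * \<epsilon> / 6\<close>, is at most \<open>r / 6\<close>, leaving room for
      the Lindeberg part below \<open>r / 2\<close>.\<close>
    define \<epsilon> where "\<epsilon> = r / (t\<^sup>2 * \<bar>t\<bar> + 1)"
    have d: "t\<^sup>2 * \<bar>t\<bar> + 1 > 0" by (simp add: add_nonneg_pos)
    have \<epsilon>: "\<epsilon> > 0" using r d by (simp add: \<epsilon>_def)
    have t\<epsilon>: "t\<^sup>2 * \<bar>t\<bar> * \<epsilon> \<le> r" using r d by (simp add: \<epsilon>_def field_simps)
    have "(\<lambda>n. t\<^sup>2 * L \<epsilon> n) \<longlonglongrightarrow> 0"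
      unfolding L_def by (rule tendsto_mult_right_zero) (rule lindeberg[OF \<epsilon>])
    from LIMSEQ_D[OF this, of "r / 2"] r obtain n0 where n0: "\<And>n. n \<ge> n0 \<Longrightarrow> \<bar>t\<^sup>2 * L \<epsilon> n\<bar> < r / 2"
      by auto
    show "\<exists>no. \<forall>n\<ge>no. norm (\<phi> n - complex_of_real ((1 + (- (t\<^sup>2) / 2) / real n) ^ n) - 0) < r"
    proof (intro exI allI impI)
      fix n assume n: "n \<ge> max n0 (max 1 (nat \<lceil>t\<^sup>2 / 4\<rceil>))"
      then have n': "n \<ge> 1" "real n \<ge> t\<^sup>2 / 4" by linarith+
      have "t\<^sup>2 / 6 * (6 * L \<epsilon> n + \<bar>t\<bar> * \<epsilon>) = t\<^sup>2 * L \<epsilon> n + t\<^sup>2 * \<bar>t\<bar> * \<epsilon> / 6"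
        by (simp add: algebra_simps)
      also have "\<dots> < r" using n0[of n] n t\<epsilon> r by simp
      finally show "norm (\<phi> n - complex_of_real ((1 + (- (t\<^sup>2) / 2) / real n) ^ n) - 0) < r"
        using main[OF n' \<epsilon>] by simp
    qed
  qed
  moreover have "(\<lambda>n. complex_of_real ((1 + (- (t\<^sup>2) / 2) / real n) ^ n)) \<longlonglongrightarrow> complex_of_real (exp (- (t\<^sup>2) / 2))"
    by (rule isCont_tendsto_compose [OF _ tendsto_exp_limit_sequentially]) auto
  ultimately have "\<phi> \<longlonglongrightarrow> complex_of_real (exp (- (t\<^sup>2) / 2))"
    using tendsto_add by fastforce
  then show ?thesis by (simp add: \<phi>_def[abs_def] char_std_normal_distribution)
qed

section \<open>Stochastic order\<close>

text \<open>Since \<open>ennreal\<close> sends negative numbers to 0, comparison in the extended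
  nonnegative reals agrees with comparison of reals only for nonnegative thresholds; hence the sign
  condition on the rate here and below.\<close>

lemma Op_real_iff:
  assumes "\<And>N. r N \<ge> 0"
  shows "Op_real M U r \<longleftrightarrow> (\<forall>\<^sub>F N in sequentially. U N \<in> borel_measurable (M N)) \<and>
    (\<forall>\<epsilon>>0. \<exists>C>0. \<forall>\<^sub>F N in sequentially.
      measure (M N) {\<omega> \<in> space (M N). \<bar>U N \<omega>\<bar> > C * r N} \<le> \<epsilon>)"
proof -
  have eq: "(ennreal \<bar>U N \<omega>\<bar> > ennreal (C * r N)) = (\<bar>U N \<omega>\<bar> > C * r N)" if "C > 0" for C N \<omega>
    using assms[of N] that by (simp add: ennreal_less_iff)
  show ?thesis
    unfolding Op_def
  proof (intro conj_cong refl all_cong1 imp_cong ex_cong1)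
    fix \<epsilon> C :: real
    assume meas: "\<forall>\<^sub>F N in sequentially. U N \<in> borel_measurable (M N)"
    have "(\<lambda>\<omega>. ennreal \<bar>U N \<omega>\<bar>) \<in> borel_measurable (M N)" if "U N \<in> borel_measurable (M N)" for N
      using that by simp
    with meas have "\<forall>\<^sub>F N in sequentially. (\<lambda>\<omega>. ennreal \<bar>U N \<omega>\<bar>) \<in> borel_measurable (M N)"
      by (auto elim: eventually_mono)
    moreover assume "0 < C"
    ultimately show "(\<forall>\<^sub>F N in sequentially. (\<lambda>\<omega>. ennreal \<bar>U N \<omega>\<bar>) \<in> borel_measurable (M N) \<and>
        measure (M N) {\<omega> \<in> space (M N). ennreal (C * r N) < ennreal \<bar>U N \<omega>\<bar>} \<le> \<epsilon>) \<longleftrightarrow>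
      (\<forall>\<^sub>F N in sequentially. measure (M N) {\<omega> \<in> space (M N). C * r N < \<bar>U N \<omega>\<bar>} \<le> \<epsilon>)"
      by (simp add: eventually_conj_iff eq)
  qed
qed

lemma Op_real_cong:
  assumes "\<forall>\<^sub>F N in sequentially. \<forall>\<omega>\<in>space (M N). U N \<omega> = U' N \<omega>" "\<And>N. r N \<ge> 0" "Op_real M U r"
  shows "Op_real M U' r"
proof -
  have 1: "\<forall>\<^sub>F N in sequentially. U' N \<in> borel_measurable (M N)"
  proof -
    have "\<forall>\<^sub>F N in sequentially. U N \<in> borel_measurable (M N)" using assms(3) by simp
    with assms(1) show ?thesis
      by eventually_elim (simp cong: measurable_cong)
  qed
  have 2: "\<exists>C>0. \<forall>\<^sub>F N in sequentially. measure (M N) {\<omega> \<in> space (M N). \<bar>U' N \<omega>\<bar> > C * r N} \<le> \<epsilon>"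
    if "\<epsilon> > 0" for \<epsilon>
  proof -
    obtain C where "C > 0"
      and C: "\<forall>\<^sub>F N in sequentially. measure (M N) {\<omega> \<in> space (M N). \<bar>U N \<omega>\<bar> > C * r N} \<le> \<epsilon>"
      using assms(3) \<open>\<epsilon> > 0\<close> unfolding Op_real_iff[of r, OF assms(2)] by blast
    from assms(1) C have "\<forall>\<^sub>F N in sequentially. measure (M N) {\<omega> \<in> space (M N). \<bar>U' N \<omega>\<bar> > C * r N} \<le> \<epsilon>"
    proof eventually_elim
      case (elim N)
      then have "{\<omega> \<in> space (M N). \<bar>U' N \<omega>\<bar> > C * r N} = {\<omega> \<in> space (M N). \<bar>U N \<omega>\<bar> > C * r N}" by auto
      with elim show ?case by simp
    qed
    with \<open>C > 0\<close> show ?thesis by blast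
  qed
  show ?thesis unfolding Op_real_iff[of r, OF assms(2)] using 1 2 by blast
qed

lemma Op_real_mono:
  assumes prob: "\<And>N. N \<ge> 1 \<Longrightarrow> prob_space (M N)"
    and r: "\<And>N. r N \<ge> 0" "\<And>N. r' N \<ge> 0" and D: "D > 0" "\<And>N. r N \<le> D * r' N"
    and U: "Op_real M U r"
  shows "Op_real M U r'"
proof -
  have meas: "\<forall>\<^sub>F N in sequentially. U N \<in> borel_measurable (M N)" using U by simp
  show ?thesis
    unfolding Op_real_iff[of r', OF r(2)]
  proof (intro conjI allI impI meas)
    fix \<epsilon> :: real assume "\<epsilon> > 0"
    then obtain C where "C > 0"
      and C: "\<forall>\<^sub>F N in sequentially. measure (M N) {\<omega> \<in> space (M N). \<bar>U N \<omega>\<bar> > C * r N} \<le> \<epsilon>"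
      using U unfolding Op_real_iff[of r, OF r(1)] by blast
    from meas C eventually_ge_at_top[of 1]
    have "\<forall>\<^sub>F N in sequentially. measure (M N) {\<omega> \<in> space (M N). \<bar>U N \<omega>\<bar> > (C * D) * r' N} \<le> \<epsilon>"
    proof eventually_elim
      case (elim N)
      interpret prob_space "M N" by (rule prob) fact
      note [measurable] = elim(1)
      have "C * r N \<le> C * (D * r' N)" using D(2)[of N] \<open>C > 0\<close> by (intro mult_left_mono) auto
      then have "measure (M N) {\<omega> \<in> space (M N). \<bar>U N \<omega>\<bar> > (C * D) * r' N}
          \<le> measure (M N) {\<omega> \<in> space (M N). \<bar>U N \<omega>\<bar> > C * r N}"
        by (intro finite_measure_mono) (auto simp: mult.assoc)
      with elim show ?case by simp
    qed
    moreover have "C * D > 0" using \<open>C > 0\<close> D(1) by simp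
    ultimately show "\<exists>C>0. \<forall>\<^sub>F N in sequentially. measure (M N) {\<omega> \<in> space (M N). \<bar>U N \<omega>\<bar> > C * r' N} \<le> \<epsilon>"
      by blast
  qed
qed

lemma Op_real_add:
  assumes prob: "\<And>N. N \<ge> 1 \<Longrightarrow> prob_space (M N)" and r: "\<And>N. r N \<ge> 0"
    and U: "Op_real M U r" and U': "Op_real M U' r"
  shows "Op_real M (\<lambda>N \<omega>. U N \<omega> + U' N \<omega>) r"
proof -
  have meas: "\<forall>\<^sub>F N in sequentially. U N \<in> borel_measurable (M N)"
    "\<forall>\<^sub>F N in sequentially. U' N \<in> borel_measurable (M N)" using U U' by simp_all
  then have meas_add: "\<forall>\<^sub>F N in sequentially. (\<lambda>\<omega>. U N \<omega> + U' N \<omega>) \<in> borel_measurable (M N)"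
    by eventually_elim simp
  show ?thesis
    unfolding Op_real_iff[of r, OF r]
  proof (intro conjI allI impI meas_add)
    fix \<epsilon> :: real assume "\<epsilon> > 0"
    then have "\<epsilon> / 2 > 0" by simp
    then obtain C C' where C: "C > 0" "C' > 0"
      "\<forall>\<^sub>F N in sequentially. measure (M N) {\<omega> \<in> space (M N). \<bar>U N \<omega>\<bar> > C * r N} \<le> \<epsilon> / 2"
      "\<forall>\<^sub>F N in sequentially. measure (M N) {\<omega> \<in> space (M N). \<bar>U' N \<omega>\<bar> > C' * r N} \<le> \<epsilon> / 2"
      using U U' unfolding Op_real_iff[of r, OF r] by meson
    from meas C(3,4) eventually_ge_at_top[of 1]
    have "\<forall>\<^sub>F N in sequentially. measure (M N) {\<omega> \<in> space (M N). \<bar>U N \<omega> + U' N \<omega>\<bar> > (C + C') * r N} \<le> \<epsilon>"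
    proof eventually_elim
      case (elim N)
      interpret prob_space "M N" by (rule prob) fact
      note [measurable] = elim(1,2)
      have "measure (M N) {\<omega> \<in> space (M N). \<bar>U N \<omega> + U' N \<omega>\<bar> > (C + C') * r N} \<le>
          measure (M N) ({\<omega> \<in> space (M N). \<bar>U N \<omega>\<bar> > C * r N} \<union> {\<omega> \<in> space (M N). \<bar>U' N \<omega>\<bar> > C' * r N})"
        by (intro finite_measure_mono) (auto simp: distrib_right)
      also have "\<dots> \<le> measure (M N) {\<omega> \<in> space (M N). \<bar>U N \<omega>\<bar> > C * r N} +
          measure (M N) {\<omega> \<in> space (M N). \<bar>U' N \<omega>\<bar> > C' * r N}"
        by (intro measure_Un_le) auto
      finally show ?case using elim by simp
    qed
    moreover have "C + C' > 0" using C by simp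
    ultimately show "\<exists>C>0. \<forall>\<^sub>F N in sequentially.
        measure (M N) {\<omega> \<in> space (M N). \<bar>U N \<omega> + U' N \<omega>\<bar> > C * r N} \<le> \<epsilon>"
      by blast
  qed
qed

lemma Op_real_zero: "(\<And>N. r N \<ge> 0) \<Longrightarrow> Op_real M (\<lambda>N \<omega>. 0) r"
  unfolding Op_def by (auto intro!: exI[of _ "1::real"])

lemma Op_real_sum:
  assumes prob: "\<And>N. N \<ge> 1 \<Longrightarrow> prob_space (M N)" and r: "\<And>N. r N \<ge> 0"
    and "finite A" "\<And>k. k \<in> A \<Longrightarrow> Op_real M (U k) r"
  shows "Op_real M (\<lambda>N \<omega>. \<Sum>k\<in>A. U k N \<omega>) r"
  using assms(3,4)
proof (induction A)
  case empty
  then show ?case using Op_real_zero[of r M] r by simp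
next
  case (insert k A)
  have "Op_real M (\<lambda>N \<omega>. U k N \<omega> + (\<Sum>k\<in>A. U k N \<omega>)) r"
    by (rule Op_real_add[OF prob r]) (use insert in blast)+
  then show ?case using insert.hyps by simp
qed

lemma Op_real_cmult:
  assumes prob: "\<And>N. N \<ge> 1 \<Longrightarrow> prob_space (M N)" and r: "\<And>N. r N \<ge> 0"
    and U: "Op_real M U r"
  shows "Op_real M (\<lambda>N \<omega>. c N * U N \<omega>) (\<lambda>N. \<bar>c N\<bar> * r N)"
proof -
  have r': "\<bar>c N\<bar> * r N \<ge> 0" for N using r by simp
  have meas: "\<forall>\<^sub>F N in sequentially. U N \<in> borel_measurable (M N)" using U by simp
  then have meas': "\<forall>\<^sub>F N in sequentially. (\<lambda>\<omega>. c N * U N \<omega>) \<in> borel_measurable (M N)"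
    by eventually_elim simp
  show ?thesis
    unfolding Op_real_iff[of "\<lambda>N. \<bar>c N\<bar> * r N", OF r']
  proof (intro conjI allI impI meas')
    fix \<epsilon> :: real assume "\<epsilon> > 0"
    then obtain C where "C > 0"
      and C: "\<forall>\<^sub>F N in sequentially. measure (M N) {\<omega> \<in> space (M N). \<bar>U N \<omega>\<bar> > C * r N} \<le> \<epsilon>"
      using U unfolding Op_real_iff[of r, OF r(1)] by blast
    from meas C eventually_ge_at_top[of 1]
    have "\<forall>\<^sub>F N in sequentially. measure (M N) {\<omega> \<in> space (M N). \<bar>c N * U N \<omega>\<bar> > C * (\<bar>c N\<bar> * r N)} \<le> \<epsilon>"
    proof eventually_elim
      case (elim N)
      interpret prob_space "M N" by (rule prob) fact
      note [measurable] = elim(1)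
      have "\<bar>U N \<omega>\<bar> > C * r N" if "\<bar>c N * U N \<omega>\<bar> > C * (\<bar>c N\<bar> * r N)" for \<omega>
      proof -
        \<comment> \<open>The inequality is strict, so \<open>c N = 0\<close> cannot occur here and
          the factor may be cancelled.\<close>
        have "\<bar>c N\<bar> * (C * r N) < \<bar>c N\<bar> * \<bar>U N \<omega>\<bar>" using that by (simp add: abs_mult ac_simps)
        then show ?thesis by (simp add: mult_less_cancel_left)
      qed
      then have "measure (M N) {\<omega> \<in> space (M N). \<bar>c N * U N \<omega>\<bar> > C * (\<bar>c N\<bar> * r N)}
          \<le> measure (M N) {\<omega> \<in> space (M N). \<bar>U N \<omega>\<bar> > C * r N}"
        by (intro finite_measure_mono) auto
      with elim show ?case by simp
    qed
    with \<open>C > 0\<close> show "\<exists>C>0. \<forall>\<^sub>F N in sequentially.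
        measure (M N) {\<omega> \<in> space (M N). \<bar>c N * U N \<omega>\<bar> > C * (\<bar>c N\<bar> * r N)} \<le> \<epsilon>"
      by blast
  qed
qed

text \<open>For a vanishing rate the threshold \<open>C * r N\<close> eventually drops below any
  fixed \<open>\<epsilon>\<close>, whatever \<open>C\<close> the stochastic bound required.\<close>

lemma Op_real_null_imp_tendsto:
  assumes prob: "\<And>N. N \<ge> 1 \<Longrightarrow> prob_space (M N)" and r: "\<And>N. r N \<ge> 0" "r \<longlonglongrightarrow> 0"
    and U: "Op_real M U r" and "\<epsilon> > 0"
  shows "(\<lambda>N. measure (M N) {\<omega> \<in> space (M N). \<bar>U N \<omega>\<bar> > \<epsilon>}) \<longlonglongrightarrow> 0"
proof (rule order_tendstoI)
  fix a :: real assume "a < 0"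
  then show "\<forall>\<^sub>F N in sequentially. a < measure (M N) {\<omega> \<in> space (M N). \<bar>U N \<omega>\<bar> > \<epsilon>}"
    by (intro always_eventually allI) (auto intro: less_le_trans)
next
  fix a :: real assume "a > 0"
  then have "a / 2 > 0" by simp
  then obtain C where "C > 0"
    and C: "\<forall>\<^sub>F N in sequentially. measure (M N) {\<omega> \<in> space (M N). \<bar>U N \<omega>\<bar> > C * r N} \<le> a / 2"
    using U unfolding Op_real_iff[of r, OF r(1)] by meson
  have "(\<lambda>N. C * r N) \<longlonglongrightarrow> 0" using r(2) by (rule tendsto_mult_right_zero)
  then have "\<forall>\<^sub>F N in sequentially. C * r N < \<epsilon>" using \<open>\<epsilon> > 0\<close> by (rule order_tendstoD)
  moreover have "\<forall>\<^sub>F N in sequentially. U N \<in> borel_measurable (M N)" using U by simp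
  ultimately show "\<forall>\<^sub>F N in sequentially. measure (M N) {\<omega> \<in> space (M N). \<bar>U N \<omega>\<bar> > \<epsilon>} < a"
    using C eventually_ge_at_top[of 1]
  proof eventually_elim
    case (elim N)
    interpret prob_space "M N" by (rule prob) fact
    note [measurable] = elim(2)
    have "measure (M N) {\<omega> \<in> space (M N). \<bar>U N \<omega>\<bar> > \<epsilon>}
        \<le> measure (M N) {\<omega> \<in> space (M N). \<bar>U N \<omega>\<bar> > C * r N}"
      using elim(1) by (intro finite_measure_mono) auto
    with elim \<open>a > 0\<close> show ?case by simp
  qed
qed

text \<open>Only a truncated second moment is available, and \<open>r N\<close> may vanish: then the bound forces
  \<open>U N\<close> to vanish almost surely on the truncation event.\<close>

lemma Op_real_truncated_second_moment:
  assumes prob: "\<And>N. N \<ge> 1 \<Longrightarrow> prob_space (M N)" and r: "\<And>N. r N \<ge> 0"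
    and meas: "\<forall>\<^sub>F N in sequentially. U N \<in> borel_measurable (M N)"
    and trunc: "\<And>\<epsilon>. \<epsilon> > 0 \<Longrightarrow> \<exists>B>0. \<forall>\<^sub>F N in sequentially. \<exists>E\<in>sets (M N).
      measure (M N) (space (M N) - E) \<le> \<epsilon> \<and>
      (\<integral>\<^sup>+\<omega>. indicator E \<omega> * ennreal ((U N \<omega>)\<^sup>2) \<partial>M N) \<le> ennreal (B * (r N)\<^sup>2)"
  shows "Op_real M U r"
  unfolding Op_real_iff[of r, OF r]
proof (intro conjI allI impI meas)
  fix \<epsilon> :: real assume "\<epsilon> > 0"
  then have "\<epsilon> / 2 > 0" by simp
  from trunc[OF this] obtain B where "B > 0" and B: "\<forall>\<^sub>F N in sequentially. \<exists>E\<in>sets (M N).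
      measure (M N) (space (M N) - E) \<le> \<epsilon> / 2 \<and>
      (\<integral>\<^sup>+\<omega>. indicator E \<omega> * ennreal ((U N \<omega>)\<^sup>2) \<partial>M N) \<le> ennreal (B * (r N)\<^sup>2)" by blast
  \<comment> \<open>Chosen so that Chebyshev's bound \<open>B / C^2\<close> equals
    \<open>\<epsilon> / 2\<close>; the other half is reserved for the complement of
    \<open>E\<close>.\<close>
  define C where "C = sqrt (2 * B / \<epsilon>)"
  have C: "C > 0" "C\<^sup>2 = 2 * B / \<epsilon>" using \<open>B > 0\<close> \<open>\<epsilon> > 0\<close> by (simp_all add: C_def)
  from meas B eventually_ge_at_top[of 1]
  have "\<forall>\<^sub>F N in sequentially. measure (M N) {\<omega> \<in> space (M N). \<bar>U N \<omega>\<bar> > C * r N} \<le> \<epsilon>"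
  proof eventually_elim
    case (elim N)
    interpret prob_space "M N" by (rule prob) fact
    note [measurable] = elim(1)
    obtain E where E[measurable]: "E \<in> sets (M N)" and E1: "measure (M N) (space (M N) - E) \<le> \<epsilon> / 2"
      and E2: "(\<integral>\<^sup>+\<omega>. indicator E \<omega> * ennreal ((U N \<omega>)\<^sup>2) \<partial>M N) \<le> ennreal (B * (r N)\<^sup>2)"
      using elim(2) by blast
    let ?S = "{\<omega> \<in> E. \<bar>U N \<omega>\<bar> > C * r N}"
    have "?S = E \<inter> {\<omega> \<in> space (M N). \<bar>U N \<omega>\<bar> > C * r N}"
      using sets.sets_into_space[OF E] by auto
    then have S[measurable]: "?S \<in> sets (M N)" by simp
    have "measure (M N) ?S \<le> \<epsilon> / 2"
    proof (cases "r N = 0")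
      case True
      have "(\<integral>\<^sup>+\<omega>. indicator E \<omega> * ennreal ((U N \<omega>)\<^sup>2) \<partial>M N) = 0" using E2 True by simp
      then have "AE \<omega> in M N. indicator E \<omega> * ennreal ((U N \<omega>)\<^sup>2) = 0"
        by (subst (asm) nn_integral_0_iff_AE) simp_all
      then have "AE \<omega> in M N. \<omega> \<notin> ?S"
        by eventually_elim (use True in \<open>auto split: split_indicator_asm\<close>)
      then have "measure (M N) ?S = 0" using S by (simp add: prob_eq_0)
      then show ?thesis using \<open>\<epsilon> > 0\<close> by simp
    next
      case False
      then have rp: "r N > 0" using r[of N] by simp
      let ?b = "C\<^sup>2 * (r N)\<^sup>2"
      have bp: "?b > 0" using C(1) rp by simp
      have "ennreal ?b * emeasure (M N) ?S = (\<integral>\<^sup>+\<omega>. ennreal ?b * indicator ?S \<omega> \<partial>M N)"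
        by (rule nn_integral_cmult_indicator[symmetric]) (rule S)
      also have "\<dots> \<le> (\<integral>\<^sup>+\<omega>. indicator E \<omega> * ennreal ((U N \<omega>)\<^sup>2) \<partial>M N)"
      proof (rule nn_integral_mono)
        fix \<omega>
        show "ennreal ?b * indicator ?S \<omega> \<le> indicator E \<omega> * ennreal ((U N \<omega>)\<^sup>2)"
        proof (cases "\<omega> \<in> ?S")
          case True
          then have "(C * r N)\<^sup>2 \<le> \<bar>U N \<omega>\<bar>\<^sup>2" using C rp by (intro power_mono) auto
          then show ?thesis using True by (simp add: power_mult_distrib)
        qed simp
      qed
      also note E2
      finally have "ennreal (?b * measure (M N) ?S) \<le> ennreal (B * (r N)\<^sup>2)"
        using bp by (simp add: emeasure_eq_measure ennreal_mult)
      then have "?b * measure (M N) ?S \<le> B * (r N)\<^sup>2"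
        using \<open>B > 0\<close> by (subst (asm) ennreal_le_iff) auto
      then have "(C\<^sup>2 * measure (M N) ?S) * (r N)\<^sup>2 \<le> B * (r N)\<^sup>2" by (simp add: ac_simps)
      then have "C\<^sup>2 * measure (M N) ?S \<le> B" using rp by simp
      then show ?thesis using \<open>B > 0\<close> \<open>\<epsilon> > 0\<close> unfolding C(2) by (simp add: field_simps)
    qed
    moreover have "measure (M N) {\<omega> \<in> space (M N). \<bar>U N \<omega>\<bar> > C * r N} \<le> measure (M N) (?S \<union> (space (M N) - E))"
      by (intro finite_measure_mono) auto
    moreover have "measure (M N) (?S \<union> (space (M N) - E)) \<le> measure (M N) ?S + measure (M N) (space (M N) - E)"
      by (intro measure_Un_le) auto
    ultimately show ?case using E1 by simp
  qed
  with C(1) show "\<exists>C>0. \<forall>\<^sub>F N in sequentially. measure (M N) {\<omega> \<in> space (M N). \<bar>U N \<omega>\<bar> > C * r N} \<le> \<epsilon>"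
    by blast
qed

text \<open>The bound is the one for a sum of at most \<open>N\<close> uncorrelated centred terms
  with second moment \<open>B * c^2 / s\<close>; division by \<open>N\<close> turns it into
  \<open>B\<close> times the square of the rate. In the application \<open>s\<close> is
  \<open>a\<close> and \<open>c\<close> is the rate of the fit.\<close>

lemma Op_real_mean_truncated:
  assumes prob: "\<And>N. N \<ge> 1 \<Longrightarrow> prob_space (M N)"
    and c: "\<And>N. c N \<ge> 0" and s: "\<And>N. s N \<ge> 0" "\<And>N. N \<ge> 1 \<Longrightarrow> s N > 0"
    and meas: "\<And>N. N \<ge> 1 \<Longrightarrow> S N \<in> borel_measurable (M N)"
    and trunc: "\<And>\<epsilon>. \<epsilon> > 0 \<Longrightarrow> \<exists>B>0. \<forall>\<^sub>F N in sequentially. \<exists>E\<in>sets (M N).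
      measure (M N) (space (M N) - E) \<le> \<epsilon> \<and>
      (\<integral>\<^sup>+\<omega>. indicator E \<omega> * ennreal ((S N \<omega>)\<^sup>2) \<partial>M N) \<le> ennreal (real N * (B * (c N)\<^sup>2 / s N))"
  shows "Op_real M (\<lambda>N \<omega>. S N \<omega> / real N) (\<lambda>N. c N / sqrt (real N * s N))"
proof (rule Op_real_truncated_second_moment[OF prob])
  show "0 \<le> c N / sqrt (real N * s N)" for N using c s(1) by simp
  show "\<forall>\<^sub>F N in sequentially. (\<lambda>\<omega>. S N \<omega> / real N) \<in> borel_measurable (M N)"
    using eventually_ge_at_top[of 1] by eventually_elim (use meas in simp)
  fix \<epsilon> :: real assume "\<epsilon> > 0"
  from trunc[OF this] obtain B where "B > 0" and B: "\<forall>\<^sub>F N in sequentially. \<exists>E\<in>sets (M N).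
      measure (M N) (space (M N) - E) \<le> \<epsilon> \<and>
      (\<integral>\<^sup>+\<omega>. indicator E \<omega> * ennreal ((S N \<omega>)\<^sup>2) \<partial>M N) \<le> ennreal (real N * (B * (c N)\<^sup>2 / s N))" by blast
  from B eventually_ge_at_top[of 1]
  have "\<forall>\<^sub>F N in sequentially. \<exists>E\<in>sets (M N). measure (M N) (space (M N) - E) \<le> \<epsilon> \<and>
      (\<integral>\<^sup>+\<omega>. indicator E \<omega> * ennreal ((S N \<omega> / real N)\<^sup>2) \<partial>M N) \<le>
        ennreal (B * (c N / sqrt (real N * s N))\<^sup>2)"
  proof eventually_elim
    case (elim N)
    then obtain E where E[measurable]: "E \<in> sets (M N)" and E1: "measure (M N) (space (M N) - E) \<le> \<epsilon>"
      and E2: "(\<integral>\<^sup>+\<omega>. indicator E \<omega> * ennreal ((S N \<omega>)\<^sup>2) \<partial>M N) \<le> ennreal (real N * (B * (c N)\<^sup>2 / s N))"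
      by blast
    note [measurable] = meas[OF elim(2)]
    have sN: "s N > 0" by (rule s(2)[OF elim(2)])
    have "(\<integral>\<^sup>+\<omega>. indicator E \<omega> * ennreal ((S N \<omega> / real N)\<^sup>2) \<partial>M N) =
        (\<integral>\<^sup>+\<omega>. ennreal (1 / (real N)\<^sup>2) * (indicator E \<omega> * ennreal ((S N \<omega>)\<^sup>2)) \<partial>M N)"
      by (intro nn_integral_cong)
        (auto simp: power_divide ennreal_mult[symmetric] split: split_indicator)
    also have "\<dots> = ennreal (1 / (real N)\<^sup>2) * (\<integral>\<^sup>+\<omega>. indicator E \<omega> * ennreal ((S N \<omega>)\<^sup>2) \<partial>M N)"
      by (rule nn_integral_cmult) measurable
    also have "\<dots> \<le> ennreal (1 / (real N)\<^sup>2) * ennreal (real N * (B * (c N)\<^sup>2 / s N))"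
      by (rule mult_left_mono[OF E2]) simp
    also have "\<dots> = ennreal (1 / (real N)\<^sup>2 * (real N * (B * (c N)\<^sup>2 / s N)))"
      by (rule ennreal_mult[symmetric]) (use \<open>B > 0\<close> sN in auto)
    also have "1 / (real N)\<^sup>2 * (real N * (B * (c N)\<^sup>2 / s N)) = B * (c N / sqrt (real N * s N))\<^sup>2"
      using elim(2) sN by (simp add: power_divide power2_eq_square[of "real N"])
    finally show ?case using E E1 by blast
  qed
  with \<open>B > 0\<close> show "\<exists>B>0. \<forall>\<^sub>F N in sequentially. \<exists>E\<in>sets (M N). measure (M N) (space (M N) - E) \<le> \<epsilon> \<and>
      (\<integral>\<^sup>+\<omega>. indicator E \<omega> * ennreal ((S N \<omega> / real N)\<^sup>2) \<partial>M N) \<le>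
        ennreal (B * (c N / sqrt (real N * s N))\<^sup>2)" by blast
qed

text \<open>The untruncated case. Taking \<open>s\<close> to be \<open>a\<close> serves the leading
  average; \<open>s = 1\<close> serves the average of \<open>\<mu>(X)\<close>, whose variance does
  not inflate with \<open>1 / a\<close>.\<close>

lemma Op_real_mean:
  assumes prob: "\<And>N. N \<ge> 1 \<Longrightarrow> prob_space (M N)"
    and s: "\<And>N. s N \<ge> 0" "\<And>N. N \<ge> 1 \<Longrightarrow> s N > 0"
    and meas: "\<And>N. N \<ge> 1 \<Longrightarrow> S N \<in> borel_measurable (M N)"
    and B: "B > 0" "\<And>N. N \<ge> 1 \<Longrightarrow> (\<integral>\<^sup>+\<omega>. ennreal ((S N \<omega>)\<^sup>2) \<partial>M N) \<le> ennreal (real N * (B / s N))"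
  shows "Op_real M (\<lambda>N \<omega>. S N \<omega> / real N) (\<lambda>N. 1 / sqrt (real N * s N))"
proof (rule Op_real_mean_truncated[where c="\<lambda>_. 1", OF prob _ s meas])
  fix \<epsilon> :: real assume "\<epsilon> > 0"
  have "\<forall>\<^sub>F N in sequentially. \<exists>E\<in>sets (M N). measure (M N) (space (M N) - E) \<le> \<epsilon> \<and>
      (\<integral>\<^sup>+\<omega>. indicator E \<omega> * ennreal ((S N \<omega>)\<^sup>2) \<partial>M N) \<le> ennreal (real N * (B * 1\<^sup>2 / s N))"
    using eventually_ge_at_top[of 1]
  proof eventually_elim
    case (elim N)
    have "(\<integral>\<^sup>+\<omega>. indicator (space (M N)) \<omega> * ennreal ((S N \<omega>)\<^sup>2) \<partial>M N) = (\<integral>\<^sup>+\<omega>. ennreal ((S N \<omega>)\<^sup>2) \<partial>M N)"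
      by (rule nn_integral_cong) simp
    then show ?case
      using B(2)[OF elim] \<open>\<epsilon> > 0\<close> by (intro bexI[of _ "space (M N)"]) auto
  qed
  with B(1) show "\<exists>B>0. \<forall>\<^sub>F N in sequentially. \<exists>E\<in>sets (M N). measure (M N) (space (M N) - E) \<le> \<epsilon> \<and>
      (\<integral>\<^sup>+\<omega>. indicator E \<omega> * ennreal ((S N \<omega>)\<^sup>2) \<partial>M N) \<le> ennreal (real N * (B * 1\<^sup>2 / s N))"
    by blast
qed auto

section \<open>Variance of the influence functions\<close>

text \<open>A single population is fixed. All bounds obtained here involve it only through
  \<open>v\<^sub>1\<close>, \<open>v\<^sub>2\<close> and the rate \<open>a\<close>, which makes them
  uniform along the array.\<close>

locale aipw_population = population +
  fixes \<mu> :: "(nat \<Rightarrow> real) \<Rightarrow> real" and v\<^sub>1 v\<^sub>2 :: real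
  assumes \<mu>_measurable: "\<mu> \<in> borel_measurable (cov_space p)"
    and ignorability: "cond_indep_given Q (sigma_of Q p X) R Y"
    and v_pos: "v\<^sub>1 > 0" "v\<^sub>2 > 0"
    and basic: "basic_assumption Q p R Y X m \<mu> v\<^sub>1 v\<^sub>2"
begin

declare R_measurable[measurable] Y_measurable[measurable] X_measurable[measurable]
  m_measurable[measurable] ps_measurable[measurable] \<mu>_measurable[measurable]

section \<open>The propensity score, the rate and ignorability\<close>

lemma subalgebra_sigma_of: "subalgebra Q (sigma_of Q p X)"
proof -
  have "X \<in> space Q \<rightarrow> space (cov_space p)" using X_measurable by (rule measurable_space[THEN Pi_I])
  then have "sets (sigma_of Q p X) = {X -` A \<inter> space Q | A. A \<in> sets (cov_space p)}"
    unfolding sigma_of_def by (rule sets_vimage_algebra2)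
  then show ?thesis
    unfolding subalgebra_def by (auto simp: sigma_of_def)
qed

sublocale given_X: finite_measure_subalgebra Q "sigma_of Q p X"
  by unfold_locales (rule subalgebra_sigma_of)

lemma X_measurable_sigma_of[measurable]: "X \<in> measurable (sigma_of Q p X) (cov_space p)"
  unfolding sigma_of_def
  by (rule measurable_vimage_algebra1) (use measurable_space[OF X_measurable] in auto)

lemma R_cases: "\<omega> \<in> space Q \<Longrightarrow> R \<omega> = 0 \<or> R \<omega> = 1"
  using R_binary by auto

lemma ps_pos: "AE \<omega> in Q. 0 < \<pi> (X \<omega>)"
proof -
  have "AE \<omega> in Q. inverse (ennreal (\<pi> (X \<omega>))) \<noteq> \<infinity>"
    using mean_inv_ps_finite unfolding mean_inv_ps_def by (intro nn_integral_PInf_AE) auto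
  then show ?thesis
    by eventually_elim (auto simp: not_le[symmetric] ennreal_neg)
qed

lemma ps_le_1: "AE \<omega> in Q. \<pi> (X \<omega>) \<le> 1"
proof -
  have "integrable Q (\<lambda>\<omega>. indicator {1} (R \<omega>) :: real)"
    by (rule integrable_const_bound[where B=1]) auto
  then have "AE \<omega> in Q. real_cond_exp Q (sigma_of Q p X) (\<lambda>\<omega>. indicator {1} (R \<omega>)) \<omega> \<le> 1"
    by (rule given_X.real_cond_exp_le_c) (auto split: split_indicator)
  with ps_propensity show ?thesis by eventually_elim simp
qed

abbreviation "a \<equiv> a_rate Q X \<pi>"

lemma nn_integral_inverse_ps: "(\<integral>\<^sup>+\<omega>. ennreal (1 / \<pi> (X \<omega>)) \<partial>Q) = ennreal (1 / a)"
proof -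
  have "(\<integral>\<^sup>+\<omega>. ennreal (1 / \<pi> (X \<omega>)) \<partial>Q) = mean_inv_ps Q X \<pi>"
    unfolding mean_inv_ps_def
    by (rule nn_integral_cong_AE) (use ps_pos in eventually_elim, simp add: inverse_ennreal inverse_eq_divide)
  also have "\<dots> = ennreal (enn2real (mean_inv_ps Q X \<pi>))"
    using mean_inv_ps_finite by (simp add: ennreal_enn2real)
  finally show ?thesis by (simp add: a_rate_def)
qed

lemma inverse_ps_integrable: "integrable Q (\<lambda>\<omega>. 1 / \<pi> (X \<omega>))"
  and integral_inverse_ps: "(LINT \<omega>|Q. 1 / \<pi> (X \<omega>)) = 1 / a"
proof -
  have nn: "AE \<omega> in Q. 0 \<le> 1 / \<pi> (X \<omega>)" using ps_pos by eventually_elim simp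
  show int: "integrable Q (\<lambda>\<omega>. 1 / \<pi> (X \<omega>))"
    by (rule integrableI_nonneg) (use nn nn_integral_inverse_ps in auto)
  have "0 \<le> 1 / a" by (simp add: a_rate_def)
  then show "(LINT \<omega>|Q. 1 / \<pi> (X \<omega>)) = 1 / a"
    using nn_integral_eq_integral[OF int nn] nn_integral_inverse_ps integral_nonneg_AE[OF nn]
    by (simp add: ennreal_inj)
qed

lemma a_le_1: "a \<le> 1" and a_pos: "a > 0"
proof -
  have "(LINT \<omega>|Q. 1) \<le> (LINT \<omega>|Q. 1 / \<pi> (X \<omega>))"
    by (rule integral_mono_AE[OF _ inverse_ps_integrable], simp)
      (use ps_pos ps_le_1 in eventually_elim, simp)
  then have 1: "1 \<le> 1 / a" by (simp add: integral_inverse_ps prob_space)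
  moreover have "a \<ge> 0" by (simp add: a_rate_def)
  \<comment> \<open>For \<open>a = 0\<close> the quotient \<open>1 / a\<close> would be 0 by
    convention, contradicting the lower bound 1.\<close>
  ultimately show "a > 0" by (cases "a = 0") auto
  with 1 show "a \<le> 1" by simp
qed

text \<open>Ignorability in integrated form: under any integral of a function of \<open>(Y, X)\<close>, the indicator
  \<open>R\<close> may be replaced by \<open>\<pi>(X)\<close>.\<close>

lemma distr_density_R_eq:
  "distr (density Q (\<lambda>\<omega>. ennreal (R \<omega>))) (borel \<Otimes>\<^sub>M cov_space p) (\<lambda>\<omega>. (Y \<omega>, X \<omega>)) =
   distr (density Q (\<lambda>\<omega>. ennreal (\<pi> (X \<omega>)))) (borel \<Otimes>\<^sub>M cov_space p) (\<lambda>\<omega>. (Y \<omega>, X \<omega>))"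
    (is "?D1 = ?D2")
proof -
  let ?E = "{A \<times> B | A B. A \<in> sets (borel :: real measure) \<and> B \<in> sets (cov_space p)}"
  have em: "emeasure (distr (density Q f) (borel \<Otimes>\<^sub>M cov_space p) (\<lambda>\<omega>. (Y \<omega>, X \<omega>))) (A \<times> B) =
      (\<integral>\<^sup>+\<omega>. f \<omega> * (indicator A (Y \<omega>) * indicator B (X \<omega>)) \<partial>Q)"
    if [measurable]: "f \<in> borel_measurable Q" "A \<in> sets borel" "B \<in> sets (cov_space p)" for f A B
  proof -
    have "emeasure (distr (density Q f) (borel \<Otimes>\<^sub>M cov_space p) (\<lambda>\<omega>. (Y \<omega>, X \<omega>))) (A \<times> B) =
        emeasure (density Q f) ((\<lambda>\<omega>. (Y \<omega>, X \<omega>)) -` (A \<times> B) \<inter> space Q)"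
      by (subst emeasure_distr) auto
    also have "\<dots> = (\<integral>\<^sup>+\<omega>. f \<omega> * indicator ((\<lambda>\<omega>. (Y \<omega>, X \<omega>)) -` (A \<times> B) \<inter> space Q) \<omega> \<partial>Q)"
      by (rule emeasure_density) measurable
    also have "\<dots> = (\<integral>\<^sup>+\<omega>. f \<omega> * (indicator A (Y \<omega>) * indicator B (X \<omega>)) \<partial>Q)"
      by (rule nn_integral_cong) (auto split: split_indicator)
    finally show ?thesis .
  qed
  have eq: "emeasure ?D1 (A \<times> B) = emeasure ?D2 (A \<times> B)"
    if [measurable]: "A \<in> sets borel" "B \<in> sets (cov_space p)" for A B
  proof -
    let ?c = "real_cond_exp Q (sigma_of Q p X)"
    let ?iA = "\<lambda>\<omega>. indicator A (Y \<omega>) :: real" and ?iB = "\<lambda>\<omega>. indicator B (X \<omega>) :: real"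
    let ?R = "\<lambda>\<omega>. indicator {1} (R \<omega>) :: real"
    have int1: "integrable Q (\<lambda>\<omega>. ?iB \<omega> * (?R \<omega> * ?iA \<omega>))"
      by (rule integrable_const_bound[where B=1]) (auto split: split_indicator)
    have int2: "integrable Q (\<lambda>\<omega>. (?iB \<omega> * \<pi> (X \<omega>)) * ?iA \<omega>)"
      by (rule integrable_const_bound[where B=1])
        (use ps_pos ps_le_1 in eventually_elim, auto split: split_indicator)
    \<comment> \<open>Tower property: condition on \<open>X\<close>, factor by ignorability, replace
      the conditional probability of \<open>R = 1\<close> by \<open>\<pi>(X)\<close>, and
      uncondition what is left.\<close>
    have "(LINT \<omega>|Q. ?iB \<omega> * (?R \<omega> * ?iA \<omega>)) = (LINT \<omega>|Q. ?iB \<omega> * ?c (\<lambda>\<omega>. ?R \<omega> * ?iA \<omega>) \<omega>)"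
      by (rule given_X.real_cond_exp_intg(2)[symmetric, OF int1]) measurable
    also have "\<dots> = (LINT \<omega>|Q. (?iB \<omega> * \<pi> (X \<omega>)) * ?c ?iA \<omega>)"
    proof (rule integral_cong_AE)
      have "AE \<omega> in Q. ?c (\<lambda>\<omega>. ?R \<omega> * ?iA \<omega>) \<omega> = ?c ?R \<omega> * ?c ?iA \<omega>"
        using ignorability[unfolded cond_indep_given_def, rule_format, of "{1}" A] by simp
      with ps_propensity show "AE \<omega> in Q. ?iB \<omega> * ?c (\<lambda>\<omega>. ?R \<omega> * ?iA \<omega>) \<omega> = (?iB \<omega> * \<pi> (X \<omega>)) * ?c ?iA \<omega>"
        by eventually_elim simp
    qed measurable
    also have "\<dots> = (LINT \<omega>|Q. (?iB \<omega> * \<pi> (X \<omega>)) * ?iA \<omega>)"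
      by (rule given_X.real_cond_exp_intg(2)[OF int2]) measurable
    finally have L: "(LINT \<omega>|Q. ?iB \<omega> * (?R \<omega> * ?iA \<omega>)) = (LINT \<omega>|Q. (?iB \<omega> * \<pi> (X \<omega>)) * ?iA \<omega>)" .
    have "emeasure ?D1 (A \<times> B) = (\<integral>\<^sup>+\<omega>. ennreal (?iB \<omega> * (?R \<omega> * ?iA \<omega>)) \<partial>Q)"
      by (subst em, simp, simp, simp, rule nn_integral_cong)
        (auto dest!: R_cases split: split_indicator)
    also have "\<dots> = ennreal (LINT \<omega>|Q. ?iB \<omega> * (?R \<omega> * ?iA \<omega>))"
      by (rule nn_integral_eq_integral[OF int1]) simp
    also have "\<dots> = (\<integral>\<^sup>+\<omega>. ennreal ((?iB \<omega> * \<pi> (X \<omega>)) * ?iA \<omega>) \<partial>Q)"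
      unfolding L by (rule nn_integral_eq_integral[OF int2, symmetric])
        (use ps_pos in eventually_elim, simp)
    also have "\<dots> = emeasure ?D2 (A \<times> B)"
      by (subst em, simp, simp, simp, rule nn_integral_cong) (auto split: split_indicator)
    finally show ?thesis .
  qed
  \<comment> \<open>Rectangles form an intersection-stable generator. The whole space is itself a
    rectangle, of finite mass because \<open>R\<close> is at most 1, so a constant sequence exhausts
    it.\<close>
  show ?thesis
  proof (rule measure_eqI_generator_eq[where E = ?E and \<Omega> = "space borel \<times> space (cov_space p)"
        and A = "\<lambda>_. space borel \<times> space (cov_space p)"])
    show "Int_stable ?E" by (rule Int_stable_pair_measure_generator)
    show "?E \<subseteq> Pow (space borel \<times> space (cov_space p))"
      by (auto dest: sets.sets_into_space)
    show "emeasure ?D1 S = emeasure ?D2 S" if "S \<in> ?E" for S using that eq by blast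
    show "sets ?D1 = sigma_sets (space borel \<times> space (cov_space p)) ?E"
      "sets ?D2 = sigma_sets (space borel \<times> space (cov_space p)) ?E"
      by (simp_all add: sets_pair_measure)
    show "range (\<lambda>_::nat. space borel \<times> space (cov_space p)) \<subseteq> ?E" by blast
    show "(\<Union>i::nat. space borel \<times> space (cov_space p)) = space borel \<times> space (cov_space p)" by simp
    have "emeasure ?D1 (space borel \<times> space (cov_space p)) \<le> (\<integral>\<^sup>+\<omega>. 1 \<partial>Q)"
      by (subst em, simp, simp, simp, rule nn_integral_mono)
        (auto dest!: R_cases split: split_indicator)
    then show "emeasure ?D1 (space borel \<times> space (cov_space p)) \<noteq> \<infinity>"
      by (auto simp: emeasure_space_1 top_unique)
  qed
qed

text \<open>A reading of the identity of image measures for real integrands. The equivalence of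
  integrability matters as much as the value: expressions weighted by \<open>R / \<pi>(X)\<close>
  are not known to be integrable beforehand.\<close>

lemma
  fixes g :: "real \<times> (nat \<Rightarrow> real) \<Rightarrow> real"
  assumes g[measurable]: "g \<in> borel_measurable (borel \<Otimes>\<^sub>M cov_space p)"
  shows integrable_R_iff:
    "integrable Q (\<lambda>\<omega>. R \<omega> * g (Y \<omega>, X \<omega>)) \<longleftrightarrow> integrable Q (\<lambda>\<omega>. \<pi> (X \<omega>) * g (Y \<omega>, X \<omega>))"
    and integral_R_eq:
    "(LINT \<omega>|Q. R \<omega> * g (Y \<omega>, X \<omega>)) = (LINT \<omega>|Q. \<pi> (X \<omega>) * g (Y \<omega>, X \<omega>))"
proof -
  have R0: "AE \<omega> in Q. 0 \<le> R \<omega>" by (rule AE_I2) (use R_cases in fastforce)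
  have p0: "AE \<omega> in Q. 0 \<le> \<pi> (X \<omega>)" using ps_pos by eventually_elim simp
  have *: "integrable (distr (density Q (\<lambda>\<omega>. ennreal (f \<omega>))) (borel \<Otimes>\<^sub>M cov_space p) (\<lambda>\<omega>. (Y \<omega>, X \<omega>))) g
        \<longleftrightarrow> integrable Q (\<lambda>\<omega>. f \<omega> * g (Y \<omega>, X \<omega>))"
    "integral\<^sup>L (distr (density Q (\<lambda>\<omega>. ennreal (f \<omega>))) (borel \<Otimes>\<^sub>M cov_space p) (\<lambda>\<omega>. (Y \<omega>, X \<omega>))) g
        = (LINT \<omega>|Q. f \<omega> * g (Y \<omega>, X \<omega>))"
    if [measurable]: "f \<in> borel_measurable Q" and "AE \<omega> in Q. 0 \<le> f \<omega>" for f
    using that(2) by (simp_all add: integrable_distr_eq integrable_density integral_distr integral_density)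
  show "integrable Q (\<lambda>\<omega>. R \<omega> * g (Y \<omega>, X \<omega>)) \<longleftrightarrow> integrable Q (\<lambda>\<omega>. \<pi> (X \<omega>) * g (Y \<omega>, X \<omega>))"
    using *(1)[OF R_measurable R0] *(1)[OF _ p0] unfolding distr_density_R_eq by simp
  show "(LINT \<omega>|Q. R \<omega> * g (Y \<omega>, X \<omega>)) = (LINT \<omega>|Q. \<pi> (X \<omega>) * g (Y \<omega>, X \<omega>))"
    using *(2)[OF R_measurable R0] *(2)[OF _ p0] unfolding distr_density_R_eq by simp
qed

text \<open>Given \<open>(Y, X)\<close>, the weight \<open>R / \<pi>(X)\<close> has conditional mean
  1. The proof exchanges \<open>R\<close> for \<open>\<pi>(X)\<close> in front of
  \<open>g / \<pi>\<close>; the cancellation is valid almost surely, where the propensity is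
  positive.\<close>

lemma
  fixes g :: "real \<times> (nat \<Rightarrow> real) \<Rightarrow> real"
  assumes g[measurable]: "g \<in> borel_measurable (borel \<Otimes>\<^sub>M cov_space p)"
    and int: "integrable Q (\<lambda>\<omega>. g (Y \<omega>, X \<omega>))"
  shows integrable_centered_weight: "integrable Q (\<lambda>\<omega>. (R \<omega> / \<pi> (X \<omega>) - 1) * g (Y \<omega>, X \<omega>))"
    and integral_centered_weight: "(LINT \<omega>|Q. (R \<omega> / \<pi> (X \<omega>) - 1) * g (Y \<omega>, X \<omega>)) = 0"
proof -
  let ?h = "\<lambda>z. g z / \<pi> (snd z)"
  have h: "?h \<in> borel_measurable (borel \<Otimes>\<^sub>M cov_space p)" by measurable
  have ae: "AE \<omega> in Q. \<pi> (X \<omega>) * ?h (Y \<omega>, X \<omega>) = g (Y \<omega>, X \<omega>)"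
    using ps_pos by eventually_elim simp
  have "integrable Q (\<lambda>\<omega>. \<pi> (X \<omega>) * ?h (Y \<omega>, X \<omega>)) \<longleftrightarrow> integrable Q (\<lambda>\<omega>. g (Y \<omega>, X \<omega>))"
    by (rule integrable_cong_AE[OF _ _ ae]) measurable
  then have intR: "integrable Q (\<lambda>\<omega>. R \<omega> * ?h (Y \<omega>, X \<omega>))"
    using int integrable_R_iff[OF h] by simp
  have "(LINT \<omega>|Q. \<pi> (X \<omega>) * ?h (Y \<omega>, X \<omega>)) = (LINT \<omega>|Q. g (Y \<omega>, X \<omega>))"
    by (rule integral_cong_AE[OF _ _ ae]) measurable
  then have eqR: "(LINT \<omega>|Q. R \<omega> * ?h (Y \<omega>, X \<omega>)) = (LINT \<omega>|Q. g (Y \<omega>, X \<omega>))"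
    using integral_R_eq[OF h] by simp
  have eq: "(R \<omega> / \<pi> (X \<omega>) - 1) * g (Y \<omega>, X \<omega>) = R \<omega> * ?h (Y \<omega>, X \<omega>) - g (Y \<omega>, X \<omega>)" for \<omega>
    by (simp add: algebra_simps)
  show "integrable Q (\<lambda>\<omega>. (R \<omega> / \<pi> (X \<omega>) - 1) * g (Y \<omega>, X \<omega>))"
    unfolding eq by (rule Bochner_Integration.integrable_diff[OF intR int])
  show "(LINT \<omega>|Q. (R \<omega> / \<pi> (X \<omega>) - 1) * g (Y \<omega>, X \<omega>)) = 0"
    unfolding eq Bochner_Integration.integral_diff[OF intR int] eqR by simp
qed

text \<open>Given \<open>(Y, X)\<close>, the weight \<open>R / \<pi>(X)\<close> has conditional
  variance \<open>1 / \<pi>(X) - 1\<close>. Integrability is required with weight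
  \<open>1 / \<pi>(X)\<close>, which is at least 1 and therefore also covers the unweighted
  square.\<close>

lemma
  fixes g :: "real \<times> (nat \<Rightarrow> real) \<Rightarrow> real"
  assumes g[measurable]: "g \<in> borel_measurable (borel \<Otimes>\<^sub>M cov_space p)"
    and int: "integrable Q (\<lambda>\<omega>. 1 / \<pi> (X \<omega>) * (g (Y \<omega>, X \<omega>))\<^sup>2)"
  shows integrable_square_of_weighted: "integrable Q (\<lambda>\<omega>. (g (Y \<omega>, X \<omega>))\<^sup>2)"
    and integrable_centered_weight_square:
      "integrable Q (\<lambda>\<omega>. ((R \<omega> / \<pi> (X \<omega>) - 1) * g (Y \<omega>, X \<omega>))\<^sup>2)"
    and integral_centered_weight_square:
      "(LINT \<omega>|Q. ((R \<omega> / \<pi> (X \<omega>) - 1) * g (Y \<omega>, X \<omega>))\<^sup>2) =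
        (LINT \<omega>|Q. (1 / \<pi> (X \<omega>) - 1) * (g (Y \<omega>, X \<omega>))\<^sup>2)"
proof -
  show int2: "integrable Q (\<lambda>\<omega>. (g (Y \<omega>, X \<omega>))\<^sup>2)"
  proof (rule Bochner_Integration.integrable_bound[OF int])
    show "AE \<omega> in Q. norm ((g (Y \<omega>, X \<omega>))\<^sup>2) \<le> norm (1 / \<pi> (X \<omega>) * (g (Y \<omega>, X \<omega>))\<^sup>2)"
      using ps_pos ps_le_1
    proof eventually_elim
      case (elim \<omega>)
      then have "1 * (g (Y \<omega>, X \<omega>))\<^sup>2 \<le> 1 / \<pi> (X \<omega>) * (g (Y \<omega>, X \<omega>))\<^sup>2"
        by (intro mult_right_mono) simp_all
      then show ?case using elim by simp
    qed
  qed measurable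
  \<comment> \<open>From \<open>R^2 = R\<close>, the square of \<open>R / \<pi> - 1\<close> is
    \<open>R * (1 / \<pi>^2 - 2 / \<pi>) + 1\<close>; exchanging \<open>R\<close> for
    \<open>\<pi>\<close> leaves \<open>1 / \<pi> - 2\<close> in front, plus 1.\<close>
  let ?h = "\<lambda>z. (1 / (\<pi> (snd z))\<^sup>2 - 2 / \<pi> (snd z)) * (g z)\<^sup>2"
  have h: "?h \<in> borel_measurable (borel \<Otimes>\<^sub>M cov_space p)" by measurable
  let ?k = "\<lambda>\<omega>. 1 / \<pi> (X \<omega>) * (g (Y \<omega>, X \<omega>))\<^sup>2 - 2 * (g (Y \<omega>, X \<omega>))\<^sup>2"
  have k: "integrable Q ?k" using int int2 by simp
  have ae: "AE \<omega> in Q. \<pi> (X \<omega>) * ?h (Y \<omega>, X \<omega>) = ?k \<omega>"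
    using ps_pos by eventually_elim (simp add: field_simps power2_eq_square)
  have "integrable Q (\<lambda>\<omega>. \<pi> (X \<omega>) * ?h (Y \<omega>, X \<omega>)) \<longleftrightarrow> integrable Q ?k"
    by (rule integrable_cong_AE[OF _ _ ae]) measurable
  then have intR: "integrable Q (\<lambda>\<omega>. R \<omega> * ?h (Y \<omega>, X \<omega>))"
    using k integrable_R_iff[OF h] by simp
  have "(LINT \<omega>|Q. \<pi> (X \<omega>) * ?h (Y \<omega>, X \<omega>)) = integral\<^sup>L Q ?k"
    by (rule integral_cong_AE[OF _ _ ae]) measurable
  then have eqR: "(LINT \<omega>|Q. R \<omega> * ?h (Y \<omega>, X \<omega>)) = integral\<^sup>L Q ?k"
    using integral_R_eq[OF h] by simp
  have eq: "((R \<omega> / \<pi> (X \<omega>) - 1) * g (Y \<omega>, X \<omega>))\<^sup>2 = R \<omega> * ?h (Y \<omega>, X \<omega>) + (g (Y \<omega>, X \<omega>))\<^sup>2"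
    if "\<omega> \<in> space Q" for \<omega>
  proof -
    have "((r * q - 1) * u)\<^sup>2 = r * ((q\<^sup>2 - 2 * q) * u\<^sup>2) + u\<^sup>2" if "r = 0 \<or> r = 1" for r q u :: real
      using that by (auto simp: power2_eq_square algebra_simps)
    from this[OF R_cases[OF that], of "1 / \<pi> (X \<omega>)"] show ?thesis by (simp add: power_divide)
  qed
  have "integrable Q (\<lambda>\<omega>. ((R \<omega> / \<pi> (X \<omega>) - 1) * g (Y \<omega>, X \<omega>))\<^sup>2) \<longleftrightarrow>
      integrable Q (\<lambda>\<omega>. R \<omega> * ?h (Y \<omega>, X \<omega>) + (g (Y \<omega>, X \<omega>))\<^sup>2)"
    by (rule Bochner_Integration.integrable_cong[OF refl eq])
  then show "integrable Q (\<lambda>\<omega>. ((R \<omega> / \<pi> (X \<omega>) - 1) * g (Y \<omega>, X \<omega>))\<^sup>2)"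
    using Bochner_Integration.integrable_add[OF intR int2] by blast
  have "(LINT \<omega>|Q. ((R \<omega> / \<pi> (X \<omega>) - 1) * g (Y \<omega>, X \<omega>))\<^sup>2) =
      (LINT \<omega>|Q. R \<omega> * ?h (Y \<omega>, X \<omega>) + (g (Y \<omega>, X \<omega>))\<^sup>2)"
    by (rule Bochner_Integration.integral_cong[OF refl eq])
  also have "\<dots> = integral\<^sup>L Q ?k + (LINT \<omega>|Q. (g (Y \<omega>, X \<omega>))\<^sup>2)"
    by (subst Bochner_Integration.integral_add[OF intR int2]) (simp only: eqR)
  also have "\<dots> = (LINT \<omega>|Q. ?k \<omega> + (g (Y \<omega>, X \<omega>))\<^sup>2)"
    by (rule Bochner_Integration.integral_add[OF k int2, symmetric])
  also have "\<dots> = (LINT \<omega>|Q. (1 / \<pi> (X \<omega>) - 1) * (g (Y \<omega>, X \<omega>))\<^sup>2)"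
    by (rule Bochner_Integration.integral_cong) (auto simp: algebra_simps)
  finally show "(LINT \<omega>|Q. ((R \<omega> / \<pi> (X \<omega>) - 1) * g (Y \<omega>, X \<omega>))\<^sup>2) =
        (LINT \<omega>|Q. (1 / \<pi> (X \<omega>) - 1) * (g (Y \<omega>, X \<omega>))\<^sup>2)" .
qed

section \<open>Consequences of the conditional second moment bounds\<close>

lemma Y_square_integrable: "integrable Q (\<lambda>\<omega>. (Y \<omega>)\<^sup>2)"
  and variance_Y_le: "variance Y \<le> v\<^sub>2"
  and cond_residual_ge: "AE \<omega> in Q.
        nn_cond_exp Q (sigma_of Q p X) (\<lambda>\<omega>. ennreal ((Y \<omega> - m (X \<omega>))\<^sup>2)) \<omega> \<ge> ennreal v\<^sub>1"
  and cond_residual_le: "AE \<omega> in Q.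
        nn_cond_exp Q (sigma_of Q p X) (\<lambda>\<omega>. ennreal ((Y \<omega> - \<mu> (X \<omega>))\<^sup>2)) \<omega> \<le> ennreal v\<^sub>2"
  using basic unfolding basic_assumption_def by auto

text \<open>A weight depending on \<open>X\<close> may be moved under the nonnegative conditional
  expectation, where the bound \<open>v\<^sub>2\<close> applies. Nothing needs to be integrable for
  this, so integrability comes out as a consequence.\<close>

lemma
  fixes w :: "(nat \<Rightarrow> real) \<Rightarrow> real"
  assumes w[measurable]: "w \<in> borel_measurable (cov_space p)"
    and w0: "AE \<omega> in Q. 0 \<le> w (X \<omega>)" and wi: "integrable Q (\<lambda>\<omega>. w (X \<omega>))"
  shows integrable_weighted_residual: "integrable Q (\<lambda>\<omega>. w (X \<omega>) * (Y \<omega> - \<mu> (X \<omega>))\<^sup>2)"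
    and integral_weighted_residual_le:
      "(LINT \<omega>|Q. w (X \<omega>) * (Y \<omega> - \<mu> (X \<omega>))\<^sup>2) \<le> v\<^sub>2 * (LINT \<omega>|Q. w (X \<omega>))"
proof -
  let ?f = "\<lambda>\<omega>. w (X \<omega>) * (Y \<omega> - \<mu> (X \<omega>))\<^sup>2"
  have f0: "AE \<omega> in Q. 0 \<le> ?f \<omega>" using w0 by eventually_elim simp
  have W0: "0 \<le> (LINT \<omega>|Q. w (X \<omega>))" by (rule integral_nonneg_AE[OF w0])
  have "(\<integral>\<^sup>+\<omega>. ennreal (?f \<omega>) \<partial>Q) = (\<integral>\<^sup>+\<omega>. ennreal (w (X \<omega>)) * ennreal ((Y \<omega> - \<mu> (X \<omega>))\<^sup>2) \<partial>Q)"
    by (rule nn_integral_cong_AE) (use w0 in eventually_elim, simp add: ennreal_mult)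
  also have "\<dots> = (\<integral>\<^sup>+\<omega>. ennreal (w (X \<omega>)) *
      nn_cond_exp Q (sigma_of Q p X) (\<lambda>\<omega>. ennreal ((Y \<omega> - \<mu> (X \<omega>))\<^sup>2)) \<omega> \<partial>Q)"
    by (rule given_X.nn_cond_exp_intg[symmetric]) measurable
  also have "\<dots> \<le> (\<integral>\<^sup>+\<omega>. ennreal (w (X \<omega>)) * ennreal v\<^sub>2 \<partial>Q)"
    by (rule nn_integral_mono_AE) (use cond_residual_le in eventually_elim, simp add: mult_left_mono)
  also have "\<dots> = (\<integral>\<^sup>+\<omega>. ennreal (w (X \<omega>)) \<partial>Q) * ennreal v\<^sub>2"
    by (rule nn_integral_multc) measurable
  also have "\<dots> = ennreal (v\<^sub>2 * (LINT \<omega>|Q. w (X \<omega>)))"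
    using v_pos W0 by (simp add: nn_integral_eq_integral[OF wi w0] ennreal_mult mult.commute)
  finally have le: "(\<integral>\<^sup>+\<omega>. ennreal (?f \<omega>) \<partial>Q) \<le> ennreal (v\<^sub>2 * (LINT \<omega>|Q. w (X \<omega>)))" .
  show int: "integrable Q ?f"
    by (rule integrableI_nonneg) (use f0 le in \<open>auto intro: le_less_trans\<close>)
  from le show "integral\<^sup>L Q ?f \<le> v\<^sub>2 * (LINT \<omega>|Q. w (X \<omega>))"
    unfolding nn_integral_eq_integral[OF int f0] using v_pos W0
    by (subst (asm) ennreal_le_iff) auto
qed

lemma residual_square_integrable: "integrable Q (\<lambda>\<omega>. (Y \<omega> - \<mu> (X \<omega>))\<^sup>2)"
  and residual_second_moment_le: "(LINT \<omega>|Q. (Y \<omega> - \<mu> (X \<omega>))\<^sup>2) \<le> v\<^sub>2"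
proof -
  have *: "(\<lambda>_. 1 :: real) \<in> borel_measurable (cov_space p)" "AE \<omega> in Q. 0 \<le> (1 :: real)"
    "integrable Q (\<lambda>\<omega>. 1 :: real)" by auto
  show "integrable Q (\<lambda>\<omega>. (Y \<omega> - \<mu> (X \<omega>))\<^sup>2)"
    using integrable_weighted_residual[OF *] by simp
  show "(LINT \<omega>|Q. (Y \<omega> - \<mu> (X \<omega>))\<^sup>2) \<le> v\<^sub>2"
    using integral_weighted_residual_le[OF *] by (simp add: prob_space)
qed

text \<open>No moment of \<open>\<mu>(X)\<close> is assumed; it is the difference of
  \<open>Y\<close> and the residual.\<close>

lemma \<mu>_square_integrable: "integrable Q (\<lambda>\<omega>. (\<mu> (X \<omega>))\<^sup>2)"
  using integrable_square_diff[OF _ _ Y_square_integrable residual_square_integrable] by simp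

text \<open>Conditional Jensen inequality for the square.\<close>

lemma m_square_integrable: "integrable Q (\<lambda>\<omega>. (m (X \<omega>))\<^sup>2)"
proof -
  have "integrable Q (\<lambda>\<omega>. (real_cond_exp Q (sigma_of Q p X) Y \<omega>)\<^sup>2)"
    by (rule given_X.integrable_convex_cond_exp[where I=UNIV and q=power2])
      (use Y_integrable Y_square_integrable in \<open>auto simp: convex_power2 emeasure_space_1\<close>)
  also have "?this \<longleftrightarrow> ?thesis"
    by (rule integrable_cong_AE) (use m_regression in \<open>auto elim: eventually_mono\<close>)
  finally show ?thesis .
qed

text \<open>Since \<open>m\<close> is the regression function, it minimises the conditional mean squared error; hence
  the lower bound \<open>v\<^sub>1\<close> holds for every square integrable predictor \<open>h\<close>.\<close>

lemma integral_weighted_error_ge: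
  fixes w h :: "(nat \<Rightarrow> real) \<Rightarrow> real"
  assumes w[measurable]: "w \<in> borel_measurable (cov_space p)"
    and h[measurable]: "h \<in> borel_measurable (cov_space p)"
    and w0: "AE \<omega> in Q. 0 \<le> w (X \<omega>)" and wi: "integrable Q (\<lambda>\<omega>. w (X \<omega>))"
    and hi: "integrable Q (\<lambda>\<omega>. (h (X \<omega>))\<^sup>2)"
    and whi: "integrable Q (\<lambda>\<omega>. w (X \<omega>) * (Y \<omega> - h (X \<omega>))\<^sup>2)"
  shows "v\<^sub>1 * (LINT \<omega>|Q. w (X \<omega>)) \<le> (LINT \<omega>|Q. w (X \<omega>) * (Y \<omega> - h (X \<omega>))\<^sup>2)"
proof -
  let ?c = "real_cond_exp Q (sigma_of Q p X)"
  let ?\<epsilon> = "\<lambda>\<omega>. Y \<omega> - m (X \<omega>)" and ?d = "\<lambda>\<omega>. m (X \<omega>) - h (X \<omega>)"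
  have e2: "integrable Q (\<lambda>\<omega>. (?\<epsilon> \<omega>)\<^sup>2)"
    by (rule integrable_square_diff) (use Y_square_integrable m_square_integrable in auto)
  have d2: "integrable Q (\<lambda>\<omega>. (?d \<omega>)\<^sup>2)"
    by (rule integrable_square_diff) (use hi m_square_integrable in auto)
  have de: "integrable Q (\<lambda>\<omega>. 2 * ?d \<omega> * ?\<epsilon> \<omega>)"
  proof -
    have "integrable Q (\<lambda>\<omega>. ?d \<omega> * ?\<epsilon> \<omega>)"
      by (rule integrable_mult_of_square_integrable[OF _ _ d2 e2]) measurable
    from integrable_mult_right[OF this, of 2] show ?thesis by (simp only: mult.assoc)
  qed
  have mi: "integrable Q (\<lambda>\<omega>. m (X \<omega>))"
    by (rule square_integrable_imp_integrable[OF _ m_square_integrable]) simp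
  have "AE \<omega> in Q. ?c ?\<epsilon> \<omega> = ?c Y \<omega> - ?c (\<lambda>\<omega>. m (X \<omega>)) \<omega>"
    by (rule given_X.real_cond_exp_diff[OF Y_integrable mi])
  moreover have "AE \<omega> in Q. ?c (\<lambda>\<omega>. m (X \<omega>)) \<omega> = m (X \<omega>)"
    by (rule given_X.real_cond_exp_F_meas[OF mi]) measurable
  ultimately have c0: "AE \<omega> in Q. ?c ?\<epsilon> \<omega> = 0"
    using m_regression by eventually_elim simp
  have c1: "AE \<omega> in Q. ?c (\<lambda>\<omega>. 2 * ?d \<omega> * ?\<epsilon> \<omega>) \<omega> = 2 * ?d \<omega> * ?c ?\<epsilon> \<omega>"
    by (rule given_X.real_cond_exp_mult[OF _ _ de]) measurable
  have c2: "AE \<omega> in Q. 0 \<le> ?c (\<lambda>\<omega>. (?d \<omega>)\<^sup>2) \<omega>"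
    by (rule given_X.real_cond_exp_pos) auto
  have c3: "AE \<omega> in Q. v\<^sub>1 \<le> ?c (\<lambda>\<omega>. (?\<epsilon> \<omega>)\<^sup>2) \<omega>"
  proof -
    \<comment> \<open>The lower bound is given in the extended reals, and \<open>enn2real\<close>
      sends infinity to 0; the conditional expectation must be shown finite before the bound passes
      to reals.\<close>
    let ?g = "nn_cond_exp Q (sigma_of Q p X) (\<lambda>\<omega>. ennreal ((?\<epsilon> \<omega>)\<^sup>2))"
    have "(\<integral>\<^sup>+\<omega>. 1 * ?g \<omega> \<partial>Q) = (\<integral>\<^sup>+\<omega>. 1 * ennreal ((?\<epsilon> \<omega>)\<^sup>2) \<partial>Q)"
      by (rule given_X.nn_cond_exp_intg) measurable
    also have "\<dots> < \<infinity>" using nn_integral_eq_integral[OF e2] by simp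
    finally have "AE \<omega> in Q. ?g \<omega> \<noteq> \<infinity>"
      by (intro nn_integral_PInf_AE) auto
    moreover have "AE \<omega> in Q. 0 = nn_cond_exp Q (sigma_of Q p X) (\<lambda>_. 0) \<omega>"
      by (rule given_X.nn_cond_exp_F_meas) simp
    ultimately show ?thesis using cond_residual_ge
    proof eventually_elim
      case (elim \<omega>)
      have "(\<lambda>\<omega>. ennreal (- (?\<epsilon> \<omega>)\<^sup>2)) = (\<lambda>_. 0)" by (auto simp: ennreal_neg)
      then have "?c (\<lambda>\<omega>. (?\<epsilon> \<omega>)\<^sup>2) \<omega> = enn2real (?g \<omega>)"
        using elim by (simp add: real_cond_exp_def)
      moreover have "enn2real (ennreal v\<^sub>1) \<le> enn2real (?g \<omega>)"
        using elim by (intro enn2real_mono) (auto simp: less_top)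
      ultimately show ?case using v_pos by simp
    qed
  qed
  \<comment> \<open>Expansion around \<open>m\<close>: given \<open>X\<close>, the cross term has
    conditional mean zero and the last square is nonnegative, so the conditional error is at least
    that of \<open>m\<close>.\<close>
  have exp: "(Y \<omega> - h (X \<omega>))\<^sup>2 = (?\<epsilon> \<omega>)\<^sup>2 + (2 * ?d \<omega> * ?\<epsilon> \<omega> + (?d \<omega>)\<^sup>2)" for \<omega>
    by (simp add: power2_eq_square algebra_simps)
  have s1: "AE \<omega> in Q. ?c (\<lambda>\<omega>. (Y \<omega> - h (X \<omega>))\<^sup>2) \<omega> =
      ?c (\<lambda>\<omega>. (?\<epsilon> \<omega>)\<^sup>2) \<omega> + ?c (\<lambda>\<omega>. 2 * ?d \<omega> * ?\<epsilon> \<omega> + (?d \<omega>)\<^sup>2) \<omega>"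
    unfolding exp by (rule given_X.real_cond_exp_add[OF e2 Bochner_Integration.integrable_add[OF de d2]])
  have s2: "AE \<omega> in Q. ?c (\<lambda>\<omega>. 2 * ?d \<omega> * ?\<epsilon> \<omega> + (?d \<omega>)\<^sup>2) \<omega> =
      ?c (\<lambda>\<omega>. 2 * ?d \<omega> * ?\<epsilon> \<omega>) \<omega> + ?c (\<lambda>\<omega>. (?d \<omega>)\<^sup>2) \<omega>"
    by (rule given_X.real_cond_exp_add[OF de d2])
  have ge: "AE \<omega> in Q. v\<^sub>1 \<le> ?c (\<lambda>\<omega>. (Y \<omega> - h (X \<omega>))\<^sup>2) \<omega>"
    using s1 s2 c0 c1 c2 c3 by eventually_elim simp
  have "v\<^sub>1 * (LINT \<omega>|Q. w (X \<omega>)) = (LINT \<omega>|Q. w (X \<omega>) * v\<^sub>1)" by simp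
  also have "\<dots> \<le> (LINT \<omega>|Q. w (X \<omega>) * ?c (\<lambda>\<omega>. (Y \<omega> - h (X \<omega>))\<^sup>2) \<omega>)"
  proof (rule integral_mono_AE)
    show "integrable Q (\<lambda>\<omega>. w (X \<omega>) * ?c (\<lambda>\<omega>. (Y \<omega> - h (X \<omega>))\<^sup>2) \<omega>)"
      by (rule given_X.real_cond_exp_intg(1)[OF whi]) measurable
    show "AE \<omega> in Q. w (X \<omega>) * v\<^sub>1 \<le> w (X \<omega>) * ?c (\<lambda>\<omega>. (Y \<omega> - h (X \<omega>))\<^sup>2) \<omega>"
      using w0 ge by eventually_elim (rule mult_left_mono)
  qed (use wi in simp)
  also have "\<dots> = (LINT \<omega>|Q. w (X \<omega>) * (Y \<omega> - h (X \<omega>))\<^sup>2)"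
    by (rule given_X.real_cond_exp_intg(2)[OF whi]) measurable
  finally show ?thesis .
qed

section \<open>The two influence functions and their variances\<close>

definition inflation :: real where
  "inflation = (LINT \<omega>|Q. (1 / \<pi> (X \<omega>) - 1) * (Y \<omega> - \<mu> (X \<omega>))\<^sup>2)"

text \<open>The weight \<open>1 / \<pi>(X) - 1\<close> is nonnegative with mean
  \<open>1 / a - 1\<close>, and the residual bounds apply under any such weight. The missing
  \<open>v\<^sub>1\<close> in the lower bound will be supplied by the variance of \<open>Y\<close>
  or of the residual.\<close>

lemma inflation_bounds: "v\<^sub>1 * (1 / a - 1) \<le> inflation" "inflation \<le> v\<^sub>2 * (1 / a - 1)"
proof -
  let ?w = "\<lambda>x. 1 / \<pi> x - 1"
  have w: "?w \<in> borel_measurable (cov_space p)" by measurable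
  have w0: "AE \<omega> in Q. 0 \<le> ?w (X \<omega>)" using ps_pos ps_le_1 by eventually_elim simp
  have wi: "integrable Q (\<lambda>\<omega>. ?w (X \<omega>))" using inverse_ps_integrable by simp
  have W: "(LINT \<omega>|Q. ?w (X \<omega>)) = 1 / a - 1"
    using inverse_ps_integrable by (simp add: integral_inverse_ps prob_space)
  show "v\<^sub>1 * (1 / a - 1) \<le> inflation"
    using integral_weighted_error_ge[OF w \<mu>_measurable w0 wi \<mu>_square_integrable
        integrable_weighted_residual[OF w w0 wi]] by (simp add: W inflation_def)
  show "inflation \<le> v\<^sub>2 * (1 / a - 1)"
    using integral_weighted_residual_le[OF w w0 wi] by (simp add: W inflation_def)
qed

lemma inverse_weighted_residual_integrable:
  "integrable Q (\<lambda>\<omega>. 1 / \<pi> (X \<omega>) * (Y \<omega> - \<mu> (X \<omega>))\<^sup>2)"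
  by (rule integrable_weighted_residual[OF _ _ inverse_ps_integrable])
    (use ps_pos in \<open>auto elim: eventually_mono\<close>)

text \<open>Both influence functions are instances: the constant \<open>h\<close> equal to the mean
  of \<open>Y\<close> gives \<open>psi\<close>, and \<open>h = \<mu>\<close> gives the weighted
  residual. The second summand of \<open>G\<close> is a function of \<open>(Y, X)\<close> times a
  centred weight, hence uncorrelated with the first.\<close>

lemma
  fixes h :: "(nat \<Rightarrow> real) \<Rightarrow> real"
  assumes h[measurable]: "h \<in> borel_measurable (cov_space p)"
    and hi: "integrable Q (\<lambda>\<omega>. (h (X \<omega>))\<^sup>2)"
  defines "G \<equiv> \<lambda>\<omega>. (Y \<omega> - h (X \<omega>)) + (R \<omega> / \<pi> (X \<omega>) - 1) * (Y \<omega> - \<mu> (X \<omega>))"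
  shows square_integrable_augmented: "integrable Q (\<lambda>\<omega>. (G \<omega>)\<^sup>2)"
    and expectation_augmented: "expectation G = expectation (\<lambda>\<omega>. Y \<omega> - h (X \<omega>))"
    and variance_augmented: "variance G = variance (\<lambda>\<omega>. Y \<omega> - h (X \<omega>)) + inflation"
    and variance_error_ge: "v\<^sub>1 \<le> variance (\<lambda>\<omega>. Y \<omega> - h (X \<omega>))"
proof -
  let ?D = "\<lambda>\<omega>. Y \<omega> - h (X \<omega>)"
  let ?g = "\<lambda>z. fst z - \<mu> (snd z)"
  let ?Z = "\<lambda>\<omega>. (R \<omega> / \<pi> (X \<omega>) - 1) * (Y \<omega> - \<mu> (X \<omega>))"
  have g: "?g \<in> borel_measurable (borel \<Otimes>\<^sub>M cov_space p)" by measurable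
  have D2: "integrable Q (\<lambda>\<omega>. (?D \<omega>)\<^sup>2)"
    by (rule integrable_square_diff) (use hi Y_square_integrable in auto)
  have D1: "integrable Q ?D" by (rule square_integrable_imp_integrable[OF _ D2]) simp
  have Z2: "integrable Q (\<lambda>\<omega>. (?Z \<omega>)\<^sup>2)" "(LINT \<omega>|Q. (?Z \<omega>)\<^sup>2) = inflation"
    using integrable_centered_weight_square[OF g] integral_centered_weight_square[OF g]
      inverse_weighted_residual_integrable by (simp_all add: inflation_def)
  have e1: "integrable Q (\<lambda>\<omega>. Y \<omega> - \<mu> (X \<omega>))"
    by (rule square_integrable_imp_integrable[OF _ residual_square_integrable]) simp
  have Z1: "integrable Q ?Z" "(LINT \<omega>|Q. ?Z \<omega>) = 0"
    using integrable_centered_weight[OF g] integral_centered_weight[OF g] e1 by simp_all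
  show "integrable Q (\<lambda>\<omega>. (G \<omega>)\<^sup>2)"
    unfolding G_def by (rule integrable_square_add) (use D2 Z2 in auto)
  show EG: "expectation G = expectation ?D"
    unfolding G_def using D1 Z1 by simp
  define c where "c = expectation ?D"
  let ?E = "\<lambda>\<omega>. ?D \<omega> - c"
  have D02: "integrable Q (\<lambda>\<omega>. (?E \<omega>)\<^sup>2)"
    by (rule integrable_square_diff) (use D2 in auto)
  \<comment> \<open>The cross term of the square is twice the centred weight times \<open>?k\<close>
    at \<open>(Y, X)\<close>, so its integral vanishes.\<close>
  let ?k = "\<lambda>z. (fst z - \<mu> (snd z)) * (fst z - h (snd z) - c)"
  have k: "?k \<in> borel_measurable (borel \<Otimes>\<^sub>M cov_space p)" by measurable
  have "integrable Q (\<lambda>\<omega>. (Y \<omega> - \<mu> (X \<omega>)) * ?E \<omega>)"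
    by (rule integrable_mult_of_square_integrable[OF _ _ residual_square_integrable D02]) auto
  then have kZ: "integrable Q (\<lambda>\<omega>. (R \<omega> / \<pi> (X \<omega>) - 1) * ((Y \<omega> - \<mu> (X \<omega>)) * ?E \<omega>))"
    "(LINT \<omega>|Q. (R \<omega> / \<pi> (X \<omega>) - 1) * ((Y \<omega> - \<mu> (X \<omega>)) * ?E \<omega>)) = 0"
    using integrable_centered_weight[OF k] integral_centered_weight[OF k] by simp_all
  have kZ2: "integrable Q (\<lambda>\<omega>. 2 * ((R \<omega> / \<pi> (X \<omega>) - 1) * ((Y \<omega> - \<mu> (X \<omega>)) * ?E \<omega>)))"
    using kZ(1) by (rule integrable_mult_right)
  have kZ0: "(LINT \<omega>|Q. 2 * ((R \<omega> / \<pi> (X \<omega>) - 1) * ((Y \<omega> - \<mu> (X \<omega>)) * ?E \<omega>))) = 0"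
    by (subst integral_mult_right_zero, subst kZ(2)) simp
  have "variance G = (LINT \<omega>|Q. (?E \<omega>)\<^sup>2 +
      (2 * ((R \<omega> / \<pi> (X \<omega>) - 1) * ((Y \<omega> - \<mu> (X \<omega>)) * ?E \<omega>)) + (?Z \<omega>)\<^sup>2))"
  proof -
    have "(d + w * e - c)\<^sup>2 = (d - c)\<^sup>2 + (2 * (w * (e * (d - c))) + (w * e)\<^sup>2)" for d w e :: real
      by (simp add: power2_eq_square algebra_simps)
    then show ?thesis unfolding EG c_def[symmetric] unfolding G_def by (simp only:)
  qed
  also have "\<dots> = (LINT \<omega>|Q. (?E \<omega>)\<^sup>2) + inflation"
    by (subst Bochner_Integration.integral_add[OF D02 Bochner_Integration.integrable_add[OF kZ2 Z2(1)]],
        subst Bochner_Integration.integral_add[OF kZ2 Z2(1)])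
      (simp only: kZ0 Z2(2) add_0_left)
  finally show "variance G = variance (\<lambda>\<omega>. Y \<omega> - h (X \<omega>)) + inflation" unfolding c_def .
  \<comment> \<open>Centring \<open>Y - h(X)\<close> at its mean \<open>c\<close> is the same as
    predicting \<open>Y\<close> by \<open>h(X) + c\<close>, so the lower bound for squared errors
    becomes one for the variance.\<close>
  have hc: "integrable Q (\<lambda>\<omega>. (h (X \<omega>) + c)\<^sup>2)"
    by (rule integrable_square_add) (use hi in auto)
  have "v\<^sub>1 * (LINT \<omega>|Q. 1) \<le> (LINT \<omega>|Q. 1 * (Y \<omega> - (h (X \<omega>) + c))\<^sup>2)"
    by (rule integral_weighted_error_ge[where w="\<lambda>_. 1" and h="\<lambda>x. h x + c"])
      (use D02 hc in \<open>auto simp: algebra_simps\<close>)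
  then show "v\<^sub>1 \<le> variance ?D"
    by (simp add: prob_space diff_diff_eq c_def)
qed

lemma \<mu>_integrable: "integrable Q (\<lambda>\<omega>. \<mu> (X \<omega>))"
  by (rule square_integrable_imp_integrable[OF _ \<mu>_square_integrable]) simp

definition psi :: "real \<Rightarrow> real \<Rightarrow> (nat \<Rightarrow> real) \<Rightarrow> real" where
  "psi r y x = \<mu> x + r / \<pi> x * (y - \<mu> x) - expectation Y"

lemma psi_augmented:
  "(\<lambda>\<omega>. psi (R \<omega>) (Y \<omega>) (X \<omega>)) =
    (\<lambda>\<omega>. (Y \<omega> - expectation Y) + (R \<omega> / \<pi> (X \<omega>) - 1) * (Y \<omega> - \<mu> (X \<omega>)))"
  by (auto simp: psi_def algebra_simps)

lemma psi_square_integrable: "integrable Q (\<lambda>\<omega>. (psi (R \<omega>) (Y \<omega>) (X \<omega>))\<^sup>2)"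
  and psi_expectation: "expectation (\<lambda>\<omega>. psi (R \<omega>) (Y \<omega>) (X \<omega>)) = 0"
  and psi_variance: "variance (\<lambda>\<omega>. psi (R \<omega>) (Y \<omega>) (X \<omega>)) = variance Y + inflation"
  and variance_Y_ge: "v\<^sub>1 \<le> variance Y"
proof -
  note * = square_integrable_augmented[of "\<lambda>_. expectation Y"]
    expectation_augmented[of "\<lambda>_. expectation Y"] variance_augmented[of "\<lambda>_. expectation Y"]
    variance_error_ge[of "\<lambda>_. expectation Y"]
  show "integrable Q (\<lambda>\<omega>. (psi (R \<omega>) (Y \<omega>) (X \<omega>))\<^sup>2)"
    using *(1) fun_cong[OF psi_augmented] by simp
  show "expectation (\<lambda>\<omega>. psi (R \<omega>) (Y \<omega>) (X \<omega>)) = 0"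
    using *(2) Y_integrable unfolding psi_augmented by (simp add: prob_space)
  show "variance (\<lambda>\<omega>. psi (R \<omega>) (Y \<omega>) (X \<omega>)) = variance Y + inflation"
    using *(3) Y_integrable fun_cong[OF psi_augmented] by (simp add: prob_space)
  show "v\<^sub>1 \<le> variance Y"
    using *(4) Y_integrable by (simp add: prob_space)
qed

lemma ipw_augmented:
  "(\<lambda>\<omega>. ipw_residual \<pi> \<mu> (R \<omega>) (Y \<omega>) (X \<omega>)) =
    (\<lambda>\<omega>. (Y \<omega> - \<mu> (X \<omega>)) + (R \<omega> / \<pi> (X \<omega>) - 1) * (Y \<omega> - \<mu> (X \<omega>)))"
  by (auto simp: ipw_residual_def algebra_simps)

lemma ipw_square_integrable: "integrable Q (\<lambda>\<omega>. (ipw_residual \<pi> \<mu> (R \<omega>) (Y \<omega>) (X \<omega>))\<^sup>2)"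
  and ipw_expectation: "expectation (\<lambda>\<omega>. ipw_residual \<pi> \<mu> (R \<omega>) (Y \<omega>) (X \<omega>)) =
    expectation Y - expectation (\<lambda>\<omega>. \<mu> (X \<omega>))"
  and ipw_variance: "variance (\<lambda>\<omega>. ipw_residual \<pi> \<mu> (R \<omega>) (Y \<omega>) (X \<omega>)) =
    variance (\<lambda>\<omega>. Y \<omega> - \<mu> (X \<omega>)) + inflation"
  and variance_residual_ge: "v\<^sub>1 \<le> variance (\<lambda>\<omega>. Y \<omega> - \<mu> (X \<omega>))"
  using square_integrable_augmented[OF \<mu>_measurable \<mu>_square_integrable]
    expectation_augmented[OF \<mu>_measurable \<mu>_square_integrable]
    variance_augmented[OF \<mu>_measurable \<mu>_square_integrable]
    variance_error_ge[OF \<mu>_measurable \<mu>_square_integrable]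
    fun_cong[OF ipw_augmented] ipw_augmented Y_integrable \<mu>_integrable
  by simp_all

lemma variance_residual_le: "variance (\<lambda>\<omega>. Y \<omega> - \<mu> (X \<omega>)) \<le> v\<^sub>2"
proof -
  have "integrable Q (\<lambda>\<omega>. Y \<omega> - \<mu> (X \<omega>))"
    by (rule square_integrable_imp_integrable[OF _ residual_square_integrable]) simp
  from variance_le_second_moment[OF this residual_square_integrable]
  show ?thesis using residual_second_moment_le by simp
qed

lemma ipw_integrable: "integrable Q (\<lambda>\<omega>. ipw_residual \<pi> \<mu> (R \<omega>) (Y \<omega>) (X \<omega>))"
  by (rule square_integrable_imp_integrable[OF _ ipw_square_integrable])
    (simp add: ipw_residual_def)

abbreviation "V \<equiv> variance (\<lambda>\<omega>. psi (R \<omega>) (Y \<omega>) (X \<omega>))"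
abbreviation "V' \<equiv> variance (\<lambda>\<omega>. ipw_residual \<pi> \<mu> (R \<omega>) (Y \<omega>) (X \<omega>))"

text \<open>\<open>v\<^sub>1 + v\<^sub>1 * (1 / a - 1)\<close> is \<open>v\<^sub>1 / a\<close>, and
  likewise for \<open>v\<^sub>2\<close>. In the difference the inflation cancels, leaving the
  variances of \<open>Y\<close> and of the residual, both between 0 and
  \<open>v\<^sub>2\<close>.\<close>

lemma variance_bounds: "v\<^sub>1 / a \<le> V" "V \<le> v\<^sub>2 / a" "v\<^sub>1 / a \<le> V'" "V' \<le> v\<^sub>2 / a" "\<bar>V - V'\<bar> \<le> v\<^sub>2"
  using inflation_bounds variance_Y_ge variance_Y_le variance_residual_ge variance_residual_le v_pos
  unfolding psi_variance ipw_variance by (auto simp: algebra_simps)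

text \<open>Centred, \<open>\<mu>(X)\<close> is the difference of centred \<open>Y\<close> and
  centred residual, and \<open>(A - B)^2\<close> is at most \<open>2 A^2 + 2 B^2\<close>. The bound
  is free of \<open>a\<close>: replacing the average of \<open>\<mu>(X)\<close> by its mean costs
  only \<open>1 / sqrt N\<close>.\<close>

lemma \<mu>_centered_square_integrable:
    "integrable Q (\<lambda>\<omega>. (\<mu> (X \<omega>) - expectation (\<lambda>\<omega>. \<mu> (X \<omega>)))\<^sup>2)"
  and variance_\<mu>_le: "variance (\<lambda>\<omega>. \<mu> (X \<omega>)) \<le> 4 * v\<^sub>2"
proof -
  let ?A = "\<lambda>\<omega>. Y \<omega> - expectation Y" and ?B = "\<lambda>\<omega>. (Y \<omega> - \<mu> (X \<omega>)) - expectation (\<lambda>\<omega>. Y \<omega> - \<mu> (X \<omega>))"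
  have A: "integrable Q (\<lambda>\<omega>. (?A \<omega>)\<^sup>2)"
    by (rule integrable_square_diff) (use Y_square_integrable in auto)
  have B: "integrable Q (\<lambda>\<omega>. (?B \<omega>)\<^sup>2)"
    by (rule integrable_square_diff) (use residual_square_integrable in auto)
  have eq: "\<mu> (X \<omega>) - expectation (\<lambda>\<omega>. \<mu> (X \<omega>)) = ?A \<omega> - ?B \<omega>" for \<omega>
    using Y_integrable \<mu>_integrable by simp
  show int: "integrable Q (\<lambda>\<omega>. (\<mu> (X \<omega>) - expectation (\<lambda>\<omega>. \<mu> (X \<omega>)))\<^sup>2)"
    unfolding eq by (rule integrable_square_diff) (use A B in auto)
  have "variance (\<lambda>\<omega>. \<mu> (X \<omega>)) \<le> (LINT \<omega>|Q. 2 * (?A \<omega>)\<^sup>2 + 2 * (?B \<omega>)\<^sup>2)"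
  proof (rule integral_mono[OF int])
    show "integrable Q (\<lambda>\<omega>. 2 * (?A \<omega>)\<^sup>2 + 2 * (?B \<omega>)\<^sup>2)" using A B by simp
    fix \<omega>
    have "0 \<le> (?A \<omega> + ?B \<omega>)\<^sup>2" by (rule zero_le_power2)
    then show "(\<mu> (X \<omega>) - expectation (\<lambda>\<omega>. \<mu> (X \<omega>)))\<^sup>2 \<le> 2 * (?A \<omega>)\<^sup>2 + 2 * (?B \<omega>)\<^sup>2"
      unfolding eq by (simp add: power2_eq_square algebra_simps)
  qed
  also have "\<dots> = 2 * variance Y + 2 * variance (\<lambda>\<omega>. Y \<omega> - \<mu> (X \<omega>))"
    using A B by simp
  also have "\<dots> \<le> 4 * v\<^sub>2" using variance_Y_le variance_residual_le by simp
  finally show "variance (\<lambda>\<omega>. \<mu> (X \<omega>)) \<le> 4 * v\<^sub>2" .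
qed

end

section \<open>The cross-fitting remainder\<close>

locale aipw_sample =
  pop: aipw_population Q p R\<^sub>0 Y\<^sub>0 X\<^sub>0 m \<pi> \<mu> v\<^sub>1 v\<^sub>2 +
  crossfit_sample M N p K "distr Q (obs_space p) (\<lambda>\<omega>. obs (R\<^sub>0 \<omega>) (Y\<^sub>0 \<omega>) (X\<^sub>0 \<omega>))" R Y X I mhat
  for Q :: "'b measure" and p R\<^sub>0 Y\<^sub>0 X\<^sub>0 m \<pi> \<mu> v\<^sub>1 v\<^sub>2
    and M :: "'a measure" and N K R Y X I mhat +
  assumes N_ge_1: "N \<ge> 1"
begin

section \<open>From the sample to the population\<close>

lemma obs_measurable[measurable]: "(\<lambda>\<omega>. obs (R\<^sub>0 \<omega>) (Y\<^sub>0 \<omega>) (X\<^sub>0 \<omega>)) \<in> measurable Q (obs_space p)"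
  unfolding obs_def obs_space_def by measurable

definition Z :: "nat \<Rightarrow> 'a \<Rightarrow> real \<times> real \<times> (nat \<Rightarrow> real)" where
  "Z i \<omega> = obs (R i \<omega>) (Y i \<omega>) (X i \<omega>)"

lemma Z_indep: "indep_vars (\<lambda>_. obs_space p) Z {1..N}"
  using data_indep unfolding Z_def[abs_def] .

lemma Z_measurable: "i \<in> {1..N} \<Longrightarrow> Z i \<in> measurable M (obs_space p)"
  using Z_indep by (simp add: indep_vars_def2)

lemma Z_law: "i \<in> {1..N} \<Longrightarrow>
    distr M (obs_space p) (Z i) = distr Q (obs_space p) (\<lambda>\<omega>. obs (R\<^sub>0 \<omega>) (Y\<^sub>0 \<omega>) (X\<^sub>0 \<omega>))"
  using data_law unfolding Z_def[abs_def] by simp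

text \<open>The outcome of an unlabelled unit has no prescribed law in the sample; only functions
  \<open>g\<close> of the observed triple can be compared with the population.\<close>

lemma
  fixes g :: "real \<times> real \<times> (nat \<Rightarrow> real) \<Rightarrow> real"
  assumes g[measurable]: "g \<in> borel_measurable (obs_space p)" and i: "i \<in> {1..N}"
  shows distr_Z: "distr M borel (\<lambda>\<omega>. g (Z i \<omega>)) = distr Q borel (\<lambda>\<omega>. g (obs (R\<^sub>0 \<omega>) (Y\<^sub>0 \<omega>) (X\<^sub>0 \<omega>)))"
    and integrable_Z: "integrable M (\<lambda>\<omega>. g (Z i \<omega>)) \<longleftrightarrow> integrable Q (\<lambda>\<omega>. g (obs (R\<^sub>0 \<omega>) (Y\<^sub>0 \<omega>) (X\<^sub>0 \<omega>)))"
    and integral_Z: "(LINT \<omega>|M. g (Z i \<omega>)) = (LINT \<omega>|Q. g (obs (R\<^sub>0 \<omega>) (Y\<^sub>0 \<omega>) (X\<^sub>0 \<omega>)))"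
proof -
  note [measurable] = Z_measurable[OF i]
  have "distr M borel (\<lambda>\<omega>. g (Z i \<omega>)) = distr (distr M (obs_space p) (Z i)) borel g"
    by (simp add: distr_distr comp_def)
  also have "\<dots> = distr Q borel (\<lambda>\<omega>. g (obs (R\<^sub>0 \<omega>) (Y\<^sub>0 \<omega>) (X\<^sub>0 \<omega>)))"
    unfolding Z_law[OF i] by (simp add: distr_distr comp_def)
  finally show eq: "distr M borel (\<lambda>\<omega>. g (Z i \<omega>)) = distr Q borel (\<lambda>\<omega>. g (obs (R\<^sub>0 \<omega>) (Y\<^sub>0 \<omega>) (X\<^sub>0 \<omega>)))" .
  have "integrable M (\<lambda>\<omega>. g (Z i \<omega>)) \<longleftrightarrow> integrable (distr M borel (\<lambda>\<omega>. g (Z i \<omega>))) (\<lambda>x. x)"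
    by (subst integrable_distr_eq) simp_all
  also have "\<dots> \<longleftrightarrow> integrable Q (\<lambda>\<omega>. g (obs (R\<^sub>0 \<omega>) (Y\<^sub>0 \<omega>) (X\<^sub>0 \<omega>)))"
    unfolding eq by (subst integrable_distr_eq) simp_all
  finally show "integrable M (\<lambda>\<omega>. g (Z i \<omega>)) \<longleftrightarrow> integrable Q (\<lambda>\<omega>. g (obs (R\<^sub>0 \<omega>) (Y\<^sub>0 \<omega>) (X\<^sub>0 \<omega>)))" .
  have "(LINT \<omega>|M. g (Z i \<omega>)) = (LINT x|distr M borel (\<lambda>\<omega>. g (Z i \<omega>)). x)"
    by (subst integral_distr) simp_all
  also have "\<dots> = (LINT \<omega>|Q. g (obs (R\<^sub>0 \<omega>) (Y\<^sub>0 \<omega>) (X\<^sub>0 \<omega>)))"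
    unfolding eq by (subst integral_distr) simp_all
  finally show "(LINT \<omega>|M. g (Z i \<omega>)) = (LINT \<omega>|Q. g (obs (R\<^sub>0 \<omega>) (Y\<^sub>0 \<omega>) (X\<^sub>0 \<omega>)))" .
qed

text \<open>The size of \<open>J\<close> is bounded by \<open>N\<close>, so the estimate is the same
  for every value a random block can take.\<close>

lemma nn_integral_sum_square_le:
  fixes g :: "real \<times> real \<times> (nat \<Rightarrow> real) \<Rightarrow> real"
  assumes g[measurable]: "g \<in> borel_measurable (obs_space p)" and J: "J \<subseteq> {1..N}"
    and int: "integrable Q (\<lambda>\<omega>. (g (obs (R\<^sub>0 \<omega>) (Y\<^sub>0 \<omega>) (X\<^sub>0 \<omega>)))\<^sup>2)"
    and mean: "(LINT \<omega>|Q. g (obs (R\<^sub>0 \<omega>) (Y\<^sub>0 \<omega>) (X\<^sub>0 \<omega>))) = 0"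
    and le: "(LINT \<omega>|Q. (g (obs (R\<^sub>0 \<omega>) (Y\<^sub>0 \<omega>) (X\<^sub>0 \<omega>)))\<^sup>2) \<le> v"
  shows "(\<integral>\<^sup>+\<omega>. ennreal ((\<Sum>i\<in>J. g (Z i \<omega>))\<^sup>2) \<partial>M) \<le> ennreal (real N * v)"
proof -
  have fin: "finite J" using J by (rule finite_subset) simp
  have g2: "(\<lambda>z. (g z)\<^sup>2) \<in> borel_measurable (obs_space p)" by measurable
  have "indep_vars (\<lambda>_. borel) (\<lambda>i \<omega>. g (Z i \<omega>)) J"
    by (rule indep_vars_compose2[OF indep_vars_subset[OF Z_indep J]]) simp
  moreover have "integrable M (\<lambda>\<omega>. (g (Z i \<omega>))\<^sup>2)" if "i \<in> J" for i
    using integrable_Z[OF g2, of i] int J that by auto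
  moreover have "expectation (\<lambda>\<omega>. g (Z i \<omega>)) = 0" if "i \<in> J" for i
    using integral_Z[OF g, of i] mean J that by auto
  ultimately have *: "integrable M (\<lambda>\<omega>. (\<Sum>i\<in>J. g (Z i \<omega>))\<^sup>2)"
    "expectation (\<lambda>\<omega>. (\<Sum>i\<in>J. g (Z i \<omega>))\<^sup>2) = (\<Sum>i\<in>J. expectation (\<lambda>\<omega>. (g (Z i \<omega>))\<^sup>2))"
    using second_moment_sum_indep[OF fin, of "\<lambda>i \<omega>. g (Z i \<omega>)"] by auto
  have v: "0 \<le> v" by (rule order_trans[OF _ le]) simp
  have "(\<Sum>i\<in>J. expectation (\<lambda>\<omega>. (g (Z i \<omega>))\<^sup>2)) \<le> (\<Sum>i\<in>J. v)"
    using integral_Z[OF g2] le J by (intro sum_mono) auto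
  also have "\<dots> \<le> real N * v"
    using card_mono[OF _ J] v by (simp add: mult_right_mono)
  finally show ?thesis
    using nn_integral_eq_integral[OF *(1)] *(2) by (simp add: ennreal_leI)
qed

text \<open>The change in one summand of the estimator when \<open>\<mu>\<close> is replaced by a
  fit \<open>f\<close>. The outcome cancels, so only \<open>R\<close> and \<open>X\<close>
  enter.\<close>

definition remainder :: "((nat \<Rightarrow> real) \<Rightarrow> real) \<Rightarrow> real \<times> real \<times> (nat \<Rightarrow> real) \<Rightarrow> real" where
  "remainder f z = (1 - fst z / \<pi> (snd (snd z))) * (f (snd (snd z)) - \<mu> (snd (snd z)))"

lemma remainder_obs: "remainder f (obs r y x) = (1 - r / \<pi> x) * (f x - \<mu> x)"
  by (simp add: remainder_def obs_def)

abbreviation "sq_error f \<equiv> weighted_sq_error Q p X\<^sub>0 \<pi> f \<mu>"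

text \<open>The conditional variance of \<open>R / \<pi>(X)\<close> is below
  \<open>1 / \<pi>(X)\<close>, which is the weight in the squared error up to the factor
  \<open>a\<close>; this is the source of \<open>B / a\<close>.\<close>

lemma remainder_moments:
  assumes f[measurable]: "f \<in> borel_measurable (cov_space p)"
    and le: "sq_error f \<le> ennreal B" and B: "B \<ge> 0"
  shows "integrable Q (\<lambda>\<omega>. (remainder f (obs (R\<^sub>0 \<omega>) (Y\<^sub>0 \<omega>) (X\<^sub>0 \<omega>)))\<^sup>2)"
    and "(LINT \<omega>|Q. remainder f (obs (R\<^sub>0 \<omega>) (Y\<^sub>0 \<omega>) (X\<^sub>0 \<omega>))) = 0"
    and "(LINT \<omega>|Q. (remainder f (obs (R\<^sub>0 \<omega>) (Y\<^sub>0 \<omega>) (X\<^sub>0 \<omega>)))\<^sup>2) \<le> B / pop.a"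
proof -
  let ?g = "\<lambda>z :: real \<times> (nat \<Rightarrow> real). f (snd z) - \<mu> (snd z)"
  have g: "?g \<in> borel_measurable (borel \<Otimes>\<^sub>M cov_space p)" by measurable
  let ?h = "\<lambda>\<omega>. 1 / \<pi> (X\<^sub>0 \<omega>) * (f (X\<^sub>0 \<omega>) - \<mu> (X\<^sub>0 \<omega>))\<^sup>2"
  have h0: "AE \<omega> in Q. 0 \<le> ?h \<omega>" using pop.ps_pos by eventually_elim simp
  have "(\<integral>\<^sup>+\<omega>. ennreal (?h \<omega>) \<partial>Q) = (\<integral>\<^sup>+\<omega>. ennreal (1 / pop.a) *
      ennreal (pop.a / \<pi> (X\<^sub>0 \<omega>) * (f (X\<^sub>0 \<omega>) - \<mu> (X\<^sub>0 \<omega>))\<^sup>2) \<partial>Q)"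
    by (rule nn_integral_cong_AE)
      (use pop.ps_pos pop.a_pos in \<open>auto elim!: eventually_mono simp: ennreal_mult[symmetric]\<close>)
  also have "\<dots> = ennreal (1 / pop.a) * sq_error f"
    unfolding weighted_sq_error_def by (subst nn_integral_distr) (simp_all add: nn_integral_cmult)
  also have "\<dots> \<le> ennreal (1 / pop.a) * ennreal B" by (rule mult_left_mono[OF le]) simp
  also have "\<dots> = ennreal (B / pop.a)"
    using pop.a_pos B by (simp add: ennreal_mult[symmetric])
  finally have le': "(\<integral>\<^sup>+\<omega>. ennreal (?h \<omega>) \<partial>Q) \<le> ennreal (B / pop.a)" .
  have hi: "integrable Q ?h"
    by (rule integrableI_nonneg) (use h0 le' in \<open>auto intro: le_less_trans\<close>)
  have hle: "integral\<^sup>L Q ?h \<le> B / pop.a"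
    using le' B pop.a_pos unfolding nn_integral_eq_integral[OF hi h0]
    by (subst (asm) ennreal_le_iff) auto
  have int: "integrable Q (\<lambda>\<omega>. 1 / \<pi> (X\<^sub>0 \<omega>) * (?g (Y\<^sub>0 \<omega>, X\<^sub>0 \<omega>))\<^sup>2)" using hi by simp
  have g2: "integrable Q (\<lambda>\<omega>. (?g (Y\<^sub>0 \<omega>, X\<^sub>0 \<omega>))\<^sup>2)"
    by (rule pop.integrable_square_of_weighted[OF g int])
  then have g2': "integrable Q (\<lambda>\<omega>. (f (X\<^sub>0 \<omega>) - \<mu> (X\<^sub>0 \<omega>))\<^sup>2)" by simp
  have "integrable Q (\<lambda>\<omega>. f (X\<^sub>0 \<omega>) - \<mu> (X\<^sub>0 \<omega>))"
    by (rule pop.square_integrable_imp_integrable[OF _ g2']) simp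
  then have g1: "integrable Q (\<lambda>\<omega>. ?g (Y\<^sub>0 \<omega>, X\<^sub>0 \<omega>))" by simp
  have eq: "remainder f (obs (R\<^sub>0 \<omega>) (Y\<^sub>0 \<omega>) (X\<^sub>0 \<omega>)) =
      - ((R\<^sub>0 \<omega> / \<pi> (X\<^sub>0 \<omega>) - 1) * ?g (Y\<^sub>0 \<omega>, X\<^sub>0 \<omega>))" for \<omega>
    by (simp add: remainder_obs algebra_simps)
  show "integrable Q (\<lambda>\<omega>. (remainder f (obs (R\<^sub>0 \<omega>) (Y\<^sub>0 \<omega>) (X\<^sub>0 \<omega>)))\<^sup>2)"
    unfolding eq power2_minus by (rule pop.integrable_centered_weight_square[OF g int])
  show "(LINT \<omega>|Q. remainder f (obs (R\<^sub>0 \<omega>) (Y\<^sub>0 \<omega>) (X\<^sub>0 \<omega>))) = 0"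
    unfolding eq using pop.integral_centered_weight[OF g g1] by simp
  have "(LINT \<omega>|Q. (remainder f (obs (R\<^sub>0 \<omega>) (Y\<^sub>0 \<omega>) (X\<^sub>0 \<omega>)))\<^sup>2) =
      (LINT \<omega>|Q. (1 / \<pi> (X\<^sub>0 \<omega>) - 1) * (?g (Y\<^sub>0 \<omega>, X\<^sub>0 \<omega>))\<^sup>2)"
    unfolding eq power2_minus by (rule pop.integral_centered_weight_square[OF g int])
  also have "\<dots> = (LINT \<omega>|Q. ?h \<omega> - (f (X\<^sub>0 \<omega>) - \<mu> (X\<^sub>0 \<omega>))\<^sup>2)"
    by (simp add: left_diff_distrib)
  also have "\<dots> \<le> integral\<^sup>L Q ?h"
    by (rule integral_mono) (use hi g2' in auto)
  also note hle
  finally show "(LINT \<omega>|Q. (remainder f (obs (R\<^sub>0 \<omega>) (Y\<^sub>0 \<omega>) (X\<^sub>0 \<omega>)))\<^sup>2) \<le> B / pop.a" .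
qed

section \<open>Truncated second moment over a held-out block\<close>

lemma mhat_section_measurable:
  assumes "A \<subseteq> {1..N}" "z \<in> space (\<Pi>\<^sub>M i\<in>A. obs_space p)"
  shows "mhat A z \<in> borel_measurable (cov_space p)"
  using measurable_compose[OF measurable_Pair1'[OF assms(2)] mhat_measurable[OF assms(1)]] by simp

lemma sq_error_measurable:
  assumes "A \<subseteq> {1..N}"
  shows "(\<lambda>z. sq_error (mhat A z)) \<in> borel_measurable (\<Pi>\<^sub>M i\<in>A. obs_space p)"
proof -
  interpret D: prob_space "distr Q (cov_space p) X\<^sub>0" by (rule pop.prob_space_distr) simp
  note [measurable] = mhat_measurable[OF assms]
  have "(\<lambda>(z, x). mhat A z x) = (\<lambda>w. mhat A (fst w) (snd w))" by auto
  then have [measurable]: "(\<lambda>w. mhat A (fst w) (snd w)) \<in>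
      borel_measurable ((\<Pi>\<^sub>M i\<in>A. obs_space p) \<Otimes>\<^sub>M cov_space p)"
    using mhat_measurable[OF assms] by simp
  have "(\<lambda>w. ennreal (pop.a / \<pi> (snd w) * (mhat A (fst w) (snd w) - \<mu> (snd w))\<^sup>2)) \<in>
      borel_measurable ((\<Pi>\<^sub>M i\<in>A. obs_space p) \<Otimes>\<^sub>M cov_space p)"
    by measurable
  then show ?thesis
    unfolding weighted_sq_error_def
    by (intro D.borel_measurable_nn_integral) (simp add: split_beta' cong: measurable_cong_sets)
qed

text \<open>For a nonrandom block \<open>J\<close>, the training data \<open>z\<close> and the
  held-out data \<open>z'\<close> are kept as separate arguments, so that independence of the two
  subsamples can be applied; the truncation looks at \<open>z\<close> only.\<close>

definition trunc_square :: "real \<Rightarrow> nat set \<Rightarrow> (nat \<Rightarrow> real \<times> real \<times> (nat \<Rightarrow> real)) \<Rightarrow>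
    (nat \<Rightarrow> real \<times> real \<times> (nat \<Rightarrow> real)) \<Rightarrow> ennreal" where
  "trunc_square B J z z' = indicator {z. sq_error (mhat ({1..N} - J) z) \<le> ennreal B} z *
      ennreal ((\<Sum>i\<in>J. remainder (mhat ({1..N} - J) z) (z' i))\<^sup>2)"

lemma trunc_square_measurable:
  assumes J: "J \<subseteq> {1..N}"
  shows "(\<lambda>w. trunc_square B J (fst w) (snd w)) \<in>
    borel_measurable ((\<Pi>\<^sub>M i\<in>{1..N} - J. obs_space p) \<Otimes>\<^sub>M (\<Pi>\<^sub>M i\<in>J. obs_space p))"
proof -
  let ?S = "(\<Pi>\<^sub>M i\<in>{1..N} - J. obs_space p) \<Otimes>\<^sub>M (\<Pi>\<^sub>M i\<in>J. obs_space p)"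
  have A: "{1..N} - J \<subseteq> {1..N}" by auto
  note [measurable] = sq_error_measurable[OF A]
  have comp: "(\<lambda>w. snd w i) \<in> measurable ?S (obs_space p)" if "i \<in> J" for i
    using that by measurable
  have x: "(\<lambda>w. snd (snd (snd w i))) \<in> measurable ?S (cov_space p)"
    and u: "(\<lambda>w. fst (snd w i)) \<in> borel_measurable ?S" if "i \<in> J" for i
    using comp[OF that] unfolding obs_space_def by measurable
  have mh: "(\<lambda>w. mhat ({1..N} - J) (fst w) (snd (snd (snd w i)))) \<in> borel_measurable ?S" if "i \<in> J" for i
    using measurable_compose[OF measurable_Pair[OF measurable_fst x[OF that]] mhat_measurable[OF A]] by simp
  have "(\<lambda>w. remainder (mhat ({1..N} - J) (fst w)) (snd w i)) \<in> borel_measurable ?S" if "i \<in> J" for i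
    using x[OF that] u[OF that] mh[OF that] unfolding remainder_def by measurable
  then have [measurable]: "(\<lambda>w. \<Sum>i\<in>J. remainder (mhat ({1..N} - J) (fst w)) (snd w i)) \<in> borel_measurable ?S"
    by (rule borel_measurable_sum)
  show ?thesis unfolding trunc_square_def by measurable
qed

abbreviation "data A \<omega> \<equiv> (\<lambda>i\<in>A. Z i \<omega>)"

lemma data_measurable[measurable]: "A \<subseteq> {1..N} \<Longrightarrow> data A \<in> measurable M (\<Pi>\<^sub>M i\<in>A. obs_space p)"
  using Z_measurable by (intro measurable_restrict) auto

text \<open>Conditionally on the training data the summands are independent and centred.\<close>

lemma nn_integral_trunc_square_le:
  assumes J: "J \<subseteq> {1..N}" and B: "B \<ge> 0"
  shows "(\<integral>\<^sup>+\<omega>. trunc_square B J (data ({1..N} - J) \<omega>) (data J \<omega>) \<partial>M) \<le> ennreal (real N * (B / pop.a))"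
proof -
  have A: "{1..N} - J \<subseteq> {1..N}" by auto
  have ind: "indep_var (\<Pi>\<^sub>M i\<in>{1..N} - J. obs_space p) (data ({1..N} - J)) (\<Pi>\<^sub>M i\<in>J. obs_space p) (data J)"
    by (rule indep_var_restrict[OF Z_indep _ A J]) auto
  have "(\<integral>\<^sup>+\<omega>. trunc_square B J (data ({1..N} - J) \<omega>) (data J \<omega>) \<partial>M) =
      (\<integral>\<^sup>+\<omega>. (\<integral>\<^sup>+\<omega>'. trunc_square B J (data ({1..N} - J) \<omega>) (data J \<omega>') \<partial>M) \<partial>M)"
    using nn_integral_indep_var[OF ind trunc_square_measurable[OF J, of B]] by simp
  also have "\<dots> \<le> (\<integral>\<^sup>+\<omega>. ennreal (real N * (B / pop.a)) \<partial>M)"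
  proof (rule nn_integral_mono)
    fix \<omega> assume \<omega>: "\<omega> \<in> space M"
    let ?f = "mhat ({1..N} - J) (data ({1..N} - J) \<omega>)"
    have f[measurable]: "?f \<in> borel_measurable (cov_space p)"
      by (rule mhat_section_measurable[OF A]) (rule measurable_space[OF data_measurable[OF A] \<omega>])
    show "(\<integral>\<^sup>+\<omega>'. trunc_square B J (data ({1..N} - J) \<omega>) (data J \<omega>') \<partial>M) \<le> ennreal (real N * (B / pop.a))"
    \<comment> \<open>With the training data frozen, \<open>?f\<close> is a deterministic function
      and the truncation indicator a constant: it either annihilates the inner integral or supplies
      the bound on \<open>sq_error ?f\<close>.\<close>
    proof (cases "sq_error ?f \<le> ennreal B")
      case True
      have "remainder ?f \<in> borel_measurable (obs_space p)"
        unfolding remainder_def[abs_def] obs_space_def by measurable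
      from nn_integral_sum_square_le[OF this J remainder_moments[OF f True B]]
      have "(\<integral>\<^sup>+\<omega>'. ennreal ((\<Sum>i\<in>J. remainder ?f (Z i \<omega>'))\<^sup>2) \<partial>M) \<le> ennreal (real N * (B / pop.a))" .
      then show ?thesis using True by (simp add: trunc_square_def)
    next
      case False
      then show ?thesis by (simp add: trunc_square_def)
    qed
  qed
  finally show ?thesis by (simp add: emeasure_space_1)
qed

definition fit :: "nat \<Rightarrow> 'a \<Rightarrow> (nat \<Rightarrow> real) \<Rightarrow> real" where
  "fit k \<omega> = held_out_fit N mhat (\<lambda>k. I k \<omega>) (\<lambda>i. R i \<omega>) (\<lambda>i. Y i \<omega>) (\<lambda>i. X i \<omega>) k"

lemma fit_eq: "fit k \<omega> = mhat ({1..N} - I k \<omega>) (data ({1..N} - I k \<omega>) \<omega>)"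
  unfolding fit_def held_out_fit_def Z_def ..

lemma block_subset: "k \<in> {1..K} \<Longrightarrow> \<omega> \<in> space M \<Longrightarrow> I k \<omega> \<subseteq> {1..N}"
  using blocks_cover by blast

definition block_remainder :: "nat \<Rightarrow> 'a \<Rightarrow> real" where
  "block_remainder k \<omega> = (\<Sum>i\<in>I k \<omega>. remainder (fit k \<omega>) (Z i \<omega>))"

lemma remainder_fit_measurable:
  assumes "A \<subseteq> {1..N}" "i \<in> {1..N}"
  shows "(\<lambda>\<omega>. remainder (mhat A (data A \<omega>)) (Z i \<omega>)) \<in> borel_measurable M"
proof -
  have x: "(\<lambda>\<omega>. snd (snd (Z i \<omega>))) \<in> measurable M (cov_space p)"
    and u: "(\<lambda>\<omega>. fst (Z i \<omega>)) \<in> borel_measurable M"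
    using Z_measurable[OF assms(2)] unfolding obs_space_def by measurable
  have mh: "(\<lambda>\<omega>. mhat A (data A \<omega>) (snd (snd (Z i \<omega>)))) \<in> borel_measurable M"
    using measurable_compose[OF measurable_Pair[OF data_measurable[OF assms(1)] x] mhat_measurable[OF assms(1)]]
    by simp
  show ?thesis
    using x u mh unfolding remainder_def by measurable
qed

text \<open>A block takes finitely many values, so measurability for each fixed \<open>J\<close> is
  enough; the same device serves \<open>sq_error_fit_measurable\<close>.\<close>

lemma block_remainder_measurable:
  assumes k: "k \<in> {1..K}"
  shows "block_remainder k \<in> borel_measurable M"
proof -
  have "(\<lambda>\<omega>. \<Sum>i\<in>J. remainder (mhat ({1..N} - J) (data ({1..N} - J) \<omega>)) (Z i \<omega>)) \<in> borel_measurable M"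
    if "J \<in> Pow {1..N}" for J
    using that by (intro borel_measurable_sum remainder_fit_measurable) auto
  from measurable_compose_countable'[OF this blocks_measurable[OF k]]
  show ?thesis
    unfolding block_remainder_def[abs_def] fit_eq by (simp add: countable_finite)
qed

lemma sq_error_fit_measurable:
  assumes k: "k \<in> {1..K}"
  shows "(\<lambda>\<omega>. sq_error (fit k \<omega>)) \<in> borel_measurable M"
proof -
  have "(\<lambda>\<omega>. sq_error (mhat ({1..N} - J) (data ({1..N} - J) \<omega>))) \<in> borel_measurable M"
    if "J \<in> Pow {1..N}" for J
    by (rule measurable_compose[OF data_measurable sq_error_measurable]) auto
  from measurable_compose_countable'[OF this blocks_measurable[OF k]]
  show ?thesis unfolding fit_eq by (simp add: countable_finite)
qed

text \<open>Decomposition over the values \<open>J\<close> of the block. Independence of partition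
  and data factors out the probability of each value; the remaining integral has a bound free of
  \<open>J\<close>, and the probabilities sum to at most 1.\<close>

lemma nn_integral_block_remainder_le:
  assumes k: "k \<in> {1..K}" and B: "B \<ge> 0"
  shows "(\<integral>\<^sup>+\<omega>. indicator {\<omega> \<in> space M. sq_error (fit k \<omega>) \<le> ennreal B} \<omega> *
      ennreal ((block_remainder k \<omega>)\<^sup>2) \<partial>M) \<le> ennreal (real N * (B / pop.a))"
proof -
  let ?c = "ennreal (real N * (B / pop.a))"
  let ?C = "\<lambda>J. {\<omega> \<in> space M. I k \<omega> = J}"
  let ?F = "\<lambda>J \<omega>. trunc_square B J (data ({1..N} - J) \<omega>) (data J \<omega>)"
  have C: "?C J \<in> sets M" if "J \<in> Pow {1..N}" for J
  proof -
    have "?C J = I k -` {J} \<inter> space M" by auto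
    then show ?thesis using measurable_sets[OF blocks_measurable[OF k], of "{J}"] that by simp
  qed
  have F[measurable]: "?F J \<in> borel_measurable M" if "J \<in> Pow {1..N}" for J
  proof -
    from that have J: "J \<subseteq> {1..N}" by simp
    show ?thesis
      using measurable_compose[OF measurable_Pair[OF data_measurable data_measurable[OF J]]
          trunc_square_measurable[OF J, of B]] by simp
  qed
  have "indicator {\<omega> \<in> space M. sq_error (fit k \<omega>) \<le> ennreal B} \<omega> * ennreal ((block_remainder k \<omega>)\<^sup>2) =
      (\<Sum>J\<in>Pow {1..N}. indicator (?C J) \<omega> * ?F J \<omega>)" if \<omega>: "\<omega> \<in> space M" for \<omega>
  proof -
    have "(\<Sum>J\<in>Pow {1..N}. indicator (?C J) \<omega> * ?F J \<omega>) =
        (\<Sum>J\<in>Pow {1..N}. if I k \<omega> = J then ?F J \<omega> else 0)"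
      using \<omega> by (intro sum.cong) (auto split: split_indicator)
    also have "\<dots> = ?F (I k \<omega>) \<omega>"
      using block_subset[OF k \<omega>] by (subst sum.delta') auto
    also have "\<dots> = indicator {\<omega> \<in> space M. sq_error (fit k \<omega>) \<le> ennreal B} \<omega> * ennreal ((block_remainder k \<omega>)\<^sup>2)"
      using \<omega> unfolding trunc_square_def block_remainder_def fit_eq
      by (auto split: split_indicator)
    finally show ?thesis by simp
  qed
  then have "(\<integral>\<^sup>+\<omega>. indicator {\<omega> \<in> space M. sq_error (fit k \<omega>) \<le> ennreal B} \<omega> *
      ennreal ((block_remainder k \<omega>)\<^sup>2) \<partial>M) = (\<integral>\<^sup>+\<omega>. (\<Sum>J\<in>Pow {1..N}. indicator (?C J) \<omega> * ?F J \<omega>) \<partial>M)"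
    by (rule nn_integral_cong)
  also have "\<dots> = (\<Sum>J\<in>Pow {1..N}. \<integral>\<^sup>+\<omega>. indicator (?C J) \<omega> * ?F J \<omega> \<partial>M)"
    by (rule nn_integral_sum) (use C F in auto)
  also have "\<dots> = (\<Sum>J\<in>Pow {1..N}. emeasure M (?C J) * (\<integral>\<^sup>+\<omega>. ?F J \<omega> \<partial>M))"
  proof (rule sum.cong[OF refl])
    fix J assume J: "J \<in> Pow {1..N}"
    then have J': "J \<subseteq> {1..N}" by simp
    \<comment> \<open>The partition is independent of the complete data vector, so both subsamples
      are written as restrictions of that vector.\<close>
    let ?G = "\<lambda>z. trunc_square B J (restrict z ({1..N} - J)) (restrict z J)"
    have G: "?G \<in> borel_measurable (\<Pi>\<^sub>M i\<in>{1..N}. obs_space p)"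
    proof -
      have "(\<lambda>z. (restrict z ({1..N} - J), restrict z J)) \<in> measurable (\<Pi>\<^sub>M i\<in>{1..N}. obs_space p)
          ((\<Pi>\<^sub>M i\<in>{1..N} - J. obs_space p) \<Otimes>\<^sub>M (\<Pi>\<^sub>M i\<in>J. obs_space p))"
        by (intro measurable_Pair measurable_restrict_subset) (use J' in auto)
      from measurable_compose[OF this trunc_square_measurable[OF J', of B]] show ?thesis by simp
    qed
    have FG: "?F J \<omega> = ?G (data {1..N} \<omega>)" for \<omega>
      using J' by (simp add: restrict_restrict Int_absorb1 Int_absorb2 Int_Diff)
    have ind: "indep_set
         (sets (vimage_algebra (space M) (\<lambda>\<omega>. \<lambda>k\<in>{1..K}. I k \<omega>) (\<Pi>\<^sub>M k\<in>{1..K}. count_space (Pow {1..N}))))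
         (sets (vimage_algebra (space M) (data {1..N}) (\<Pi>\<^sub>M i\<in>{1..N}. obs_space p)))"
      using partition_indep_data unfolding Z_def .
    have "?C J \<in> sets (vimage_algebra (space M) (\<lambda>\<omega>. \<lambda>k\<in>{1..K}. I k \<omega>) (\<Pi>\<^sub>M k\<in>{1..K}. count_space (Pow {1..N})))"
    proof -
      let ?P = "\<Pi>\<^sub>M k\<in>{1..K}. count_space (Pow {1..N})"
      have sp: "(\<lambda>k\<in>{1..K}. I k \<omega>) \<in> space ?P" if "\<omega> \<in> space M" for \<omega>
        using block_subset that by (auto simp: space_PiM)
      have "(\<lambda>f. f k) -` {J} \<inter> space ?P \<in> sets ?P"
        by (rule measurable_sets[OF measurable_component_singleton[OF k]]) (use J in simp)
      from in_vimage_algebra[OF this, of "\<lambda>\<omega>. \<lambda>k\<in>{1..K}. I k \<omega>" "space M"]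
      also have "(\<lambda>\<omega>. \<lambda>k\<in>{1..K}. I k \<omega>) -` ((\<lambda>f. f k) -` {J} \<inter> space ?P) \<inter> space M = ?C J"
        using sp k by auto
      finally show ?thesis .
    qed
    from nn_integral_indicator_indep[OF ind this data_measurable[OF subset_refl] G]
    show "(\<integral>\<^sup>+\<omega>. indicator (?C J) \<omega> * ?F J \<omega> \<partial>M) = emeasure M (?C J) * (\<integral>\<^sup>+\<omega>. ?F J \<omega> \<partial>M)"
      unfolding FG .
  qed
  also have "\<dots> \<le> (\<Sum>J\<in>Pow {1..N}. emeasure M (?C J) * ?c)"
    by (intro sum_mono mult_left_mono nn_integral_trunc_square_le B) auto
  also have "\<dots> = (\<Sum>J\<in>Pow {1..N}. emeasure M (?C J)) * ?c"
    by (rule sum_distrib_right[symmetric])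
  also have "(\<Sum>J\<in>Pow {1..N}. emeasure M (?C J)) = emeasure M (\<Union>J\<in>Pow {1..N}. ?C J)"
    by (rule sum_emeasure) (use C in \<open>auto simp: disjoint_family_on_def\<close>)
  also have "\<dots> \<le> 1" by (rule emeasure_le_1)
  finally show ?thesis by (simp add: mult_right_mono)
qed

section \<open>Exact expansion of the estimator\<close>

definition theta :: "'a \<Rightarrow> real" where
  "theta \<omega> = theta_tilde N K \<pi> mhat (\<lambda>k. I k \<omega>) (\<lambda>i. R i \<omega>) (\<lambda>i. Y i \<omega>) (\<lambda>i. X i \<omega>)"

lemma fold_of_eq:
  assumes "\<omega> \<in> space M" "k \<in> {1..K}" "i \<in> I k \<omega>"
  shows "fold_of K (\<lambda>k. I k \<omega>) i = k"
  unfolding fold_of_def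
proof (rule the_equality)
  fix k' assume k': "k' \<in> {1..K} \<and> i \<in> I k' \<omega>"
  show "k' = k"
  proof (rule ccontr)
    assume "k' \<noteq> k"
    then have "I k' \<omega> \<inter> I k \<omega> = {}"
      using disjoint_family_onD[OF blocks_disjoint[OF assms(1)]] k' assms(2) by blast
    then show False using k' assms(3) by blast
  qed
qed (use assms in simp)

text \<open>A pointwise identity: the blocks partition the indices, so the sum over units regroups
  by fold. It is linear in \<open>R / \<pi>(X)\<close> and needs no positivity of the
  propensity.\<close>

lemma theta_expansion:
  assumes \<omega>: "\<omega> \<in> space M"
  shows "(theta \<omega> - pop.expectation Y\<^sub>0) - (\<Sum>i=1..N. pop.psi (R i \<omega>) (Y i \<omega>) (X i \<omega>)) / real N =
    (\<Sum>k\<in>{1..K}. block_remainder k \<omega> / real N)"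
proof -
  let ?f = "\<lambda>i. fit (fold_of K (\<lambda>k. I k \<omega>) i) \<omega> (X i \<omega>)"
  have "(theta \<omega> - pop.expectation Y\<^sub>0) - (\<Sum>i=1..N. pop.psi (R i \<omega>) (Y i \<omega>) (X i \<omega>)) / real N =
      (\<Sum>i=1..N. ?f i + R i \<omega> / \<pi> (X i \<omega>) * (Y i \<omega> - ?f i) - pop.expectation Y\<^sub>0 -
        pop.psi (R i \<omega>) (Y i \<omega>) (X i \<omega>)) / real N"
    using N_ge_1
    by (simp add: theta_def theta_tilde_def Let_def fit_def[symmetric] sum.distrib sum_subtractf
        diff_divide_distrib add_divide_distrib)
  also have "(\<Sum>i=1..N. ?f i + R i \<omega> / \<pi> (X i \<omega>) * (Y i \<omega> - ?f i) - pop.expectation Y\<^sub>0 -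
        pop.psi (R i \<omega>) (Y i \<omega>) (X i \<omega>)) =
      (\<Sum>i\<in>(\<Union>k\<in>{1..K}. I k \<omega>). remainder (fit (fold_of K (\<lambda>k. I k \<omega>) i) \<omega>) (Z i \<omega>))"
    unfolding blocks_cover[OF \<omega>] Z_def remainder_obs pop.psi_def
    by (intro sum.cong refl) (simp add: algebra_simps diff_divide_distrib)
  also have "\<dots> = (\<Sum>k\<in>{1..K}. \<Sum>i\<in>I k \<omega>. remainder (fit (fold_of K (\<lambda>k. I k \<omega>) i) \<omega>) (Z i \<omega>))"
    by (rule sum.UNION_disjoint)
      (use blocks_disjoint[OF \<omega>] finite_subset[OF block_subset[OF _ \<omega>]] in
        \<open>auto simp: disjoint_family_on_def\<close>)
  also have "\<dots> = (\<Sum>k\<in>{1..K}. block_remainder k \<omega>)"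
    unfolding block_remainder_def by (intro sum.cong refl) (simp add: fold_of_eq[OF \<omega>])
  finally show ?thesis by (simp add: sum_divide_distrib)
qed

text \<open>The influence function rewritten in terms of the product \<open>R Y\<close>, the only
  form in which the outcome is observed.\<close>

definition psi_obs :: "real \<times> real \<times> (nat \<Rightarrow> real) \<Rightarrow> real" where
  "psi_obs z = \<mu> (snd (snd z)) + (fst (snd z) - fst z * \<mu> (snd (snd z))) / \<pi> (snd (snd z)) -
    pop.expectation Y\<^sub>0"

lemma psi_obs_measurable[measurable]: "psi_obs \<in> borel_measurable (obs_space p)"
  unfolding psi_obs_def[abs_def] obs_space_def by measurable

lemma psi_obs_obs: "psi_obs (obs r y x) = pop.psi r y x"
  by (simp add: psi_obs_def pop.psi_def obs_def right_diff_distrib diff_divide_distrib)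

lemma psi_obs_Z: "psi_obs (Z i \<omega>) = pop.psi (R i \<omega>) (Y i \<omega>) (X i \<omega>)"
  by (simp add: Z_def psi_obs_obs)

lemma psi_measurable: "i \<in> {1..N} \<Longrightarrow> (\<lambda>\<omega>. pop.psi (R i \<omega>) (Y i \<omega>) (X i \<omega>)) \<in> borel_measurable M"
  using measurable_compose[OF Z_measurable psi_obs_measurable] by (simp add: psi_obs_Z)

lemma psi_indep: "indep_vars (\<lambda>_. borel) (\<lambda>i \<omega>. pop.psi (R i \<omega>) (Y i \<omega>) (X i \<omega>)) {1..N}"
  using indep_vars_compose2[OF Z_indep, of "\<lambda>_. psi_obs" "\<lambda>_. borel"] by (simp add: psi_obs_Z)

lemma psi_law: "i \<in> {1..N} \<Longrightarrow> distr M borel (\<lambda>\<omega>. pop.psi (R i \<omega>) (Y i \<omega>) (X i \<omega>)) =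
    distr Q borel (\<lambda>\<omega>. pop.psi (R\<^sub>0 \<omega>) (Y\<^sub>0 \<omega>) (X\<^sub>0 \<omega>))"
  using distr_Z[OF psi_obs_measurable] by (simp add: psi_obs_Z psi_obs_obs)

lemma nn_integral_sum_psi_le:
  "(\<integral>\<^sup>+\<omega>. ennreal ((\<Sum>i=1..N. pop.psi (R i \<omega>) (Y i \<omega>) (X i \<omega>))\<^sup>2) \<partial>M) \<le> ennreal (real N * (v\<^sub>2 / pop.a))"
  using nn_integral_sum_square_le[OF psi_obs_measurable subset_refl, of "v\<^sub>2 / pop.a"]
    pop.psi_square_integrable pop.psi_expectation pop.variance_bounds(2)
  by (simp add: psi_obs_Z psi_obs_obs)

lemma nn_integral_sum_\<mu>_le:
  "(\<integral>\<^sup>+\<omega>. ennreal ((\<Sum>i=1..N. \<mu> (X i \<omega>) - pop.expectation (\<lambda>\<omega>. \<mu> (X\<^sub>0 \<omega>)))\<^sup>2) \<partial>M) \<le>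
    ennreal (real N * (4 * v\<^sub>2))"
proof -
  let ?g = "\<lambda>z. \<mu> (snd (snd z)) - pop.expectation (\<lambda>\<omega>. \<mu> (X\<^sub>0 \<omega>))"
  have "?g \<in> borel_measurable (obs_space p)" unfolding obs_space_def by measurable
  from nn_integral_sum_square_le[OF this subset_refl, of "4 * v\<^sub>2"]
  show ?thesis
    using pop.\<mu>_centered_square_integrable pop.variance_\<mu>_le pop.\<mu>_integrable
    by (simp add: Z_def obs_def pop.prob_space)
qed

text \<open>Read off from the expansion, whose terms are known to be measurable; this avoids the
  description operator in \<open>fold_of\<close>.\<close>

lemma theta_measurable: "theta \<in> borel_measurable M"
proof -
  have "(\<lambda>\<omega>. (\<Sum>k\<in>{1..K}. block_remainder k \<omega> / real N) +
      (\<Sum>i=1..N. pop.psi (R i \<omega>) (Y i \<omega>) (X i \<omega>)) / real N + pop.expectation Y\<^sub>0) \<in> borel_measurable M"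
    using block_remainder_measurable psi_measurable
    by (intro borel_measurable_add borel_measurable_sum borel_measurable_divide) auto
  also have "?this \<longleftrightarrow> ?thesis"
  proof (rule measurable_cong)
    fix \<omega> assume "\<omega> \<in> space M"
    from theta_expansion[OF this]
    show "(\<Sum>k\<in>{1..K}. block_remainder k \<omega> / real N) +
      (\<Sum>i=1..N. pop.psi (R i \<omega>) (Y i \<omega>) (X i \<omega>)) / real N + pop.expectation Y\<^sub>0 = theta \<omega>"
      by linarith
  qed
  finally show ?thesis .
qed

end

section \<open>The main theorem\<close>

theorem theorem3p1:
  fixes Q :: "nat \<Rightarrow> 'b measure" and M :: "nat \<Rightarrow> 'a measure" and p :: "nat \<Rightarrow> nat" and K :: nat
    and R\<^sub>0 Y\<^sub>0 :: "nat \<Rightarrow> 'b \<Rightarrow> real" and X\<^sub>0 :: "nat \<Rightarrow> 'b \<Rightarrow> nat \<Rightarrow> real"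
    and R Y :: "nat \<Rightarrow> nat \<Rightarrow> 'a \<Rightarrow> real" and X :: "nat \<Rightarrow> nat \<Rightarrow> 'a \<Rightarrow> nat \<Rightarrow> real"
    and I :: "nat \<Rightarrow> nat \<Rightarrow> 'a \<Rightarrow> nat set"
    and mhat :: "nat \<Rightarrow> nat set \<Rightarrow> (nat \<Rightarrow> real \<times> real \<times> (nat \<Rightarrow> real)) \<Rightarrow> (nat \<Rightarrow> real) \<Rightarrow> real"
    and m \<pi> \<mu> :: "nat \<Rightarrow> (nat \<Rightarrow> real) \<Rightarrow> real"
    and v\<^sub>1 v\<^sub>2 :: real and c\<^sub>\<mu> :: "nat \<Rightarrow> real"
  defines "a \<equiv> \<lambda>N. a_rate (Q N) (X\<^sub>0 N) (\<pi> N)"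
    and "\<theta>\<^sub>0 \<equiv> \<lambda>N. prob_space.expectation (Q N) (Y\<^sub>0 N)"
  defines "fit \<equiv> \<lambda>N k \<omega>. held_out_fit N (mhat N) (\<lambda>k. I N k \<omega>)
                  (\<lambda>i. R N i \<omega>) (\<lambda>i. Y N i \<omega>) (\<lambda>i. X N i \<omega>) k"
    and "\<theta> \<equiv> \<lambda>N \<omega>. theta_tilde N K (\<pi> N) (mhat N) (\<lambda>k. I N k \<omega>)
                  (\<lambda>i. R N i \<omega>) (\<lambda>i. Y N i \<omega>) (\<lambda>i. X N i \<omega>)"
    and "\<psi> \<equiv> \<lambda>N r y x. \<mu> N x + r / \<pi> N x * (y - \<mu> N x) - \<theta>\<^sub>0 N"
    and "\<psi>\<^sub>t \<equiv> \<lambda>N r y x. ipw_residual (\<pi> N) (\<mu> N) r y x -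
                  prob_space.expectation (Q N)
                    (\<lambda>\<omega>. ipw_residual (\<pi> N) (\<mu> N) (R\<^sub>0 N \<omega>) (Y\<^sub>0 N \<omega>) (X\<^sub>0 N \<omega>))"
  defines "V \<equiv> \<lambda>N. prob_space.variance (Q N) (\<lambda>\<omega>. \<psi> N (R\<^sub>0 N \<omega>) (Y\<^sub>0 N \<omega>) (X\<^sub>0 N \<omega>))"
    and "V\<^sub>t \<equiv> \<lambda>N. prob_space.variance (Q N) (\<lambda>\<omega>. \<psi>\<^sub>t N (R\<^sub>0 N \<omega>) (Y\<^sub>0 N \<omega>) (X\<^sub>0 N \<omega>))"
  assumes K: "K \<ge> 2"
    and population:
      "\<And>N. N \<ge> 1 \<Longrightarrow> population (Q N) (p N) (R\<^sub>0 N) (Y\<^sub>0 N) (X\<^sub>0 N) (m N) (\<pi> N)"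
    and sample:
      "\<And>N. N \<ge> 1 \<Longrightarrow> crossfit_sample (M N) N (p N) K
         (distr (Q N) (obs_space (p N)) (\<lambda>\<omega>. obs (R\<^sub>0 N \<omega>) (Y\<^sub>0 N \<omega>) (X\<^sub>0 N \<omega>)))
         (R N) (Y N) (X N) (I N) (mhat N)"
    and \<mu>_measurable: "\<And>N. N \<ge> 1 \<Longrightarrow> \<mu> N \<in> borel_measurable (cov_space (p N))"
    and ignorability:
      "\<And>N. N \<ge> 1 \<Longrightarrow> cond_indep_given (Q N) (sigma_of (Q N) (p N) (X\<^sub>0 N)) (R\<^sub>0 N) (Y\<^sub>0 N)"
    and v_pos: "v\<^sub>1 > 0" "v\<^sub>2 > 0"
    and basic:
      "\<And>N. N \<ge> 1 \<Longrightarrow>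
         basic_assumption (Q N) (p N) (R\<^sub>0 N) (Y\<^sub>0 N) (X\<^sub>0 N) (m N) (\<mu> N) v\<^sub>1 v\<^sub>2"
    and Na: "filterlim (\<lambda>N. real N * a N) at_top sequentially"
    and c_nonneg: "\<And>N. c\<^sub>\<mu> N \<ge> 0"
    and c_null: "c\<^sub>\<mu> \<longlonglongrightarrow> 0"
    and limit:
      "\<And>k. k \<in> {1..K} \<Longrightarrow>
         Op M (\<lambda>N \<omega>. weighted_sq_error (Q N) (p N) (X\<^sub>0 N) (\<pi> N) (fit N k \<omega>) (\<mu> N))
            (\<lambda>N. (c\<^sub>\<mu> N)\<^sup>2)"
  shows
    "Op_real M
       (\<lambda>N \<omega>. (\<theta> N \<omega> - \<theta>\<^sub>0 N) - (\<Sum>i=1..N. \<psi> N (R N i \<omega>) (Y N i \<omega>) (X N i \<omega>)) / real N)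
       (\<lambda>N. c\<^sub>\<mu> N / sqrt (real N * a N)) \<and>
     same_order V (\<lambda>N. 1 / a N) \<and>
     (\<forall>N\<ge>1. integrable (Q N) (\<lambda>\<omega>. \<psi>\<^sub>t N (R\<^sub>0 N \<omega>) (Y\<^sub>0 N \<omega>) (X\<^sub>0 N \<omega>)) \<and>
        prob_space.expectation (Q N) (\<lambda>\<omega>. \<psi>\<^sub>t N (R\<^sub>0 N \<omega>) (Y\<^sub>0 N \<omega>) (X\<^sub>0 N \<omega>)) = 0) \<and>
     Op_real M
       (\<lambda>N \<omega>. (\<theta> N \<omega> - \<theta>\<^sub>0 N) - (\<Sum>i=1..N. \<psi>\<^sub>t N (R N i \<omega>) (Y N i \<omega>) (X N i \<omega>)) / real N)
       (\<lambda>N. c\<^sub>\<mu> N / sqrt (real N * a N) + 1 / sqrt (real N)) \<and>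
     same_order V\<^sub>t (\<lambda>N. 1 / a N) \<and>
     ((\<forall>c>0. (\<lambda>N. 1 / a N *
           prob_space.expectation (Q N)
             (\<lambda>\<omega>. (\<psi> N (R\<^sub>0 N \<omega>) (Y\<^sub>0 N \<omega>) (X\<^sub>0 N \<omega>))\<^sup>2 *
                   indicator {t. \<bar>t\<bar> > c * sqrt (real N / a N)}
                     (\<psi> N (R\<^sub>0 N \<omega>) (Y\<^sub>0 N \<omega>) (X\<^sub>0 N \<omega>)))) \<longlonglongrightarrow> 0) \<longrightarrow>
        Op_real M (\<lambda>N \<omega>. sqrt (real N * a N) * (\<theta> N \<omega> - \<theta>\<^sub>0 N)) (\<lambda>N. 1) \<and>
        weak_conv_m
          (\<lambda>N. distr (M N) borel (\<lambda>\<omega>. sqrt (real N) / sqrt (V N) * (\<theta> N \<omega> - \<theta>\<^sub>0 N)))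
          std_normal_distribution \<and>
        (a \<longlonglongrightarrow> 0 \<longrightarrow>
           weak_conv_m
             (\<lambda>N. distr (M N) borel (\<lambda>\<omega>. sqrt (real N) / sqrt (V\<^sub>t N) * (\<theta> N \<omega> - \<theta>\<^sub>0 N)))
             std_normal_distribution \<and>
           (\<lambda>N. V N / V\<^sub>t N - 1) \<in> O(a)))"
proof -

  \<comment> \<open>Facts for each fixed sample size\<close>
  have prob: "prob_space (M N)" if "N \<ge> 1" for N
    using sample[OF that] by (rule crossfit_sample.axioms(1))
  have smp: "aipw_sample (Q N) (p N) (R\<^sub>0 N) (Y\<^sub>0 N) (X\<^sub>0 N) (m N) (\<pi> N) (\<mu> N) v\<^sub>1 v\<^sub>2
      (M N) N K (R N) (Y N) (X N) (I N) (mhat N)" if "N \<ge> 1" for N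
    by (intro aipw_sample.intro aipw_population.intro aipw_population_axioms.intro
        aipw_sample_axioms.intro) (use that population sample \<mu>_measurable ignorability v_pos basic in auto)
  define \<psi>\<^sub>0 where "\<psi>\<^sub>0 N \<omega> = \<psi> N (R\<^sub>0 N \<omega>) (Y\<^sub>0 N \<omega>) (X\<^sub>0 N \<omega>)" for N \<omega>
  define \<Psi> where "\<Psi> N i \<omega> = \<psi> N (R N i \<omega>) (Y N i \<omega>) (X N i \<omega>)" for N i \<omega>
  define S where "S N \<omega> = (\<Sum>i=1..N. \<Psi> N i \<omega>)" for N \<omega>
  define \<mu>\<^sub>0 where "\<mu>\<^sub>0 N = prob_space.expectation (Q N) (\<lambda>\<omega>. \<mu> N (X\<^sub>0 N \<omega>))" for N
  define Sm where "Sm N \<omega> = (\<Sum>i=1..N. \<mu> N (X N i \<omega>) - \<mu>\<^sub>0 N)" for N \<omega>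
  have a_nonneg: "a N \<ge> 0" for N by (simp add: a_def a_rate_def)

  \<comment> \<open>Block remainders exist only inside the locale of one sample size. Their
    properties are packed into \<open>good\<close> so that choice yields one family \<open>b\<close>
    over all sample sizes.\<close>
  define good where "good N b \<longleftrightarrow> (\<forall>k\<in>{1..K}. b k \<in> borel_measurable (M N) \<and>
        (\<lambda>\<omega>. weighted_sq_error (Q N) (p N) (X\<^sub>0 N) (\<pi> N) (fit N k \<omega>) (\<mu> N)) \<in> borel_measurable (M N) \<and>
        (\<forall>B\<ge>0. (\<integral>\<^sup>+\<omega>. indicator {\<omega> \<in> space (M N). weighted_sq_error (Q N) (p N) (X\<^sub>0 N) (\<pi> N) (fit N k \<omega>) (\<mu> N) \<le> ennreal B} \<omega> *
          ennreal ((b k \<omega>)\<^sup>2) \<partial>M N) \<le> ennreal (real N * (B / a N)))) \<and>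
      (\<forall>\<omega>\<in>space (M N). (\<theta> N \<omega> - \<theta>\<^sub>0 N) - S N \<omega> / real N = (\<Sum>k\<in>{1..K}. b k \<omega> / real N))" for N b
  have "\<exists>b. N \<ge> 1 \<longrightarrow> good N b" for N
  proof (cases "N \<ge> 1")
    case True
    interpret S: aipw_sample "Q N" "p N" "R\<^sub>0 N" "Y\<^sub>0 N" "X\<^sub>0 N" "m N" "\<pi> N" "\<mu> N" v\<^sub>1 v\<^sub>2
      "M N" N K "R N" "Y N" "X N" "I N" "mhat N" by (rule smp[OF True])
    have fit: "S.fit = fit N" by (simp add: fun_eq_iff S.fit_def fit_def)
    have theta: "S.theta = \<theta> N" by (simp add: fun_eq_iff S.theta_def \<theta>_def)
    have psi: "S.pop.psi = \<psi> N" by (simp add: fun_eq_iff S.pop.psi_def \<psi>_def \<theta>\<^sub>0_def)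
    show ?thesis
      using S.block_remainder_measurable S.sq_error_fit_measurable S.nn_integral_block_remainder_le
        S.theta_expansion
      unfolding fit theta psi good_def by (intro exI[of _ S.block_remainder]) (simp add: a_def \<theta>\<^sub>0_def S_def \<Psi>_def)
  qed simp
  then obtain b where "\<And>N. N \<ge> 1 \<longrightarrow> good N (b N)"
    using choice[of "\<lambda>N b. N \<ge> 1 \<longrightarrow> good N b"] by blast
  then have b_all: "good N (b N)" if "N \<ge> 1" for N using that by blast
  have b: "b N k \<in> borel_measurable (M N)"
      "(\<lambda>\<omega>. weighted_sq_error (Q N) (p N) (X\<^sub>0 N) (\<pi> N) (fit N k \<omega>) (\<mu> N)) \<in> borel_measurable (M N)"
      "B \<ge> 0 \<Longrightarrow> (\<integral>\<^sup>+\<omega>. indicator {\<omega> \<in> space (M N). weighted_sq_error (Q N) (p N) (X\<^sub>0 N) (\<pi> N) (fit N k \<omega>) (\<mu> N) \<le> ennreal B} \<omega> *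
          ennreal ((b N k \<omega>)\<^sup>2) \<partial>M N) \<le> ennreal (real N * (B / a N))"
    if "N \<ge> 1" "k \<in> {1..K}" for N k B
    using b_all[OF that(1)] that(2) unfolding good_def by blast+
  have expansion: "(\<theta> N \<omega> - \<theta>\<^sub>0 N) - S N \<omega> / real N = (\<Sum>k\<in>{1..K}. b N k \<omega> / real N)"
    if "N \<ge> 1" "\<omega> \<in> space (M N)" for N \<omega>
    using b_all[OF that(1)] that(2) unfolding good_def by blast

  have \<theta>_meas: "\<theta> N \<in> borel_measurable (M N)"
    and a_pos: "a N > 0" and a_le: "a N \<le> 1"
    and V_bounds: "v\<^sub>1 / a N \<le> V N" "V N \<le> v\<^sub>2 / a N" "v\<^sub>1 / a N \<le> V\<^sub>t N" "V\<^sub>t N \<le> v\<^sub>2 / a N"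
      "\<bar>V N - V\<^sub>t N\<bar> \<le> v\<^sub>2"
    and \<psi>\<^sub>t_int: "integrable (Q N) (\<lambda>\<omega>. \<psi>\<^sub>t N (R\<^sub>0 N \<omega>) (Y\<^sub>0 N \<omega>) (X\<^sub>0 N \<omega>))"
    and \<psi>\<^sub>t_mean: "prob_space.expectation (Q N) (\<lambda>\<omega>. \<psi>\<^sub>t N (R\<^sub>0 N \<omega>) (Y\<^sub>0 N \<omega>) (X\<^sub>0 N \<omega>)) = 0"
    and \<psi>\<^sub>t_eq: "\<And>r y x. \<psi>\<^sub>t N r y x = \<psi> N r y x - (\<mu> N x - \<mu>\<^sub>0 N)"
    and \<psi>\<^sub>0_meas: "\<psi>\<^sub>0 N \<in> borel_measurable (Q N)"
    and \<psi>\<^sub>0_sq: "integrable (Q N) (\<lambda>\<omega>. (\<psi>\<^sub>0 N \<omega>)\<^sup>2)"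
    and \<psi>\<^sub>0_mean: "(LINT \<omega>|Q N. \<psi>\<^sub>0 N \<omega>) = 0"
    and \<psi>\<^sub>0_var: "(LINT \<omega>|Q N. (\<psi>\<^sub>0 N \<omega>)\<^sup>2) = V N"
    and \<Psi>_meas: "\<And>i. i \<in> {1..N} \<Longrightarrow> \<Psi> N i \<in> borel_measurable (M N)"
    and \<Psi>_indep: "prob_space.indep_vars (M N) (\<lambda>_. borel) (\<Psi> N) {1..N}"
    and \<Psi>_law: "\<And>i. i \<in> {1..N} \<Longrightarrow> distr (M N) borel (\<Psi> N i) = distr (Q N) borel (\<psi>\<^sub>0 N)"
    and S_second: "(\<integral>\<^sup>+\<omega>. ennreal ((S N \<omega>)\<^sup>2) \<partial>M N) \<le> ennreal (real N * (v\<^sub>2 / a N))"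
    and Sm_second: "(\<integral>\<^sup>+\<omega>. ennreal ((Sm N \<omega>)\<^sup>2) \<partial>M N) \<le> ennreal (real N * (4 * v\<^sub>2))"
    and Sm_meas: "Sm N \<in> borel_measurable (M N)"
    and probQ: "prob_space (Q N)"
    if N: "N \<ge> 1" for N
  proof -
    interpret S: aipw_sample "Q N" "p N" "R\<^sub>0 N" "Y\<^sub>0 N" "X\<^sub>0 N" "m N" "\<pi> N" "\<mu> N" v\<^sub>1 v\<^sub>2
      "M N" N K "R N" "Y N" "X N" "I N" "mhat N" by (rule smp[OF N])
    have theta: "S.theta = \<theta> N" by (simp add: fun_eq_iff S.theta_def \<theta>_def)
    have psi: "S.pop.psi = \<psi> N" by (simp add: fun_eq_iff S.pop.psi_def \<psi>_def \<theta>\<^sub>0_def)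
    have a: "S.pop.a = a N" by (simp add: a_def)
    show "prob_space (Q N)" by unfold_locales
    show "\<theta> N \<in> borel_measurable (M N)" using S.theta_measurable by (simp add: theta)
    show "a N > 0" "a N \<le> 1" using S.pop.a_pos S.pop.a_le_1 by (simp_all add: a)
    let ?e = "S.pop.expectation (\<lambda>\<omega>. ipw_residual (\<pi> N) (\<mu> N) (R\<^sub>0 N \<omega>) (Y\<^sub>0 N \<omega>) (X\<^sub>0 N \<omega>))"
    show "integrable (Q N) (\<lambda>\<omega>. \<psi>\<^sub>t N (R\<^sub>0 N \<omega>) (Y\<^sub>0 N \<omega>) (X\<^sub>0 N \<omega>))"
      unfolding \<psi>\<^sub>t_def using S.pop.ipw_integrable by simp
    show mean: "S.pop.expectation (\<lambda>\<omega>. \<psi>\<^sub>t N (R\<^sub>0 N \<omega>) (Y\<^sub>0 N \<omega>) (X\<^sub>0 N \<omega>)) = 0"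
      unfolding \<psi>\<^sub>t_def using S.pop.ipw_integrable by (simp add: S.pop.prob_space)
    have V: "S.pop.V = V N" by (simp add: V_def psi)
    have V': "S.pop.V' = V\<^sub>t N"
      unfolding V\<^sub>t_def mean by (simp add: \<psi>\<^sub>t_def)
    show "v\<^sub>1 / a N \<le> V N" "V N \<le> v\<^sub>2 / a N" "v\<^sub>1 / a N \<le> V\<^sub>t N" "V\<^sub>t N \<le> v\<^sub>2 / a N"
      "\<bar>V N - V\<^sub>t N\<bar> \<le> v\<^sub>2"
      using S.pop.variance_bounds unfolding V V' a by auto
    have e: "?e = \<theta>\<^sub>0 N - \<mu>\<^sub>0 N"
      by (simp only: S.pop.ipw_expectation \<theta>\<^sub>0_def \<mu>\<^sub>0_def)
    show "\<psi>\<^sub>t N r y x = \<psi> N r y x - (\<mu> N x - \<mu>\<^sub>0 N)" for r y x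
      by (simp add: \<psi>\<^sub>t_def e) (simp add: ipw_residual_def \<psi>_def)
    have \<psi>\<^sub>0: "\<psi>\<^sub>0 N = (\<lambda>\<omega>. S.pop.psi (R\<^sub>0 N \<omega>) (Y\<^sub>0 N \<omega>) (X\<^sub>0 N \<omega>))"
      by (simp add: fun_eq_iff \<psi>\<^sub>0_def psi)
    have \<Psi>: "\<Psi> N = (\<lambda>i \<omega>. S.pop.psi (R N i \<omega>) (Y N i \<omega>) (X N i \<omega>))"
      by (simp add: fun_eq_iff \<Psi>_def psi)
    show "\<psi>\<^sub>0 N \<in> borel_measurable (Q N)"
      unfolding \<psi>\<^sub>0 S.pop.psi_def by measurable
    show "integrable (Q N) (\<lambda>\<omega>. (\<psi>\<^sub>0 N \<omega>)\<^sup>2)"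
      unfolding \<psi>\<^sub>0 by (rule S.pop.psi_square_integrable)
    show m0: "(LINT \<omega>|Q N. \<psi>\<^sub>0 N \<omega>) = 0"
      unfolding \<psi>\<^sub>0 by (rule S.pop.psi_expectation)
    show "(LINT \<omega>|Q N. (\<psi>\<^sub>0 N \<omega>)\<^sup>2) = V N"
      unfolding V[symmetric] S.pop.psi_expectation by (simp add: \<psi>\<^sub>0)
    show \<Psi>m: "\<Psi> N i \<in> borel_measurable (M N)" if "i \<in> {1..N}" for i
      unfolding \<Psi> by (rule S.psi_measurable[OF that])
    show "S.indep_vars (\<lambda>_. borel) (\<Psi> N) {1..N}"
      unfolding \<Psi> by (rule S.psi_indep)
    show "distr (M N) borel (\<Psi> N i) = distr (Q N) borel (\<psi>\<^sub>0 N)" if "i \<in> {1..N}" for i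
      unfolding \<Psi> \<psi>\<^sub>0 by (rule S.psi_law[OF that])
    show "(\<integral>\<^sup>+\<omega>. ennreal ((S N \<omega>)\<^sup>2) \<partial>M N) \<le> ennreal (real N * (v\<^sub>2 / a N))"
      using S.nn_integral_sum_psi_le by (simp add: S_def \<Psi> a)
    show "(\<integral>\<^sup>+\<omega>. ennreal ((Sm N \<omega>)\<^sup>2) \<partial>M N) \<le> ennreal (real N * (4 * v\<^sub>2))"
      using S.nn_integral_sum_\<mu>_le by (simp add: Sm_def \<mu>\<^sub>0_def)
    show "Sm N \<in> borel_measurable (M N)"
      unfolding Sm_def
      by (intro borel_measurable_sum borel_measurable_diff borel_measurable_const
          measurable_compose[OF S.X_measurable S.pop.\<mu>_measurable])
  qed
  have S_meas: "S N \<in> borel_measurable (M N)" if "N \<ge> 1" for N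
    unfolding S_def using \<Psi>_meas[OF that] by (rule borel_measurable_sum)

  \<comment> \<open>Orders of the remainder and of the leading averages\<close>
  define U where "U N \<omega> = (\<theta> N \<omega> - \<theta>\<^sub>0 N) - S N \<omega> / real N" for N \<omega>
  define r where "r N = c\<^sub>\<mu> N / sqrt (real N * a N)" for N
  have r_nonneg: "r N \<ge> 0" for N using c_nonneg a_nonneg by (simp add: r_def)
  have block: "Op_real M (\<lambda>N \<omega>. b N k \<omega> / real N) r" if k: "k \<in> {1..K}" for k
    unfolding r_def
  proof (rule Op_real_mean_truncated[OF prob c_nonneg a_nonneg a_pos b(1)[OF _ k]])
    fix \<epsilon> :: real assume "\<epsilon> > 0"
    let ?W = "\<lambda>N \<omega>. weighted_sq_error (Q N) (p N) (X\<^sub>0 N) (\<pi> N) (fit N k \<omega>) (\<mu> N)"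
    \<comment> \<open>The constant \<open>C\<close> of the stochastic bound on the fit serves as
      \<open>B\<close>; the truncation event \<open>E\<close> is where the weighted error is at most
      \<open>C\<close> times the squared rate.\<close>
    from limit[OF k, unfolded Op_def, rule_format, OF \<open>\<epsilon> > 0\<close>] obtain C where "C > 0"
      and C0: "\<forall>\<^sub>F N in sequentially. ?W N \<in> borel_measurable (M N) \<and>
        measure (M N) {\<omega> \<in> space (M N). ?W N \<omega> > ennreal (C * (c\<^sub>\<mu> N)\<^sup>2)} \<le> \<epsilon>"
      by blast
    have C: "\<forall>\<^sub>F N in sequentially.
        measure (M N) {\<omega> \<in> space (M N). ?W N \<omega> > ennreal (C * (c\<^sub>\<mu> N)\<^sup>2)} \<le> \<epsilon>"
      by (rule eventually_mono[OF C0]) simp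
    from C eventually_ge_at_top[of 1]
    have "\<forall>\<^sub>F N in sequentially. \<exists>E\<in>sets (M N). measure (M N) (space (M N) - E) \<le> \<epsilon> \<and>
      (\<integral>\<^sup>+\<omega>. indicator E \<omega> * ennreal ((b N k \<omega>)\<^sup>2) \<partial>M N) \<le> ennreal (real N * (C * (c\<^sub>\<mu> N)\<^sup>2 / a N))"
    proof eventually_elim
      case (elim N)
      let ?E = "{\<omega> \<in> space (M N). ?W N \<omega> \<le> ennreal (C * (c\<^sub>\<mu> N)\<^sup>2)}"
      note [measurable] = b(2)[OF elim(2) k]
      have "?E \<in> sets (M N)" by measurable
      moreover have "space (M N) - ?E = {\<omega> \<in> space (M N). ?W N \<omega> > ennreal (C * (c\<^sub>\<mu> N)\<^sup>2)}"
        by (auto simp: not_le)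
      ultimately show ?case
        using elim(1) b(3)[OF elim(2) k, of "C * (c\<^sub>\<mu> N)\<^sup>2"] \<open>C > 0\<close>
        by (intro bexI[of _ ?E]) auto
    qed
    with \<open>C > 0\<close> show "\<exists>B>0. \<forall>\<^sub>F N in sequentially. \<exists>E\<in>sets (M N). measure (M N) (space (M N) - E) \<le> \<epsilon> \<and>
      (\<integral>\<^sup>+\<omega>. indicator E \<omega> * ennreal ((b N k \<omega>)\<^sup>2) \<partial>M N) \<le> ennreal (real N * (B * (c\<^sub>\<mu> N)\<^sup>2 / a N))"
      by blast
  qed
  have ev1: "\<forall>\<^sub>F N in sequentially. P N" if "\<And>N. N \<ge> 1 \<Longrightarrow> P N" for P :: "nat \<Rightarrow> bool"
    using eventually_ge_at_top[of 1] by eventually_elim (rule that)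
  have Op_U: "Op_real M U r"
  proof (rule Op_real_cong[OF _ r_nonneg])
    show "Op_real M (\<lambda>N \<omega>. \<Sum>k\<in>{1..K}. b N k \<omega> / real N) r"
      by (rule Op_real_sum[OF prob r_nonneg _ block]) auto
    show "\<forall>\<^sub>F N in sequentially. \<forall>\<omega>\<in>space (M N). (\<Sum>k\<in>{1..K}. b N k \<omega> / real N) = U N \<omega>"
      by (rule ev1) (simp add: U_def expansion)
  qed
  define q where "q N = 1 / sqrt (real N * a N)" for N
  have q_nonneg: "q N \<ge> 0" for N using a_nonneg by (simp add: q_def)
  have Op_S: "Op_real M (\<lambda>N \<omega>. S N \<omega> / real N) q"
    unfolding q_def by (rule Op_real_mean[OF prob a_nonneg a_pos S_meas v_pos(2) S_second])
  have Op_Sm: "Op_real M (\<lambda>N \<omega>. Sm N \<omega> / real N) (\<lambda>N. 1 / sqrt (real N))"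
    using Op_real_mean[where s="\<lambda>_. 1" and S=Sm and B="4 * v\<^sub>2", OF prob] Sm_meas Sm_second v_pos by simp

  have part1: "Op_real M (\<lambda>N \<omega>. (\<theta> N \<omega> - \<theta>\<^sub>0 N) - (\<Sum>i=1..N. \<psi> N (R N i \<omega>) (Y N i \<omega>) (X N i \<omega>)) / real N)
       (\<lambda>N. c\<^sub>\<mu> N / sqrt (real N * a N))"
    using Op_U by (simp add: U_def[abs_def] r_def[abs_def] S_def \<Psi>_def)
  \<comment> \<open>The variance bounds are weak inequalities and \<open>same_order\<close> asks for
    strict ones; hence the factors \<open>1 / 2\<close> and \<open>2\<close>.\<close>
  have order: "same_order W (\<lambda>N. 1 / a N)" if "\<And>N. N \<ge> 1 \<Longrightarrow> v\<^sub>1 / a N \<le> W N \<and> W N \<le> v\<^sub>2 / a N" for W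
  proof -
    have "\<forall>\<^sub>F N in sequentially. v\<^sub>1 / 2 * (1 / a N) < W N \<and> W N < 2 * v\<^sub>2 * (1 / a N)"
    proof (rule ev1)
      fix N :: nat assume N: "N \<ge> 1"
      have "v\<^sub>1 / 2 * (1 / a N) < v\<^sub>1 / a N" "v\<^sub>2 / a N < 2 * v\<^sub>2 * (1 / a N)"
        using v_pos a_pos[OF N] by (simp_all add: field_simps)
      then show "v\<^sub>1 / 2 * (1 / a N) < W N \<and> W N < 2 * v\<^sub>2 * (1 / a N)"
        using that[OF N] by linarith
    qed
    moreover have "v\<^sub>1 / 2 > 0" "2 * v\<^sub>2 > 0" using v_pos by simp_all
    ultimately show ?thesis unfolding same_order_def by blast
  qed
  have part2: "Op_real M
       (\<lambda>N \<omega>. (\<theta> N \<omega> - \<theta>\<^sub>0 N) - (\<Sum>i=1..N. \<psi>\<^sub>t N (R N i \<omega>) (Y N i \<omega>) (X N i \<omega>)) / real N)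
       (\<lambda>N. c\<^sub>\<mu> N / sqrt (real N * a N) + 1 / sqrt (real N))"
  proof (rule Op_real_cong)
    let ?r = "\<lambda>N. c\<^sub>\<mu> N / sqrt (real N * a N) + 1 / sqrt (real N)"
    show r0: "0 \<le> ?r N" for N using r_nonneg[of N] by (simp add: r_def)
    have 1: "Op_real M U ?r"
      by (rule Op_real_mono[OF prob r_nonneg r0 _ _ Op_U, where D = 1]) (auto simp: r_def)
    \<comment> \<open>The two influence functions differ by \<open>\<mu>(X)\<close> minus its mean,
      so passing from one average to the other adds \<open>Sm N / N\<close>.\<close>
    have 2: "Op_real M (\<lambda>N \<omega>. Sm N \<omega> / real N) ?r"
      by (rule Op_real_mono[OF prob _ r0 _ _ Op_Sm, where D = 1]) (use r_nonneg in \<open>auto simp: r_def\<close>)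
    show "Op_real M (\<lambda>N \<omega>. U N \<omega> + Sm N \<omega> / real N) ?r"
      by (rule Op_real_add[OF prob r0 1 2])
    show "\<forall>\<^sub>F N in sequentially. \<forall>\<omega>\<in>space (M N). U N \<omega> + Sm N \<omega> / real N =
        (\<theta> N \<omega> - \<theta>\<^sub>0 N) - (\<Sum>i=1..N. \<psi>\<^sub>t N (R N i \<omega>) (Y N i \<omega>) (X N i \<omega>)) / real N"
      by (rule ev1) (simp add: \<psi>\<^sub>t_eq U_def S_def \<Psi>_def Sm_def sum_subtractf diff_divide_distrib)
  qed

  \<comment> \<open>A convergent rate is bounded, so the remainder has at most the order
    \<open>q\<close> of the leading average.\<close>
  obtain c' where c': "c' > 0" "\<And>N. c\<^sub>\<mu> N \<le> c'"
    using convergent_imp_Bseq[OF convergentI[OF c_null]] c_nonneg by (auto simp: Bseq_def)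
  have Op_\<theta>: "Op_real M (\<lambda>N \<omega>. \<theta> N \<omega> - \<theta>\<^sub>0 N) q"
  proof (rule Op_real_cong[OF _ q_nonneg])
    have 1: "Op_real M U q"
    proof (rule Op_real_mono[OF prob r_nonneg q_nonneg c'(1) _ Op_U])
      show "r N \<le> c' * q N" for N
        using c'(2)[of N] a_nonneg by (simp add: r_def q_def divide_right_mono)
    qed
    show "Op_real M (\<lambda>N \<omega>. U N \<omega> + S N \<omega> / real N) q"
      by (rule Op_real_add[OF prob q_nonneg 1 Op_S])
  qed (simp add: U_def)

  have part3: "Op_real M (\<lambda>N \<omega>. sqrt (real N * a N) * (\<theta> N \<omega> - \<theta>\<^sub>0 N)) (\<lambda>N. 1)"
    by (rule Op_real_mono[OF prob _ _ _ _ Op_real_cmult[OF prob q_nonneg Op_\<theta>], where D = 1])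
      (use a_nonneg in \<open>auto simp: q_def\<close>)

  \<comment> \<open>Asymptotic normality\<close>
  have V_pos: "V N > 0" "V\<^sub>t N > 0" if "N \<ge> 1" for N
    using V_bounds(1,3)[OF that] v_pos a_pos[OF that]
    by (auto intro: less_le_trans[OF divide_pos_pos])
  \<comment> \<open>The normalised leading average. Both limit laws are obtained as perturbations of
    this variable.\<close>
  define A where "A N \<omega> = S N \<omega> / sqrt (real N * V N)" for N \<omega>
  have A_meas: "A N \<in> borel_measurable (M N)" if "N \<ge> 1" for N
    unfolding A_def using S_meas[OF that] by simp
  have real_dist: "real_distribution std_normal_distribution" by (rule real_dist_normal_dist)
  have null_part: "(\<lambda>N. measure (M N) {\<omega> \<in> space (M N). \<bar>sqrt (real N) / sqrt (V N) * U N \<omega>\<bar> > \<epsilon>}) \<longlonglongrightarrow> 0"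
    and Op_null: "Op_real M (\<lambda>N \<omega>. sqrt (real N) / sqrt (V N) * U N \<omega>) c\<^sub>\<mu>" if "\<epsilon> > 0" for \<epsilon>
  proof -
    show *: "Op_real M (\<lambda>N \<omega>. sqrt (real N) / sqrt (V N) * U N \<omega>) c\<^sub>\<mu>"
    \<comment> \<open>After normalisation the remainder has order
      \<open>c\<^sub>\<mu> / sqrt (V * a)\<close>, and \<open>V * a\<close> is at least
      \<open>v\<^sub>1\<close>.\<close>
    proof (rule Op_real_mono[OF prob _ c_nonneg _ _ Op_real_cmult[OF prob r_nonneg Op_U], where D = "1 / sqrt v\<^sub>1"])
      show "\<bar>sqrt (real N) / sqrt (V N)\<bar> * r N \<le> 1 / sqrt v\<^sub>1 * c\<^sub>\<mu> N" for N
      proof (cases "N \<ge> 1")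
        case True
        have "v\<^sub>1 \<le> V N * a N" using V_bounds(1)[OF True] a_pos[OF True] by (simp add: field_simps)
        then have "sqrt v\<^sub>1 \<le> sqrt (V N) * sqrt (a N)" by (simp flip: real_sqrt_mult)
        then have "1 / (sqrt (V N) * sqrt (a N)) \<le> 1 / sqrt v\<^sub>1"
          using v_pos by (intro divide_left_mono) (auto intro!: mult_pos_pos simp: V_pos[OF True] a_pos[OF True])
        then have "1 / (sqrt (V N) * sqrt (a N)) * c\<^sub>\<mu> N \<le> 1 / sqrt v\<^sub>1 * c\<^sub>\<mu> N"
          by (rule mult_right_mono) (rule c_nonneg)
        also have "1 / (sqrt (V N) * sqrt (a N)) * c\<^sub>\<mu> N = \<bar>sqrt (real N) / sqrt (V N)\<bar> * r N"
          using True V_pos[OF True] by (simp add: r_def real_sqrt_mult)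
        finally show ?thesis .
      next
        case False
        then show ?thesis using c_nonneg v_pos by (simp add: not_le)
      qed
    qed (use v_pos r_nonneg in auto)
    show "(\<lambda>N. measure (M N) {\<omega> \<in> space (M N). \<bar>sqrt (real N) / sqrt (V N) * U N \<omega>\<bar> > \<epsilon>}) \<longlonglongrightarrow> 0"
      by (rule Op_real_null_imp_tendsto[OF prob c_nonneg c_null * that])
  qed
  have B_eq: "sqrt (real N) / sqrt (V N) * (\<theta> N \<omega> - \<theta>\<^sub>0 N) - A N \<omega> = sqrt (real N) / sqrt (V N) * U N \<omega>"
    if "N \<ge> 1" for N \<omega>
  proof -
    have "A N \<omega> = sqrt (real N) / sqrt (V N) * (S N \<omega> / real N)"
      using that V_pos[OF that]
      by (simp add: A_def real_sqrt_mult field_simps)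
    then show ?thesis by (simp add: U_def right_diff_distrib)
  qed
  have tail: "\<forall>c>0. (\<lambda>N. 1 / a N * (LINT \<omega>|Q N. (\<psi>\<^sub>0 N \<omega>)\<^sup>2 * indicator {t. \<bar>t\<bar> > c * sqrt (real N / a N)} (\<psi>\<^sub>0 N \<omega>))) \<longlonglongrightarrow> 0 \<Longrightarrow>
      weak_conv_m (\<lambda>N. distr (M N) borel (\<lambda>\<omega>. sqrt (real N) / sqrt (V N) * (\<theta> N \<omega> - \<theta>\<^sub>0 N))) std_normal_distribution \<and>
      (a \<longlonglongrightarrow> 0 \<longrightarrow> weak_conv_m (\<lambda>N. distr (M N) borel (\<lambda>\<omega>. sqrt (real N) / sqrt (V\<^sub>t N) * (\<theta> N \<omega> - \<theta>\<^sub>0 N))) std_normal_distribution)"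
  proof (intro conjI impI)
    assume tail: "\<forall>c>0. (\<lambda>N. 1 / a N * (LINT \<omega>|Q N. (\<psi>\<^sub>0 N \<omega>)\<^sup>2 * indicator {t. \<bar>t\<bar> > c * sqrt (real N / a N)} (\<psi>\<^sub>0 N \<omega>))) \<longlonglongrightarrow> 0"
    have lindeberg: "(\<lambda>N. (LINT \<omega>|Q N. (\<psi>\<^sub>0 N \<omega>)\<^sup>2 * indicator {u. \<bar>u\<bar> > \<epsilon> * sqrt (real N * V N)} (\<psi>\<^sub>0 N \<omega>)) / V N) \<longlonglongrightarrow> 0"
      if "\<epsilon> > 0" for \<epsilon>
    proof (rule Lim_null_comparison)
      \<comment> \<open>As \<open>V\<close> is at least \<open>v\<^sub>1 / a\<close>, the Lindeberg
        level is no lower than \<open>\<epsilon> * sqrt v\<^sub>1\<close> times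
        \<open>sqrt (N / a)\<close>; the tail condition is used with that constant.\<close>
      let ?T = "\<lambda>N. LINT \<omega>|Q N. (\<psi>\<^sub>0 N \<omega>)\<^sup>2 * indicator {t. \<bar>t\<bar> > (\<epsilon> * sqrt v\<^sub>1) * sqrt (real N / a N)} (\<psi>\<^sub>0 N \<omega>)"
      have "\<epsilon> * sqrt v\<^sub>1 > 0" using \<open>\<epsilon> > 0\<close> v_pos by simp
      then have "(\<lambda>N. 1 / a N * ?T N) \<longlonglongrightarrow> 0" using tail by blast
      then show "(\<lambda>N. 1 / v\<^sub>1 * (1 / a N * ?T N)) \<longlonglongrightarrow> 0" by (rule tendsto_mult_right_zero)
      show "\<forall>\<^sub>F N in sequentially. norm ((LINT \<omega>|Q N. (\<psi>\<^sub>0 N \<omega>)\<^sup>2 * indicator {u. \<bar>u\<bar> > \<epsilon> * sqrt (real N * V N)} (\<psi>\<^sub>0 N \<omega>)) / V N)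
          \<le> 1 / v\<^sub>1 * (1 / a N * ?T N)"
      proof (rule ev1)
        fix N :: nat assume N: "N \<ge> 1"
        note [measurable] = \<psi>\<^sub>0_meas[OF N]
        let ?L = "LINT \<omega>|Q N. (\<psi>\<^sub>0 N \<omega>)\<^sup>2 * indicator {u. \<bar>u\<bar> > \<epsilon> * sqrt (real N * V N)} (\<psi>\<^sub>0 N \<omega>)"
        have le: "sqrt v\<^sub>1 * sqrt (real N / a N) \<le> sqrt (real N * V N)"
        proof -
          have "v\<^sub>1 * (real N / a N) \<le> real N * V N"
            using mult_left_mono[OF V_bounds(1)[OF N], of "real N"] by (simp add: ac_simps)
          then show ?thesis by (simp flip: real_sqrt_mult)
        qed
        have int: "integrable (Q N) (\<lambda>\<omega>. (\<psi>\<^sub>0 N \<omega>)\<^sup>2 * indicator {u. \<bar>u\<bar> > d} (\<psi>\<^sub>0 N \<omega>))" for d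
          by (rule Bochner_Integration.integrable_bound[OF \<psi>\<^sub>0_sq[OF N]]) (auto split: split_indicator)
        have "?L \<le> ?T N"
        proof (rule integral_mono[OF int int])
          fix \<omega>
          have "\<epsilon> * sqrt v\<^sub>1 * sqrt (real N / a N) \<le> \<epsilon> * sqrt (real N * V N)"
            using le \<open>\<epsilon> > 0\<close> by (simp add: mult.assoc)
          then show "(\<psi>\<^sub>0 N \<omega>)\<^sup>2 * indicator {u. \<bar>u\<bar> > \<epsilon> * sqrt (real N * V N)} (\<psi>\<^sub>0 N \<omega>) \<le>
              (\<psi>\<^sub>0 N \<omega>)\<^sup>2 * indicator {t. \<bar>t\<bar> > (\<epsilon> * sqrt v\<^sub>1) * sqrt (real N / a N)} (\<psi>\<^sub>0 N \<omega>)"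
            by (auto split: split_indicator)
        qed
        moreover have L0: "0 \<le> ?L" by (rule integral_nonneg_AE) simp
        \<comment> \<open>Lindeberg's condition needs only the factor \<open>a\<close>; the tail condition supplies \<open>1 / a \<ge> a\<close>.\<close>
        moreover have "1 / V N \<le> 1 / v\<^sub>1 * (1 / a N)"
        proof -
          have "1 / V N \<le> 1 / (v\<^sub>1 / a N)"
            using V_bounds(1)[OF N] v_pos a_pos[OF N] V_pos[OF N]
            by (intro divide_left_mono) (auto intro!: mult_pos_pos)
          also have "\<dots> = 1 / v\<^sub>1 * a N" by simp
          also have "\<dots> \<le> 1 / v\<^sub>1 * (1 / a N)"
          proof (rule mult_left_mono)
            have "a N * a N \<le> 1 * 1" using a_le[OF N] a_nonneg by (intro mult_mono) auto
            then show "a N \<le> 1 / a N" using a_pos[OF N] by (simp add: field_simps)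
          qed (use v_pos in simp)
          finally show ?thesis .
        qed
        ultimately have "1 / V N * ?L \<le> (1 / v\<^sub>1 * (1 / a N)) * ?T N"
          using v_pos a_pos[OF N] by (intro mult_mono) auto
        then show "norm (?L / V N) \<le> 1 / v\<^sub>1 * (1 / a N * ?T N)"
          using L0 V_pos[OF N] by (simp add: abs_of_nonneg mult.assoc)
      qed
    qed
    have char: "(\<lambda>N. char (distr (M N) borel (A N)) t) \<longlonglongrightarrow> char std_normal_distribution t" for t
      unfolding A_def S_def
      by (rule lindeberg_char_tendsto[where Q = Q and \<eta> = \<psi>\<^sub>0, OF prob probQ \<Psi>_indep \<Psi>_law
            \<psi>\<^sub>0_meas \<psi>\<^sub>0_sq \<psi>\<^sub>0_mean \<psi>\<^sub>0_var V_pos(1) lindeberg]) auto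
    have Bm: "(\<lambda>\<omega>. d * (\<theta> N \<omega> - \<theta>\<^sub>0 N)) \<in> borel_measurable (M N)" if "N \<ge> 1" for N d
      using \<theta>_meas[OF that] by simp
    show "weak_conv_m (\<lambda>N. distr (M N) borel (\<lambda>\<omega>. sqrt (real N) / sqrt (V N) * (\<theta> N \<omega> - \<theta>\<^sub>0 N))) std_normal_distribution"
    proof (rule weak_conv_m_perturb[OF prob A_meas Bm real_dist char])
      fix \<epsilon> :: real assume "\<epsilon> > 0"
      show "(\<lambda>N. measure (M N) {\<omega> \<in> space (M N). \<bar>sqrt (real N) / sqrt (V N) * (\<theta> N \<omega> - \<theta>\<^sub>0 N) - A N \<omega>\<bar> > \<epsilon>}) \<longlonglongrightarrow> 0"
        by (rule Lim_transform_eventually[OF null_part[OF \<open>\<epsilon> > 0\<close>]], rule ev1) (simp only: B_eq)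
    qed
    assume a0: "a \<longlonglongrightarrow> 0"
    show "weak_conv_m (\<lambda>N. distr (M N) borel (\<lambda>\<omega>. sqrt (real N) / sqrt (V\<^sub>t N) * (\<theta> N \<omega> - \<theta>\<^sub>0 N))) std_normal_distribution"
    proof (rule weak_conv_m_perturb[OF prob A_meas Bm real_dist char])
      fix \<epsilon> :: real assume "\<epsilon> > 0"
      \<comment> \<open>The normalisation is changed from \<open>V\<close> to
        \<open>V\<^sub>t\<close>. Because the variances differ by a bounded amount while both are at
        least of order \<open>1 / a\<close>, the change acting on the estimation error is of order
        \<open>a\<close>.\<close>
      define d where "d N = sqrt (real N) / sqrt (V\<^sub>t N) - sqrt (real N) / sqrt (V N)" for N
      have r': "c\<^sub>\<mu> N + a N \<ge> 0" for N using c_nonneg[of N] a_nonneg[of N] by simp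
      have 1: "Op_real M (\<lambda>N \<omega>. sqrt (real N) / sqrt (V N) * U N \<omega>) (\<lambda>N. c\<^sub>\<mu> N + a N)"
        by (rule Op_real_mono[OF prob c_nonneg r' _ _ Op_null[OF \<open>\<epsilon> > 0\<close>], where D = 1]) (use a_nonneg in auto)
      have 2: "Op_real M (\<lambda>N \<omega>. d N * (\<theta> N \<omega> - \<theta>\<^sub>0 N)) (\<lambda>N. c\<^sub>\<mu> N + a N)"
      \<comment> \<open>With \<open>e^2 = v\<^sub>1 / a\<close> the bound below reads
        \<open>v\<^sub>2 / (e^3 * sqrt a)\<close>, and \<open>e * sqrt a\<close> is
        \<open>sqrt v\<^sub>1\<close>; this gives the constant and one factor
        \<open>a\<close>.\<close>
      proof (rule Op_real_mono[OF prob _ r' _ _ Op_real_cmult[OF prob q_nonneg Op_\<theta>], where D = "v\<^sub>2 / (v\<^sub>1 * sqrt v\<^sub>1)"])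
        show "\<bar>d N\<bar> * q N \<le> v\<^sub>2 / (v\<^sub>1 * sqrt v\<^sub>1) * (c\<^sub>\<mu> N + a N)" for N
        proof (cases "N \<ge> 1")
          case True
          define x y e where "x = sqrt (V N)" and "y = sqrt (V\<^sub>t N)" and "e = sqrt (v\<^sub>1 / a N)"
          have e: "e > 0" "e\<^sup>2 = v\<^sub>1 / a N" "e * sqrt (a N) = sqrt v\<^sub>1"
            using v_pos a_pos[OF True] by (simp_all add: e_def real_sqrt_divide power_divide)
          have x: "e \<le> x" "x\<^sup>2 = V N" and y: "e \<le> y" "y\<^sup>2 = V\<^sub>t N"
            using V_bounds(1,3)[OF True] V_pos[OF True] by (simp_all add: x_def y_def e_def)
          have pos: "x > 0" "y > 0" using e x y by linarith+
          \<comment> \<open>Rationalising turns the difference of inverse roots into the difference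
            of the variances, for which the bound \<open>v\<^sub>2\<close> is available.\<close>
          have "\<bar>1 / y - 1 / x\<bar> = \<bar>x\<^sup>2 - y\<^sup>2\<bar> / (x * y * (x + y))"
          proof -
            have "1 / y - 1 / x = (x\<^sup>2 - y\<^sup>2) / (x * y * (x + y))"
              using pos by (simp add: divide_simps) (simp add: power2_eq_square algebra_simps)
            then show ?thesis using pos by (simp add: abs_mult)
          qed
          also have "\<dots> \<le> v\<^sub>2 / (e * e * e)"
          proof (rule frac_le)
            show "\<bar>x\<^sup>2 - y\<^sup>2\<bar> \<le> v\<^sub>2" using V_bounds(5)[OF True] x y by simp
            show "e * e * e \<le> x * y * (x + y)" using e x y pos by (intro mult_mono) auto
          qed (use e v_pos in auto)
          finally have xy: "\<bar>1 / y - 1 / x\<bar> \<le> v\<^sub>2 / (e * e * e)" .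
          have "\<bar>d N\<bar> * q N = \<bar>1 / y - 1 / x\<bar> * (1 / sqrt (a N))"
          proof -
            have "d N = sqrt (real N) * (1 / y - 1 / x)"
              by (simp add: d_def x_def y_def right_diff_distrib)
            then show ?thesis using True by (simp add: q_def abs_mult real_sqrt_mult)
          qed
          also have "\<dots> \<le> v\<^sub>2 / (e * e * e) * (1 / sqrt (a N))"
            by (rule mult_right_mono[OF xy]) (use a_nonneg in simp)
          also have "\<dots> = v\<^sub>2 / (e\<^sup>2 * (e * sqrt (a N)))"
            by (simp add: power2_eq_square)
          also have "\<dots> = v\<^sub>2 / (v\<^sub>1 * sqrt v\<^sub>1) * a N"
            unfolding e using a_pos[OF True] by simp
          also have "\<dots> \<le> v\<^sub>2 / (v\<^sub>1 * sqrt v\<^sub>1) * (c\<^sub>\<mu> N + a N)"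
            using v_pos c_nonneg by (intro mult_left_mono) auto
          finally show ?thesis .
        next
          case False
          then show ?thesis using r'[of N] v_pos by (simp add: d_def not_le)
        qed
      qed (use v_pos q_nonneg in auto)
      have 3: "Op_real M (\<lambda>N \<omega>. sqrt (real N) / sqrt (V N) * U N \<omega> + d N * (\<theta> N \<omega> - \<theta>\<^sub>0 N)) (\<lambda>N. c\<^sub>\<mu> N + a N)"
        by (rule Op_real_add[OF prob r' 1 2])
      have 4: "(\<lambda>N. c\<^sub>\<mu> N + a N) \<longlonglongrightarrow> 0" using tendsto_add[OF c_null a0] by simp
      have "(\<lambda>N. measure (M N) {\<omega> \<in> space (M N).
          \<bar>sqrt (real N) / sqrt (V N) * U N \<omega> + d N * (\<theta> N \<omega> - \<theta>\<^sub>0 N)\<bar> > \<epsilon>}) \<longlonglongrightarrow> 0"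
        by (rule Op_real_null_imp_tendsto[OF prob r' 4 3 \<open>\<epsilon> > 0\<close>])
      then show "(\<lambda>N. measure (M N) {\<omega> \<in> space (M N). \<bar>sqrt (real N) / sqrt (V\<^sub>t N) * (\<theta> N \<omega> - \<theta>\<^sub>0 N) - A N \<omega>\<bar> > \<epsilon>}) \<longlonglongrightarrow> 0"
      proof (rule Lim_transform_eventually, intro ev1)
        fix N :: nat assume N: "N \<ge> 1"
        have "sqrt (real N) / sqrt (V N) * U N \<omega> + d N * (\<theta> N \<omega> - \<theta>\<^sub>0 N) =
            sqrt (real N) / sqrt (V\<^sub>t N) * (\<theta> N \<omega> - \<theta>\<^sub>0 N) - A N \<omega>" for \<omega>
          unfolding B_eq[OF N, symmetric] d_def by (simp add: left_diff_distrib)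
        then show "measure (M N) {\<omega> \<in> space (M N).
            \<bar>sqrt (real N) / sqrt (V N) * U N \<omega> + d N * (\<theta> N \<omega> - \<theta>\<^sub>0 N)\<bar> > \<epsilon>} =
          measure (M N) {\<omega> \<in> space (M N). \<bar>sqrt (real N) / sqrt (V\<^sub>t N) * (\<theta> N \<omega> - \<theta>\<^sub>0 N) - A N \<omega>\<bar> > \<epsilon>}"
          by simp
      qed
    qed
  qed
  \<comment> \<open>A difference of at most \<open>v\<^sub>2\<close> over a denominator of at least
    \<open>v\<^sub>1 / a\<close>.\<close>
  have ratio: "(\<lambda>N. V N / V\<^sub>t N - 1) \<in> O(a)"
  proof (rule bigoI[where c = "v\<^sub>2 / v\<^sub>1"], rule ev1)
    fix N :: nat assume N: "N \<ge> 1"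
    have "norm (V N / V\<^sub>t N - 1) = \<bar>V N - V\<^sub>t N\<bar> / V\<^sub>t N"
      using V_pos[OF N] by (simp add: diff_divide_distrib[symmetric] field_simps abs_divide)
    also have "\<dots> \<le> v\<^sub>2 / (v\<^sub>1 / a N)"
      using V_bounds(3,5)[OF N] v_pos a_pos[OF N] by (intro frac_le) auto
    also have "\<dots> = v\<^sub>2 / v\<^sub>1 * norm (a N)" using a_pos[OF N] by simp
    finally show "norm (V N / V\<^sub>t N - 1) \<le> v\<^sub>2 / v\<^sub>1 * norm (a N)" .
  qed
  show ?thesis
    using part1 order[of V] order[of V\<^sub>t] V_bounds \<psi>\<^sub>t_int \<psi>\<^sub>t_mean part2 part3 tail ratio
    unfolding \<psi>\<^sub>0_def by (intro conjI allI impI) blast+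
qed

end
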